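(* Let $\tilde A_1$ denote the quiver with two vertices and exactly one arrow in each direction between them, let $\bullet$ denote the quiver with one vertex and no arrows, and let $J$ denote the quiver with one vertex and one loop. Then the map $$\Psi:\mathcal{H}(\bullet)\otimes\mathcal{H}(J)\otimes\mathcal{H}(\bullet)\to\mathcal{H}(\tilde A_1),\qquad\Psi(f\otimes g\otimes h)=f*\Psi^0(g)*h,$$ is an isomorphism of algebras. Here the tensor product is the super-commutative tensor product; the first factor $\mathcal{H}(\bullet)$ is identified with the subalgebra $\bigoplus_{m\geq0}\mathcal{H}_{m\rightleftarrows0}$ of $\mathcal{H}(\tilde A_1)$, the last factor $\mathcal{H}(\bullet)$ with the subalgebra $\bigoplus_{n\geq0}\mathcal{H}_{0\rightleftarrows n}$, and $\Psi^0:\mathcal{H}(J)\to\bigoplus_{m\ge 0}\mathcal{H}_{m\rightleftarrows m}\subseteq\mathcal{H}(\tilde A_1)$ is the algebra homomorphism determined by $\phi_i\mapsto x^i\in\mathcal{H}_{1\rightleftarrows1}=\mathbb{Q}[x,y]$ for $i\geq0$.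
   Context: The Cohomological Hall algebra (CoHa) $\mathcal{H}(Q)=\bigoplus_d\mathcal{H}_d$ of a quiver $Q$ is $\mathcal{H}_d=H^*_{G_d}(R_d;\mathbb{Q})$ with $R_d=\bigoplus_{\alpha:i\to j}\mathrm{Hom}(\mathbb{C}^{d_i},\mathbb{C}^{d_j})$, $G_d=\prod_i\mathrm{GL}_{d_i}(\mathbb{C})$, and with the Hecke-correspondence multiplication $*$ of Kontsevich--Soibelman. In the three cases needed here it is explicitly as follows. $\mathcal{H}(\bullet)$: $\mathcal{H}_d=\mathbb{Q}[x_1,\ldots,x_d]^{S_d}$, $d\geq0$, and for $f\in\mathcal{H}_d$, $g\in\mathcal{H}_e$, $$f*g=\sum_\sigma f(x_{\sigma_1},\ldots,x_{\sigma_d})\,g(x_{\sigma_{d+1}},\ldots,x_{\sigma_{d+e}})\prod_{\mu=1}^d\prod_{\nu=d+1}^{d+e}(x_{\sigma_\nu}-x_{\sigma_\mu})^{-1},$$ the sum over all $(d,e)$-shuffles $\sigma$. A homogeneous $f\in\mathcal{H}_d$ of polynomial degree $k$ has bidegree $(d,2k+d^2)$; its parity is $d^2$ mod 2. $\mathcal{H}(J)$: $\mathcal{H}_d=\mathbb{Q}[t_1,\ldots,t_d]^{S_d}$, with $f*g=\sum_\sigma f(t_{\sigma_1},\ldots,t_{\sigma_d})g(t_{\sigma_{d+1}},\ldots,t_{\sigma_{d+e}})$, the sum over all $(d,e)$-shuffles. A homogeneous $f\in\mathcal{H}_d$ of polynomial degree $k$ has bidegree $(d,2k)$; everything is even. As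 an algebra, $\mathcal{H}(J)$ is the polynomial algebra $\mathbb{Q}[\phi_0,\phi_1,\ldots]$ in the elements $\phi_i(t)=t^i\in\mathcal{H}_1=\mathbb{Q}[t]$. $\mathcal{H}(\tilde A_1)$: dimension vectors are written $m\rightleftarrows n$; $\mathcal{H}_{m\rightleftarrows n}=\mathbb{Q}[x_1,\ldots,x_m,y_1,\ldots,y_n]^{S_m\times S_n}$, and for $f\in\mathcal{H}_{m\rightleftarrows n}$, $g\in\mathcal{H}_{r\rightleftarrows s}$ the product $f*g\in\mathcal{H}_{(m+r)\rightleftarrows(n+s)}$ is $$\sum_{\sigma,\tau}f(x_{\sigma_1},\ldots,x_{\sigma_m},y_{\tau_1},\ldots,y_{\tau_n})\,g(x_{\sigma_{m+1}},\ldots,x_{\sigma_{m+r}},y_{\tau_{n+1}},\ldots,y_{\tau_{n+s}})\,\frac{\Delta_1(x_{\sigma_i},y_{\tau_j})}{\Delta_0(x_{\sigma_i},y_{\tau_j})},$$ the sum over all $(m,r)$-shuffles $\sigma$ and $(n,s)$-shuffles $\tau$, where $$\Delta_1=\prod_{i=1}^m\prod_{j'=n+1}^{n+s}(y_{j'}-x_i)\prod_{i'=m+1}^{m+r}\prod_{j=1}^n(x_{i'}-y_j),\quad\Delta_0=\prod_{i=1}^m\prod_{i'=m+1}^{m+r}(x_{i'}-x_i)\prod_{j=1}^n\prod_{j'=n+1}^{n+s}(y_{j'}-y_j).$$ A homogeneous $f\in\mathcal{H}_{m\rightleftarrows n}$ of polynomial degree $k$ has bidegree $(m\rightleftarrows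 n,2k+(m-n)^2)$; its parity is $(m-n)^2$ mod 2. With these parities, all three algebras are super-commutative. The super-commutative tensor product uses the Koszul sign rule $(a\otimes b)(a'\otimes b')=(-1)^{|b||a'|}aa'\otimes bb'$. *)

theory Defs
  imports
    "HOL-Library.Poly_Mapping"
    "HOL-Library.Product_Plus"
    "HOL-Library.FuncSet"
    "HOL-Computational_Algebra.Fraction_Field"
    "HOL-Combinatorics.Permutations"
    "HOL-Algebra.Module"
    "HOL-Algebra.QuotRing"
    "HOL-Algebra.Algebraic_Closure_Type"
begin

section \<open>Rational polynomials in variables of type \<open>'v\<close>\<close>

type_synonym 'v mpoly = "('v \<Rightarrow>\<^sub>0 nat) \<Rightarrow>\<^sub>0 rat"

definition mvar :: "'v \<Rightarrow> 'v mpoly" where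
  "mvar v = Poly_Mapping.single (Poly_Mapping.single v 1) 1"

definition vars :: "'v mpoly \<Rightarrow> 'v set" where
  "vars p = (\<Union>m\<in>Poly_Mapping.keys p. Poly_Mapping.keys m)"

text \<open>The substitution \<open>v \<mapsto> \<theta> v\<close> of variables for variables.\<close>

definition relabel :: "('v \<Rightarrow> 'w) \<Rightarrow> 'v mpoly \<Rightarrow> 'w mpoly" where
  "relabel \<theta> p =
     (\<Sum>m\<in>Poly_Mapping.keys p. Poly_Mapping.single 0 (Poly_Mapping.lookup p m) *
        (\<Prod>v\<in>Poly_Mapping.keys m. mvar (\<theta> v) ^ Poly_Mapping.lookup m v))"

definition scale :: "rat \<Rightarrow> ('k \<Rightarrow>\<^sub>0 rat) \<Rightarrow> ('k \<Rightarrow>\<^sub>0 rat)" where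
  "scale c p = Poly_Mapping.map ((*) c) p"

text \<open>The \<open>(d,e)\<close>-shuffles.\<close>

definition shuffle_perms :: "nat \<Rightarrow> nat \<Rightarrow> (nat \<Rightarrow> nat) set" where
  "shuffle_perms d e =
     {\<sigma>. \<sigma> permutes {1..d + e} \<and> strict_mono_on {1..d} \<sigma> \<and> strict_mono_on {d + 1..d + e} \<sigma>}"


section \<open>Superalgebras over the rationals\<close>

text \<open>\<open>parity_part A p a\<close> is the component of \<open>a\<close> of parity \<open>p \<in> {0, 1}\<close>.\<close>

record 'a superalgebra = "(rat, 'a) module" +
  parity_part :: "nat \<Rightarrow> 'a \<Rightarrow> 'a"

definition is_algebra :: "('a, 'm) superalgebra_scheme \<Rightarrow> bool" where
  "is_algebra A \<longleftrightarrow>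
     ring A \<and> Module.module (ring_of_type_algebra :: rat ring) A \<and>
     (\<forall>c. \<forall>x\<in>carrier A. \<forall>y\<in>carrier A.
        (c \<odot>\<^bsub>A\<^esub> x) \<otimes>\<^bsub>A\<^esub> y = c \<odot>\<^bsub>A\<^esub> (x \<otimes>\<^bsub>A\<^esub> y) \<and>
        x \<otimes>\<^bsub>A\<^esub> (c \<odot>\<^bsub>A\<^esub> y) = c \<odot>\<^bsub>A\<^esub> (x \<otimes>\<^bsub>A\<^esub> y))"

definition linear_maps ::
    "('a, 'm) superalgebra_scheme \<Rightarrow> ('b, 'n) superalgebra_scheme \<Rightarrow> ('a \<Rightarrow> 'b) set" where
  "linear_maps A B =
     {F \<in> carrier A \<rightarrow> carrier B.
        (\<forall>x\<in>carrier A. \<forall>y\<in>carrier A. F (x \<oplus>\<^bsub>A\<^esub> y) = F x \<oplus>\<^bsub>B\<^esub> F y) \<and>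
        (\<forall>c. \<forall>x\<in>carrier A. F (c \<odot>\<^bsub>A\<^esub> x) = c \<odot>\<^bsub>B\<^esub> F x)}"

definition algebra_homs ::
    "('a, 'm) superalgebra_scheme \<Rightarrow> ('b, 'n) superalgebra_scheme \<Rightarrow> ('a \<Rightarrow> 'b) set" where
  "algebra_homs A B = ring_hom A B \<inter> linear_maps A B"

definition algebra_isos ::
    "('a, 'm) superalgebra_scheme \<Rightarrow> ('b, 'n) superalgebra_scheme \<Rightarrow> ('a \<Rightarrow> 'b) set" where
  "algebra_isos A B = ring_iso A B \<inter> linear_maps A B"


section \<open>The super-commutative tensor product\<close>

text \<open>
  The tensor product over the rationals is the quotient of the vector space with basis
  \<open>carrier A \<times> carrier B\<close> by the subspace \<open>bilinear_rels A B\<close>; its elements are cosets.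
\<close>

definition free_space ::
    "('a, 'm) superalgebra_scheme \<Rightarrow> ('b, 'n) superalgebra_scheme \<Rightarrow> ('a \<times> 'b \<Rightarrow>\<^sub>0 rat) set" where
  "free_space A B = {u. Poly_Mapping.keys u \<subseteq> carrier A \<times> carrier B}"

inductive_set bilinear_rels ::
    "('a, 'm) superalgebra_scheme \<Rightarrow> ('b, 'n) superalgebra_scheme \<Rightarrow> ('a \<times> 'b \<Rightarrow>\<^sub>0 rat) set"
  for A :: "('a, 'm) superalgebra_scheme" and B :: "('b, 'n) superalgebra_scheme" where
  zero: "0 \<in> bilinear_rels A B"
| add: "u \<in> bilinear_rels A B \<Longrightarrow> v \<in> bilinear_rels A B \<Longrightarrow> u + v \<in> bilinear_rels A B"
| scale: "u \<in> bilinear_rels A B \<Longrightarrow> scale c u \<in> bilinear_rels A B"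
| add_left: "a \<in> carrier A \<Longrightarrow> a' \<in> carrier A \<Longrightarrow> b \<in> carrier B \<Longrightarrow>
    Poly_Mapping.single (a \<oplus>\<^bsub>A\<^esub> a', b) 1 - Poly_Mapping.single (a, b) 1
      - Poly_Mapping.single (a', b) 1 \<in> bilinear_rels A B"
| add_right: "a \<in> carrier A \<Longrightarrow> b \<in> carrier B \<Longrightarrow> b' \<in> carrier B \<Longrightarrow>
    Poly_Mapping.single (a, b \<oplus>\<^bsub>B\<^esub> b') 1 - Poly_Mapping.single (a, b) 1
      - Poly_Mapping.single (a, b') 1 \<in> bilinear_rels A B"
| scale_left: "a \<in> carrier A \<Longrightarrow> b \<in> carrier B \<Longrightarrow>
    Poly_Mapping.single (c \<odot>\<^bsub>A\<^esub> a, b) 1 - Poly_Mapping.single (a, b) c \<in> bilinear_rels A B"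
| scale_right: "a \<in> carrier A \<Longrightarrow> b \<in> carrier B \<Longrightarrow>
    Poly_Mapping.single (a, c \<odot>\<^bsub>B\<^esub> b) 1 - Poly_Mapping.single (a, b) c \<in> bilinear_rels A B"

definition tensor_class ::
    "('a, 'm) superalgebra_scheme \<Rightarrow> ('b, 'n) superalgebra_scheme \<Rightarrow>
     ('a \<times> 'b \<Rightarrow>\<^sub>0 rat) \<Rightarrow> ('a \<times> 'b \<Rightarrow>\<^sub>0 rat) set" where
  "tensor_class A B u = {u + n |n. n \<in> bilinear_rels A B}"

definition pure_tensor ::
    "('a, 'm) superalgebra_scheme \<Rightarrow> ('b, 'n) superalgebra_scheme \<Rightarrow>
     'a \<Rightarrow> 'b \<Rightarrow> ('a \<times> 'b \<Rightarrow>\<^sub>0 rat) set" where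
  "pure_tensor A B a b = tensor_class A B (Poly_Mapping.single (a, b) 1)"

text \<open>
  The bilinear extension of the Koszul rule
  \<open>(a \<otimes> b)(a' \<otimes> b') = (-1)\<^bsup>|b||a'|\<^esup> aa' \<otimes> bb'\<close>; since \<open>a'\<close> and \<open>b\<close> need not be
  homogeneous, they are split into their parity components.
\<close>

definition koszul_mult ::
    "('a, 'm) superalgebra_scheme \<Rightarrow> ('b, 'n) superalgebra_scheme \<Rightarrow>
     ('a \<times> 'b \<Rightarrow>\<^sub>0 rat) \<Rightarrow> ('a \<times> 'b \<Rightarrow>\<^sub>0 rat) \<Rightarrow> ('a \<times> 'b \<Rightarrow>\<^sub>0 rat)" where
  "koszul_mult A B u v =
     (\<Sum>(a, b)\<in>Poly_Mapping.keys u. \<Sum>(a', b')\<in>Poly_Mapping.keys v.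
      \<Sum>p\<in>{0, 1}. \<Sum>q\<in>{0, 1}.
        Poly_Mapping.single (a \<otimes>\<^bsub>A\<^esub> parity_part A q a', parity_part B p b \<otimes>\<^bsub>B\<^esub> b')
          ((-1) ^ (p * q) * Poly_Mapping.lookup u (a, b) *
           Poly_Mapping.lookup v (a', b')))"

definition free_parity_part ::
    "('a, 'm) superalgebra_scheme \<Rightarrow> ('b, 'n) superalgebra_scheme \<Rightarrow>
     nat \<Rightarrow> ('a \<times> 'b \<Rightarrow>\<^sub>0 rat) \<Rightarrow> ('a \<times> 'b \<Rightarrow>\<^sub>0 rat)" where
  "free_parity_part A B p u =
     (\<Sum>(a, b)\<in>Poly_Mapping.keys u.
      \<Sum>(i, j)\<in>{(i, j). i \<in> {0, 1} \<and> j \<in> {0, 1} \<and> (i + j) mod 2 = p}.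
        Poly_Mapping.single (parity_part A i a, parity_part B j b)
          (Poly_Mapping.lookup u (a, b)))"

text \<open>
  Operations on cosets are defined on representatives; the unions are unions of equal cosets.
\<close>

definition tensor_algebra ::
    "('a, 'm) superalgebra_scheme \<Rightarrow> ('b, 'n) superalgebra_scheme \<Rightarrow>
     ('a \<times> 'b \<Rightarrow>\<^sub>0 rat) set superalgebra" where
  "tensor_algebra A B = \<lparr>
     carrier = tensor_class A B ` free_space A B,
     monoid.mult = (\<lambda>U V. \<Union>u\<in>U. \<Union>v\<in>V. tensor_class A B (koszul_mult A B u v)),
     one = pure_tensor A B \<one>\<^bsub>A\<^esub> \<one>\<^bsub>B\<^esub>,
     ring.zero = tensor_class A B 0,
     add = (\<lambda>U V. \<Union>u\<in>U. \<Union>v\<in>V. tensor_class A B (u + v)),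
     module.smult = (\<lambda>c U. \<Union>u\<in>U. tensor_class A B (scale c u)),
     parity_part = (\<lambda>p U. \<Union>u\<in>U. tensor_class A B (free_parity_part A B p u)) \<rparr>"


section \<open>The cohomological Hall algebras\<close>

text \<open>
  The direct sum over all dimension vectors \<open>d\<close> of the spaces \<open>H d\<close>, with elements the finitely
  supported families; \<open>pr d e\<close> is the product \<open>H d \<times> H e \<rightarrow> H (d + e)\<close>, and \<open>H d\<close> has
  parity \<open>par d \<in> {0, 1}\<close>. The product \<open>*\<close> of the type \<open>'d \<Rightarrow>\<^sub>0 'v mpoly\<close> itself is not used.
\<close>

definition graded_algebra ::
    "('d::comm_monoid_add \<Rightarrow> 'v mpoly set) \<Rightarrow>
     ('d \<Rightarrow> 'd \<Rightarrow> 'v mpoly \<Rightarrow> 'v mpoly \<Rightarrow> 'v mpoly) \<Rightarrow> ('d \<Rightarrow> nat) \<Rightarrow>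
     ('d \<Rightarrow>\<^sub>0 'v mpoly) superalgebra" where
  "graded_algebra H pr par = \<lparr>
     carrier = {F. \<forall>d. Poly_Mapping.lookup F d \<in> H d},
     monoid.mult = (\<lambda>F G. \<Sum>d\<in>Poly_Mapping.keys F. \<Sum>e\<in>Poly_Mapping.keys G.
               Poly_Mapping.single (d + e)
                 (pr d e (Poly_Mapping.lookup F d) (Poly_Mapping.lookup G e))),
     one = Poly_Mapping.single 0 1,
     ring.zero = 0,
     add = (+),
     module.smult = (\<lambda>c F. Poly_Mapping.map (scale c) F),
     parity_part = (\<lambda>p F. \<Sum>d\<in>{d \<in> Poly_Mapping.keys F. par d = p}.
                      Poly_Mapping.single d (Poly_Mapping.lookup F d)) \<rparr>"

definition sym_polys :: "nat \<Rightarrow> nat mpoly set" where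
  "sym_polys d =
     {f. vars f \<subseteq> {1..d} \<and> (\<forall>\<pi>. \<pi> permutes {1..d} \<longrightarrow> relabel \<pi> f = f)}"

text \<open>The quiver with one vertex and no arrows.\<close>

definition pt_prod :: "nat \<Rightarrow> nat \<Rightarrow> nat mpoly \<Rightarrow> nat mpoly \<Rightarrow> nat mpoly" where
  "pt_prod d e f g = (THE p. Fract p 1 =
     (\<Sum>\<sigma>\<in>shuffle_perms d e.
        Fract (relabel \<sigma> f * relabel (\<lambda>i. \<sigma> (d + i)) g)
              (\<Prod>\<mu>\<in>{1..d}. \<Prod>\<nu>\<in>{d + 1..d + e}. mvar (\<sigma> \<nu>) - mvar (\<sigma> \<mu>))))"

definition coha_pt :: "(nat \<Rightarrow>\<^sub>0 nat mpoly) superalgebra" where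
  "coha_pt = graded_algebra sym_polys pt_prod (\<lambda>d. d\<^sup>2 mod 2)"

text \<open>The quiver with one vertex and one loop.\<close>

definition loop_prod :: "nat \<Rightarrow> nat \<Rightarrow> nat mpoly \<Rightarrow> nat mpoly \<Rightarrow> nat mpoly" where
  "loop_prod d e f g =
     (\<Sum>\<sigma>\<in>shuffle_perms d e. relabel \<sigma> f * relabel (\<lambda>i. \<sigma> (d + i)) g)"

definition coha_J :: "(nat \<Rightarrow>\<^sub>0 nat mpoly) superalgebra" where
  "coha_J = graded_algebra sym_polys loop_prod (\<lambda>d. 0)"

definition phi :: "nat \<Rightarrow> (nat \<Rightarrow>\<^sub>0 nat mpoly)" where
  "phi i = Poly_Mapping.single 1 (mvar 1 ^ i)"

text \<open>
  The quiver with two vertices and one arrow in each direction. The linear order on the variables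
  is only needed to make the polynomial ring an integral domain for \<^const>\<open>Fract\<close>.
\<close>

datatype xy = Xv nat | Yv nat

fun xy_code :: "xy \<Rightarrow> nat" where
  "xy_code (Xv i) = 2 * i"
| "xy_code (Yv j) = 2 * j + 1"

lemma xy_code_inject: "xy_code v = xy_code w \<Longrightarrow> v = w"
  by (cases v; cases w) (simp_all, presburger+)

instantiation xy :: linorder
begin

definition less_eq_xy :: "xy \<Rightarrow> xy \<Rightarrow> bool" where
  "v \<le> w \<longleftrightarrow> xy_code v \<le> xy_code w"

definition less_xy :: "xy \<Rightarrow> xy \<Rightarrow> bool" where
  "v < w \<longleftrightarrow> xy_code v < xy_code w"

instance
  by standard (auto simp: less_eq_xy_def less_xy_def intro: xy_code_inject)

end

fun xy_map :: "(nat \<Rightarrow> nat) \<Rightarrow> (nat \<Rightarrow> nat) \<Rightarrow> xy \<Rightarrow> xy" where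
  "xy_map \<sigma> \<tau> (Xv i) = Xv (\<sigma> i)"
| "xy_map \<sigma> \<tau> (Yv j) = Yv (\<tau> j)"

fun bisym_polys :: "nat \<times> nat \<Rightarrow> xy mpoly set" where
  "bisym_polys (m, n) =
     {f. vars f \<subseteq> Xv ` {1..m} \<union> Yv ` {1..n} \<and>
         (\<forall>\<pi> \<rho>. \<pi> permutes {1..m} \<longrightarrow> \<rho> permutes {1..n} \<longrightarrow> relabel (xy_map \<pi> \<rho>) f = f)}"

definition Delta1 :: "nat \<Rightarrow> nat \<Rightarrow> nat \<Rightarrow> nat \<Rightarrow> xy mpoly" where
  "Delta1 m n r s =
     (\<Prod>i\<in>{1..m}. \<Prod>j'\<in>{n + 1..n + s}. mvar (Yv j') - mvar (Xv i)) *
     (\<Prod>i'\<in>{m + 1..m + r}. \<Prod>j\<in>{1..n}. mvar (Xv i') - mvar (Yv j))"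

definition Delta0 :: "nat \<Rightarrow> nat \<Rightarrow> nat \<Rightarrow> nat \<Rightarrow> xy mpoly" where
  "Delta0 m n r s =
     (\<Prod>i\<in>{1..m}. \<Prod>i'\<in>{m + 1..m + r}. mvar (Xv i') - mvar (Xv i)) *
     (\<Prod>j\<in>{1..n}. \<Prod>j'\<in>{n + 1..n + s}. mvar (Yv j') - mvar (Yv j))"

fun A1_prod :: "nat \<times> nat \<Rightarrow> nat \<times> nat \<Rightarrow> xy mpoly \<Rightarrow> xy mpoly \<Rightarrow> xy mpoly" where
  "A1_prod (m, n) (r, s) f g = (THE p. Fract p 1 =
     (\<Sum>\<sigma>\<in>shuffle_perms m r. \<Sum>\<tau>\<in>shuffle_perms n s.
        Fract (relabel (xy_map \<sigma> \<tau>) f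
               * relabel (xy_map (\<lambda>i. \<sigma> (m + i)) (\<lambda>j. \<tau> (n + j))) g
               * relabel (xy_map \<sigma> \<tau>) (Delta1 m n r s))
              (relabel (xy_map \<sigma> \<tau>) (Delta0 m n r s))))"

definition coha_A1 :: "(nat \<times> nat \<Rightarrow>\<^sub>0 xy mpoly) superalgebra" where
  "coha_A1 = graded_algebra bisym_polys A1_prod (\<lambda>(m, n). nat ((int m - int n)\<^sup>2 mod 2))"

definition coha_A1_diag :: "(nat \<times> nat \<Rightarrow>\<^sub>0 xy mpoly) superalgebra" where
  "coha_A1_diag = coha_A1\<lparr>carrier := {F \<in> carrier coha_A1. \<forall>(m, n)\<in>Poly_Mapping.keys F. m = n}\<rparr>"


section \<open>The map \<open>\<Psi>\<close>\<close>

definition incl_X :: "(nat \<Rightarrow>\<^sub>0 nat mpoly) \<Rightarrow> (nat \<times> nat \<Rightarrow>\<^sub>0 xy mpoly)" where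
  "incl_X F = (\<Sum>m\<in>Poly_Mapping.keys F.
     Poly_Mapping.single (m, 0) (relabel Xv (Poly_Mapping.lookup F m)))"

definition incl_Y :: "(nat \<Rightarrow>\<^sub>0 nat mpoly) \<Rightarrow> (nat \<times> nat \<Rightarrow>\<^sub>0 xy mpoly)" where
  "incl_Y F = (\<Sum>n\<in>Poly_Mapping.keys F.
     Poly_Mapping.single (0, n) (relabel Yv (Poly_Mapping.lookup F n)))"

text \<open>
  Homomorphisms are determined on carriers only; \<^const>\<open>extensional\<close> fixes the value outside, so
  that the descriptions below can be unique.
\<close>

definition Psi0 :: "(nat \<Rightarrow>\<^sub>0 nat mpoly) \<Rightarrow> (nat \<times> nat \<Rightarrow>\<^sub>0 xy mpoly)" where
  "Psi0 = (THE F. F \<in> algebra_homs coha_J coha_A1_diag \<and> F \<in> extensional (carrier coha_J) \<and>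
     (\<forall>i. F (phi i) = Poly_Mapping.single (1, 1) (mvar (Xv 1) ^ i)))"

abbreviation "coha_tensor \<equiv> tensor_algebra (tensor_algebra coha_pt coha_J) coha_pt"

definition tensor3 where
  "tensor3 f g h =
     pure_tensor (tensor_algebra coha_pt coha_J) coha_pt (pure_tensor coha_pt coha_J f g) h"

definition Psi where
  "Psi = (THE F. F \<in> linear_maps coha_tensor coha_A1 \<and> F \<in> extensional (carrier coha_tensor) \<and>
     (\<forall>f\<in>carrier coha_pt. \<forall>g\<in>carrier coha_J. \<forall>h\<in>carrier coha_pt.
        F (tensor3 f g h) = incl_X f \<otimes>\<^bsub>coha_A1\<^esub> Psi0 g \<otimes>\<^bsub>coha_A1\<^esub> incl_Y h))"

end

(* Symmetric polynomials are treated as functions on finite sets of rationals, and elements of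
   H(A1) as functions T(A, B) of pairs of finite sets. The shuffle product then becomes the
   convolution over decompositions A = A1 + A2, B = B1 + B2 with a bimultiplicative kernel, which makes
   associativity and supercommutativity evident; H(pt), H(J) and the tensor products are realized in
   the same convolution algebra. In these terms Psi0(g)(A, B) = g(A) when |A| = |B|; that this is
   multiplicative is a form of Lagrange interpolation.

   For bijectivity, filter by |A Int B|. The kernel of a triple product f * Psi0(g) * h, with g of
   degree K, vanishes when |A Int B| > K, and for |A Int B| = K only one decomposition survives:
   the value is f(A - B) g(A Int B) h(B - A) times the product of all b - a with a in A - B and
   b in B - A. The leading terms therefore determine the tensor. Conversely, an element vanishing for
   |A Int B| > K is, after identifying K of the x with K of the y, divisible by the differences of
   the remaining variables, so it agrees with a sum of triple products up to a lower filtration step. *)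

theory Submission
  imports Defs "HOL-Combinatorics.Multiset_Permutations"
begin

text \<open>Finite sets of rationals suffice because points with distinct coordinates, even those
  avoiding a given finite set, are Zariski dense, and symmetry makes the order of the coordinates
  irrelevant. A and B may meet: differences between x and y values occur only in the numerator of
  the kernel, and the bijectivity argument lives on such pairs. Two obstacles shape the rest. The
  shuffle formulas are rational functions turned into polynomials by definite descriptions, so
  polynomiality must be proved before such a product has a known value. And the tensor products are
  iterated quotients of free spaces by relations, without bases. A criterion with separating
  functionals shows that an element of the free space with zero image is a relation. Applied to the
  inner and then to the outer product, it makes the operations on cosets well defined and the map to
  functions injective at once, so that injectivity of Psi is settled as soon as the triple tensor
  product is modelled. Psi and Psi0 then preserve the associated functions, and the Koszul signs
  come from exchanging the arguments of the kernel.\<close>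

abbreviation "lookup \<equiv> Poly_Mapping.lookup"
abbreviation "keys \<equiv> Poly_Mapping.keys"
abbreviation "single \<equiv> Poly_Mapping.single"

section \<open>Evaluation of polynomials\<close>

lemma poly_mapping_sum_single:
  "p = (\<Sum>k\<in>keys p. single k (lookup p k))"
proof (rule poly_mapping_eqI)
  fix k
  show "lookup p k =
      lookup (\<Sum>k\<in>keys p. single k (lookup p k)) k"
    by (simp add: lookup_sum lookup_single when_def if_distrib sum.If_cases in_keys_iff)
qed

lemma poly_mapping_add_induct [case_names zero single add]:
  fixes P :: "('k \<Rightarrow>\<^sub>0 'b::comm_monoid_add) \<Rightarrow> bool"
  assumes "P 0" "\<And>k c. P (single k c)" "\<And>p q. P p \<Longrightarrow> P q \<Longrightarrow> P (p + q)"
  shows "P p"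
proof -
  have "P (\<Sum>k\<in>K. single k (lookup p k))" if "finite K" for K
    using that by induction (auto intro: assms)
  from this[of "keys p"] show ?thesis
    using poly_mapping_sum_single[of p] by simp
qed

lemma sum_keys_superset:
  assumes "finite K" "keys p \<subseteq> K" "\<And>k. h k 0 = 0"
  shows "(\<Sum>k\<in>keys p. h k (lookup p k)) = (\<Sum>k\<in>K. h k (lookup p k))"
  using assms by (intro sum.mono_neutral_left) (auto simp: in_keys_iff)

text \<open>One substitution homomorphism serves twice: with \<open>c\<close> the identity it
  evaluates at a rational point, and with \<open>c\<close> the embedding of constants it is
  \<open>relabel\<close>.\<close>

locale scalar_embedding =
  fixes c :: "rat \<Rightarrow> 'b::comm_ring_1"
  assumes c_add: "c (x + y) = c x + c y" and c_mult: "c (x * y) = c x * c y" and c_one: "c 1 = 1"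
begin

lemma c_zero: "c 0 = 0"
  using c_add[of 0 0] by simp

definition power_prod :: "('v \<Rightarrow> 'b) \<Rightarrow> ('v \<Rightarrow>\<^sub>0 nat) \<Rightarrow> 'b" where
  "power_prod h m = (\<Prod>v\<in>keys m. h v ^ lookup m v)"

definition subst :: "('v \<Rightarrow> 'b) \<Rightarrow> 'v mpoly \<Rightarrow> 'b" where
  "subst h p = (\<Sum>m\<in>keys p. c (lookup p m) * power_prod h m)"

lemma power_prod_superset:
  assumes "finite K" "keys m \<subseteq> K"
  shows "power_prod h m = (\<Prod>v\<in>K. h v ^ lookup m v)"
  unfolding power_prod_def using assms by (intro prod.mono_neutral_left) (auto simp: in_keys_iff)

lemma power_prod_zero [simp]: "power_prod h 0 = 1"
  by (simp add: power_prod_def)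

lemma power_prod_add: "power_prod h (m + n) = power_prod h m * power_prod h n"
proof -
  let ?K = "keys m \<union> keys n"
  have "keys (m + n) \<subseteq> ?K" by (rule keys_add)
  then have "power_prod h (m + n) = (\<Prod>v\<in>?K. h v ^ lookup (m + n) v)"
    by (intro power_prod_superset) auto
  also have "\<dots> = power_prod h m * power_prod h n"
    by (simp add: power_prod_superset[of ?K m] power_prod_superset[of ?K n] lookup_add power_add prod.distrib)
  finally show ?thesis .
qed

lemma subst_zero [simp]: "subst h 0 = 0"
  by (simp add: subst_def c_zero)

lemma subst_single [simp]: "subst h (single m r) = c r * power_prod h m"
  by (simp add: subst_def c_zero)

lemma subst_add [simp]: "subst h (p + q) = subst h p + subst h q"
  unfolding subst_def by (rule setsum_keys_plus_distrib) (auto simp: c_add c_zero ring_distribs)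

lemma subst_uminus [simp]: "subst h (- p) = - subst h p"
  using subst_add[of h p "- p"] by (simp add: minus_unique)

lemma subst_diff [simp]: "subst h (p - q) = subst h p - subst h q"
  using subst_add[of h p "- q"] by simp

lemma subst_mult [simp]: "subst h (p * q) = subst h p * subst h q"
proof (induction p rule: poly_mapping_add_induct)
  case (single k d)
  show ?case
    by (induction q rule: poly_mapping_add_induct)
      (simp_all add: mult_single power_prod_add c_mult algebra_simps)
qed (simp_all add: algebra_simps)

lemma subst_one [simp]: "subst h 1 = 1"
  by (simp flip: single_one add: c_one)

lemma subst_mvar [simp]: "subst h (mvar v) = h v"
  by (simp add: mvar_def power_prod_def c_one)

lemma subst_power [simp]: "subst h (p ^ n) = subst h p ^ n"
  by (induction n) auto

lemma subst_prod [simp]: "subst h (prod f A) = (\<Prod>x\<in>A. subst h (f x))"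
  by (induction A rule: infinite_finite_induct) auto

lemma subst_sum [simp]: "subst h (sum f A) = (\<Sum>x\<in>A. subst h (f x))"
  by (induction A rule: infinite_finite_induct) auto

lemma subst_cong:
  assumes "\<And>v. v \<in> vars p \<Longrightarrow> h v = h' v"
  shows "subst h p = subst h' p"
proof -
  have "power_prod h m = power_prod h' m" if "m \<in> keys p" for m
    unfolding power_prod_def
  proof (rule prod.cong)
    fix v assume "v \<in> keys m"
    with that have "v \<in> vars p" by (auto simp: vars_def)
    then show "h v ^ lookup m v = h' v ^ lookup m v" by (simp add: assms)
  qed simp
  then show ?thesis by (simp add: subst_def)
qed

end

interpretation evl: scalar_embedding "\<lambda>x::rat. x"
  by standard simp_all

interpretation rel: scalar_embedding "single (0::'w \<Rightarrow>\<^sub>0 nat)"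
  by standard (simp_all only: single_add mult_single add_0 single_one)

abbreviation eval :: "('v \<Rightarrow> rat) \<Rightarrow> 'v mpoly \<Rightarrow> rat" where "eval \<equiv> evl.subst"

lemma relabel_eq: "relabel \<theta> = rel.subst (\<lambda>v. mvar (\<theta> v))"
  by (simp add: fun_eq_iff relabel_def rel.subst_def rel.power_prod_def)

lemma relabel_simps [simp]:
  "relabel \<theta> 0 = 0" "relabel \<theta> 1 = 1" "relabel \<theta> (p + q) = relabel \<theta> p + relabel \<theta> q"
  "relabel \<theta> (p - q) = relabel \<theta> p - relabel \<theta> q" "relabel \<theta> (- p) = - relabel \<theta> p"
  "relabel \<theta> (p * q) = relabel \<theta> p * relabel \<theta> q" "relabel \<theta> (p ^ n) = relabel \<theta> p ^ n"
  "relabel \<theta> (mvar v) = mvar (\<theta> v)" "relabel \<theta> (single 0 r) = single 0 r"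
  "relabel \<theta> (prod f A) = (\<Prod>x\<in>A. relabel \<theta> (f x))" "relabel \<theta> (sum f A) = (\<Sum>x\<in>A. relabel \<theta> (f x))"
  by (simp_all add: relabel_eq)

lemma eval_power_prod_mvar: "evl.power_prod a m = eval a (rel.power_prod mvar m)"
  by (simp add: evl.power_prod_def rel.power_prod_def)

lemma eval_relabel [simp]: "eval a (relabel \<theta> p) = eval (a \<circ> \<theta>) p"
proof (induction p rule: poly_mapping_add_induct)
  case (single m c)
  have "eval a (relabel \<theta> (single m c)) =
      eval a (single 0 c) * eval a (rel.power_prod (\<lambda>v. mvar (\<theta> v)) m)"
    unfolding relabel_eq rel.subst_single evl.subst_mult ..
  also have "\<dots> = eval (a \<circ> \<theta>) (single m c)"
    by (simp add: rel.power_prod_def evl.power_prod_def)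
  finally show ?case .
qed simp_all

text \<open>Rescaling one coordinate acts on a monomial by a character of its exponent; this is what
  tells monomials apart.\<close>

lemma power_prod_scale_var:
  "evl.power_prod (a(v := c * a v)) m = c ^ lookup m v * evl.power_prod a m"
proof -
  let ?K = "insert v (keys m)"
  have split: "evl.power_prod b m =
      b v ^ lookup m v * (\<Prod>w\<in>?K - {v}. b w ^ lookup m w)" for b
    by (rule trans[OF evl.power_prod_superset[of ?K] prod.remove]) auto
  have "(\<Prod>w\<in>?K - {v}. (a(v := c * a v)) w ^ lookup m w) =
     (\<Prod>w\<in>?K - {v}. a w ^ lookup m w)"
    by (intro prod.cong) auto
  then show ?thesis
    by (simp only: split fun_upd_same power_mult_distrib mult.assoc)
qed

text \<open>Artin's argument for the linear independence of characters.\<close>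

lemma power_prod_independent:
  fixes c :: "('v \<Rightarrow>\<^sub>0 nat) \<Rightarrow> rat"
  assumes "finite M" "\<And>a. (\<Sum>m\<in>M. c m * evl.power_prod a m) = 0" "m \<in> M"
  shows "c m = 0"
  using assms
proof (induction M arbitrary: c m rule: finite_induct)
  case (insert m0 M)
  \<comment> \<open>Doubling coordinate \<open>v\<close> and subtracting
    \<open>2 ^ lookup m0 v\<close> times the original relation removes \<open>m0\<close>, leaving a
    relation on \<open>M\<close>.\<close>
  have *: "c m * (2 ^ lookup m v - 2 ^ lookup m0 v) = 0" if "m \<in> M" for m v
  proof (rule insert.IH[OF _ that])
    fix a :: "'v \<Rightarrow> rat"
    have "(\<Sum>m\<in>M. c m * (2 ^ lookup m v - 2 ^ lookup m0 v) * evl.power_prod a m) =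
      (\<Sum>m\<in>insert m0 M. c m * evl.power_prod (a(v := 2 * a v)) m) -
        2 ^ lookup m0 v * (\<Sum>m\<in>insert m0 M. c m * evl.power_prod a m)"
      using insert.hyps
      by (simp add: power_prod_scale_var) (simp add: sum_distrib_left sum_subtractf algebra_simps)
    then show "(\<Sum>m\<in>M. c m * (2 ^ lookup m v - 2 ^ lookup m0 v) * evl.power_prod a m) = 0"
      by (simp only: insert.prems(1))
  qed
  have M: "c m = 0" if m: "m \<in> M" for m
  proof -
    from m insert.hyps have "m \<noteq> m0" by auto
    then obtain v where "lookup m v \<noteq> lookup m0 v"
      by (metis poly_mapping_eqI)
    then have "(2::rat) ^ lookup m v - 2 ^ lookup m0 v \<noteq> 0"
      by (simp add: power_inject_exp)
    with *[OF m, of v] show ?thesis by simp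
  qed
  have "c m0 = 0"
    using insert.prems(1)[of "\<lambda>_. 1"] insert.hyps M by (simp add: evl.power_prod_def)
  with M insert.prems(2) show ?case by auto
qed auto

lemma eval_eq_zeroD:
  assumes "\<And>a. eval a p = 0"
  shows "p = 0"
proof (rule poly_mapping_eqI)
  fix m
  show "lookup p m = lookup 0 m"
    using power_prod_independent[of "keys p" "lookup p" m] assms
    by (cases "m \<in> keys p") (auto simp: evl.subst_def in_keys_iff)
qed

lemma eval_inject: "(\<And>a. eval a p = eval a q) \<Longrightarrow> p = q"
  using eval_eq_zeroD[of "p - q"] by simp

text \<open>Occurrence of variables becomes a statement about values. For the converse, doubling a
  variable outside \<open>V\<close> changes no value, and independence of monomials forces its
  exponent to be 0.\<close>

lemma vars_subset_iff:
  "vars p \<subseteq> V \<longleftrightarrow> (\<forall>a a'. (\<forall>v\<in>V. a v = a' v) \<longrightarrow> eval a p = eval a' p)"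
proof
  assume "vars p \<subseteq> V"
  then show "\<forall>a a'. (\<forall>v\<in>V. a v = a' v) \<longrightarrow> eval a p = eval a' p"
    by (intro allI impI evl.subst_cong) auto
next
  assume R: "\<forall>a a'. (\<forall>v\<in>V. a v = a' v) \<longrightarrow> eval a p = eval a' p"
  show "vars p \<subseteq> V"
  proof
    fix v assume "v \<in> vars p"
    then obtain m where m: "m \<in> keys p" "v \<in> keys m"
      by (auto simp: vars_def)
    show "v \<in> V"
    proof (rule ccontr)
      assume v: "v \<notin> V"
      have "lookup p m * (2 ^ lookup m v - 1) = 0"
      proof (rule power_prod_independent[OF _ _ m(1)])
        fix a :: "'a \<Rightarrow> rat"
        have "eval (a(v := 2 * a v)) p = eval a p"
          using R v by (metis fun_upd_apply)
        then show "(\<Sum>m\<in>keys p.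
            lookup p m * (2 ^ lookup m v - 1) * evl.power_prod a m) = 0"
          by (simp add: evl.subst_def power_prod_scale_var) (simp add: sum_subtractf algebra_simps)
      qed auto
      moreover have "1 < (2::rat) ^ lookup m v"
        by (rule one_less_power) (use m(2) in \<open>auto simp: in_keys_iff\<close>)
      then have "(2::rat) ^ lookup m v - 1 \<noteq> 0" by linarith
      ultimately show False using m(1) by (simp add: in_keys_iff)
    qed
  qed
qed

lemma mvar_eq_iff [simp]: "mvar u = mvar v \<longleftrightarrow> u = v"
proof
  assume "mvar u = mvar v"
  then have "eval (\<lambda>w. if w = u then 1 else 0) (mvar u) = eval (\<lambda>w. if w = u then 1 else 0) (mvar v)"
    by simp
  then show "u = v" by (auto split: if_splits)
qed auto

text \<open>Multiplying by a nonzero polynomial \<open>D\<close> that vanishes at all excluded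
  points reduces this to vanishing everywhere. The set \<open>Y\<close> allows tests away from a
  fixed finite set, which the separation lemmas for tensors need.\<close>

lemma eval_eq_zeroD_generic:
  fixes p :: "'v::linorder mpoly"
  assumes "finite V" "finite Y" "\<And>a. inj_on a V \<Longrightarrow> a ` V \<inter> Y = {} \<Longrightarrow> eval a p = 0"
  shows "p = 0"
proof -
  define D :: "'v mpoly" where
    "D = (\<Prod>u\<in>V. \<Prod>v\<in>V - {u}. mvar v - mvar u) * (\<Prod>v\<in>V. \<Prod>y\<in>Y. mvar v - single 0 y)"
  have ne: "mvar v - single 0 y \<noteq> 0" for v :: 'v and y
  proof
    assume "mvar v - single 0 y = 0"
    then have "eval (\<lambda>_. y + 1) (mvar v - single 0 y) = 0" by simp
    then show False by simp
  qed
  have "D \<noteq> 0"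
    using assms(1,2) ne by (auto simp: D_def)
  moreover have "p * D = 0"
  proof (rule eval_eq_zeroD)
    fix a
    show "eval a (p * D) = 0"
    proof (cases "inj_on a V \<and> a ` V \<inter> Y = {}")
      case True
      then show ?thesis using assms(3) by simp
    next
      case False
      then have "eval a D = 0"
      proof (cases "inj_on a V")
        case True
        with False obtain v y where vy: "v \<in> V" "y \<in> Y" "a v = y" by auto
        then have "\<exists>v\<in>V. \<exists>y\<in>Y. a v - y = 0" by force
        then show ?thesis
          using assms(1,2) by (auto simp: D_def prod_zero_iff)
      next
        case False
        then have "\<exists>u\<in>V. \<exists>v\<in>V - {u}. a v - a u = 0" by (force simp: inj_on_def)
        then show ?thesis
          using assms(1,2) by (auto simp: D_def prod_zero_iff)
      qed
      then show ?thesis by simp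
    qed
  qed
  ultimately show ?thesis by simp
qed

section \<open>Divisibility by differences of variables\<close>

lemma relabel_fuse: "relabel \<theta> (relabel \<eta> p) = relabel (\<theta> \<circ> \<eta>) p"
  by (rule eval_inject) (simp add: comp_assoc)

lemma relabel_id [simp]: "relabel id p = p" "relabel (\<lambda>v. v) p = p"
  by (rule eval_inject, simp add: comp_def)+

lemma mpoly_induct [case_names const mvar add mult]:
  assumes "\<And>r. P (single 0 r)" "\<And>v. P (mvar v)"
    "\<And>p q. P p \<Longrightarrow> P q \<Longrightarrow> P (p + q)" "\<And>p q. P p \<Longrightarrow> P q \<Longrightarrow> P (p * q)"
  shows "P p"
proof (induction p rule: poly_mapping_add_induct)
  case (single m r)
  have 1: "P (1 :: 'a mpoly)" using assms(1)[of 1] by simp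
  have pw: "P (mvar v ^ n)" for v n
    by (induction n) (auto intro: assms 1)
  have "P (\<Prod>v\<in>K. mvar v ^ lookup m v)" if "finite K" for K
    using that by induction (auto intro: assms 1 pw)
  then have "P (single 0 r * rel.power_prod mvar m)"
    by (auto intro: assms simp: rel.power_prod_def)
  also have "single 0 r * rel.power_prod mvar m = single m r"
    by (rule eval_inject) (simp flip: eval_power_prod_mvar)
  finally show ?case .
qed (use assms(1)[of 0] assms(3) in auto)

abbreviation vdiff :: "'v \<Rightarrow> 'v \<Rightarrow> 'v mpoly" where
  "vdiff u v \<equiv> mvar v - mvar u"

lemma vdiff_dvd_relabel: "vdiff u v dvd p - relabel (id(v := u)) p"
proof (induction p rule: mpoly_induct)
  case (mult p q)
  have "p * q - relabel (id(v := u)) (p * q) =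
    (p - relabel (id(v := u)) p) * q + relabel (id(v := u)) p * (q - relabel (id(v := u)) q)"
    by (simp add: algebra_simps)
  moreover have "vdiff u v dvd (p - relabel (id(v := u)) p) * q +
      relabel (id(v := u)) p * (q - relabel (id(v := u)) q)"
    by (intro dvd_add dvd_mult dvd_mult2 mult.IH)
  ultimately show ?case by (simp only:)
next
  case (add p q)
  have "p + q - relabel (id(v := u)) (p + q) =
    (p - relabel (id(v := u)) p) + (q - relabel (id(v := u)) q)"
    by (simp add: algebra_simps)
  then show ?case using dvd_add[OF add.IH] by (simp only:)
qed auto

text \<open>The factor theorem. It tests divisibility by a homomorphism into a domain, so
  \<open>vdiff u v\<close> behaves as a prime.\<close>

lemma vdiff_dvd_iff: "vdiff u v dvd p \<longleftrightarrow> relabel (id(v := u)) p = 0"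
proof
  assume "vdiff u v dvd p"
  then show "relabel (id(v := u)) p = 0" by (auto elim!: dvdE)
qed (metis diff_zero vdiff_dvd_relabel)

text \<open>Primality of \<open>vdiff u v\<close> applies to one factor at a time: it divides
  \<open>p\<close>, is cancelled, and the induction continues with the quotient.\<close>

lemma vdiff_power_dvd_mult:
  fixes d p :: "'v::linorder mpoly"
  assumes "u \<noteq> v" "\<not> vdiff u v dvd d" "vdiff u v ^ k dvd d * p"
  shows "vdiff u v ^ k dvd p"
  using assms(3)
proof (induction k arbitrary: p)
  case (Suc k)
  have "vdiff u v dvd d * p" using Suc.prems by (auto elim: dvd_mult_left)
  then have "vdiff u v dvd p" using assms(2) by (auto simp: vdiff_dvd_iff)
  then obtain p' where p: "p = vdiff u v * p'" by (elim dvdE)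
  with Suc.prems have "vdiff u v * vdiff u v ^ k dvd vdiff u v * (d * p')"
    by (simp add: mult.left_commute)
  then have "vdiff u v ^ k dvd d * p'" using assms(1) by (subst (asm) dvd_mult_cancel_left) auto
  from Suc.IH[OF this] p show ?case by simp
qed auto

text \<open>The factors are pairwise non-associated primes.\<close>

lemma prod_vdiff_power_dvd:
  fixes p :: "'v::linorder mpoly"
  assumes "finite E" "\<And>u v. (u, v) \<in> E \<Longrightarrow> u \<noteq> v"
    "\<And>u v. (u, v) \<in> E \<Longrightarrow> (v, u) \<notin> E"
    "\<And>u v. (u, v) \<in> E \<Longrightarrow> vdiff u v ^ k dvd p"
  shows "(\<Prod>(u, v)\<in>E. vdiff u v ^ k) dvd p"
  using assms
proof (induction E arbitrary: p rule: finite_induct)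
  case (insert e E)
  obtain u v where e: "e = (u, v)" by (cases e)
  have "(\<Prod>(u, v)\<in>E. vdiff u v ^ k) dvd p"
  proof (rule insert.IH)
    fix x y assume xy: "(x, y) \<in> E"
    then have *: "(x, y) \<in> insert e E" by simp
    show "x \<noteq> y" by (rule insert.prems(1)[OF *])
    show "(y, x) \<notin> E" using insert.prems(2)[OF *] by simp
    show "vdiff x y ^ k dvd p" by (rule insert.prems(3)[OF *])
  qed
  then obtain q where q: "p = (\<Prod>(u, v)\<in>E. vdiff u v ^ k) * q" by (elim dvdE)
  have "vdiff u v ^ k dvd q"
  proof (rule vdiff_power_dvd_mult)
    show "u \<noteq> v" using insert.prems(1)[of u v] e by simp
    show "vdiff u v ^ k dvd (\<Prod>(u, v)\<in>E. vdiff u v ^ k) * q"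
      using insert.prems(3)[of u v] e q by simp
    \<comment> \<open>Identifying \<open>v\<close> with \<open>u\<close> collapses only the pair (u,
      v) and its reverse, and neither lies in \<open>E\<close>.\<close>
    have *: "(id(v := u)) x \<noteq> (id(v := u)) y" if "(x, y) \<in> E" for x y
    proof -
      from that have "x \<noteq> y" "(x, y) \<noteq> (u, v)" "(y, x) \<noteq> (u, v)"
        using insert.prems(1,2)[of x y] insert.hyps(2) e by auto
      then show ?thesis by auto
    qed
    show "\<not> vdiff u v dvd (\<Prod>(u, v)\<in>E. vdiff u v ^ k)"
    proof
      assume "vdiff u v dvd (\<Prod>(u, v)\<in>E. vdiff u v ^ k)"
      then have "(\<Prod>(x, y)\<in>E. relabel (id(v := u)) (vdiff x y ^ k)) = 0"
        by (simp add: vdiff_dvd_iff case_prod_unfold del: fun_upd_apply)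
      then obtain x y where "(x, y) \<in> E" "relabel (id(v := u)) (vdiff x y ^ k) = 0"
        using insert.hyps(1) by (auto simp: prod_zero_iff simp del: fun_upd_apply relabel_simps)
      then show False using *[of x y] by (auto simp del: fun_upd_apply)
    qed
  qed
  then show ?case using insert.hyps by (simp add: q e mult.commute mult_dvd_mono)
qed simp

text \<open>Setting the variables outside \<open>V\<close> to zero fixes \<open>d\<close> and the
  product, hence also \<open>q\<close> after cancelling \<open>d\<close>.\<close>

lemma vars_factor:
  fixes d q :: "'v::linorder mpoly"
  assumes "vars d \<subseteq> V" "vars (d * q) \<subseteq> V" "d \<noteq> 0"
  shows "vars q \<subseteq> V"
proof -
  define \<rho> :: "'v mpoly \<Rightarrow> 'v mpoly" where "\<rho> = rel.subst (\<lambda>v. if v \<in> V then mvar v else 0)"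
  have fixed: "\<rho> p = p" if "vars p \<subseteq> V" for p
  proof -
    have "\<rho> p = relabel id p"
      unfolding \<rho>_def relabel_eq by (rule rel.subst_cong) (use that in auto)
    then show ?thesis by simp
  qed
  have "d * q = \<rho> (d * q)" using fixed assms(2) by simp
  also have "\<dots> = d * \<rho> q" using fixed assms(1) by (simp add: \<rho>_def)
  finally have q: "q = \<rho> q" using assms(3) by simp
  have eval_\<rho>: "eval a (\<rho> p) = eval (\<lambda>v. if v \<in> V then a v else 0) p" for a p
    by (induction p rule: mpoly_induct) (simp_all add: \<rho>_def)
  show ?thesis
    unfolding vars_subset_iff
  proof (intro allI impI)
    fix a a' :: "'v \<Rightarrow> rat" assume "\<forall>v\<in>V. a v = a' v"
    then have "(\<lambda>v. if v \<in> V then a v else 0) = (\<lambda>v. if v \<in> V then a' v else 0)" by auto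
    then have "eval a (\<rho> q) = eval a' (\<rho> q)" by (simp add: eval_\<rho>)
    with q show "eval a q = eval a' q" by simp
  qed
qed

text \<open>The bridge from the fraction field to values: clearing denominators leaves an identity
  of polynomials, which may be tested where no denominator vanishes. The polynomial \<open>w\<close>
  lets the caller restrict further, to points with distinct coordinates.\<close>

lemma Fract_sum_iff:
  fixes p :: "'v::linorder mpoly"
  assumes "finite I" "\<And>i. i \<in> I \<Longrightarrow> d i \<noteq> 0" "w \<noteq> 0"
  shows "Fract p 1 = (\<Sum>i\<in>I. Fract (n i) (d i)) \<longleftrightarrow>
    (\<forall>a. eval a w \<noteq> 0 \<longrightarrow> (\<forall>i\<in>I. eval a (d i) \<noteq> 0) \<longrightarrow> eval a p = (\<Sum>i\<in>I. eval a (n i) / eval a (d i)))"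
proof -
  define D where "D = (\<Prod>i\<in>I. d i)"
  define N where "N = (\<Sum>i\<in>I. n i * (\<Prod>j\<in>I - {i}. d j))"
  have D0: "D \<noteq> 0" using assms by (simp add: D_def)
  have "(\<Sum>i\<in>I. Fract (n i) (d i)) = (\<Sum>i\<in>I. Fract (n i * (\<Prod>j\<in>I - {i}. d j)) D)"
  proof (rule sum.cong)
    fix i assume i: "i \<in> I"
    have "(\<Prod>j\<in>I - {i}. d j) \<noteq> 0" using assms by simp
    with i assms show "Fract (n i) (d i) = Fract (n i * (\<Prod>j\<in>I - {i}. d j)) D"
      by (simp add: eq_fract D_def prod.remove[of I i])
  qed simp
  also have "\<dots> = Fract N D"
  proof -
    have "(\<Sum>i\<in>J. Fract (m i) D) = Fract (\<Sum>i\<in>J. m i) D" if "finite J" for J m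
      using that
    proof induction
      case (insert x J)
      then show ?case using D0 by (simp add: eq_fract) (simp add: algebra_simps)
    qed (simp add: D0 Zero_fract_def eq_fract)
    then show ?thesis using assms(1) by (simp add: N_def)
  qed
  finally have "Fract p 1 = (\<Sum>i\<in>I. Fract (n i) (d i)) \<longleftrightarrow> p * D = N"
    using D0 by (simp add: eq_fract)
  also have "\<dots> \<longleftrightarrow> (\<forall>a. eval a w \<noteq> 0 \<longrightarrow> (\<forall>i\<in>I. eval a (d i) \<noteq> 0) \<longrightarrow> eval a (p * D) = eval a N)"
  proof
    assume R: "\<forall>a. eval a w \<noteq> 0 \<longrightarrow> (\<forall>i\<in>I. eval a (d i) \<noteq> 0) \<longrightarrow> eval a (p * D) = eval a N"
    \<comment> \<open>The factors \<open>D\<close> and \<open>w\<close> make the product vanish at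
      the excluded points too.\<close>
    have "(p * D - N) * D * w = 0"
    proof (rule eval_eq_zeroD)
      fix a
      show "eval a ((p * D - N) * D * w) = 0"
      proof (cases "(\<forall>i\<in>I. eval a (d i) \<noteq> 0) \<and> eval a w \<noteq> 0")
        case True
        with R show ?thesis by simp
      next
        case False
        then have "eval a D = 0 \<or> eval a w = 0" using assms(1) by (auto simp: D_def prod_zero_iff)
        then show ?thesis by auto
      qed
    qed
    with D0 assms(3) show "p * D = N" by simp
  qed simp
  also have "\<dots> \<longleftrightarrow> (\<forall>a. eval a w \<noteq> 0 \<longrightarrow> (\<forall>i\<in>I. eval a (d i) \<noteq> 0) \<longrightarrow>
      eval a p = (\<Sum>i\<in>I. eval a (n i) / eval a (d i)))"
  proof -
    have "eval a (p * D) = eval a N \<longleftrightarrow> eval a p = (\<Sum>i\<in>I. eval a (n i) / eval a (d i))"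
      if ne: "\<forall>i\<in>I. eval a (d i) \<noteq> 0" for a
    proof -
      have Da: "eval a D \<noteq> 0" using ne assms(1) by (simp add: D_def)
      have "eval a N = (\<Sum>i\<in>I. eval a (n i) / eval a (d i) * eval a D)"
        unfolding N_def evl.subst_sum
      proof (rule sum.cong)
        fix i assume i: "i \<in> I"
        with ne assms(1) show "eval a (n i * (\<Prod>j\<in>I - {i}. d j)) = eval a (n i) / eval a (d i) * eval a D"
          by (simp add: D_def prod.remove[of I i])
      qed simp
      then have "eval a N = (\<Sum>i\<in>I. eval a (n i) / eval a (d i)) * eval a D"
        by (simp only: sum_distrib_right)
      then show ?thesis using Da by (simp only: evl.subst_mult mult_cancel_right simp_thms)
    qed
    then show ?thesis by blast
  qed
  finally show ?thesis .
qed

section \<open>Symmetric polynomials as functions of finite sets of rationals\<close>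

text \<open>Indices start at 1, as the variables of the symmetric polynomials do, whereas list
  positions start at 0.\<close>

definition enum :: "'a::linorder set \<Rightarrow> nat \<Rightarrow> 'a" where
  "enum A i = sorted_list_of_set A ! (i - 1)"

lemma bij_enum:
  assumes "finite A"
  shows "bij_betw (enum A) {1..card A} A"
proof -
  have "bij_betw ((!) (sorted_list_of_set A)) {..<card A} A"
    using bij_betw_nth[of "sorted_list_of_set A"] assms by simp
  moreover have "bij_betw (\<lambda>i. i - 1) {1..card A} {..<card A}"
    by (rule bij_betwI[where g = Suc]) auto
  ultimately have "bij_betw ((!) (sorted_list_of_set A) \<circ> (\<lambda>i. i - 1)) {1..card A} A"
    by (rule bij_betw_trans[rotated])
  then show ?thesis by (simp add: comp_def enum_def[abs_def])
qed

lemma strict_mono_enum: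
  assumes "finite A"
  shows "strict_mono_on {1..card A} (enum A)"
proof (rule strict_mono_onI)
  fix i j assume "i \<in> {1..card A}" "j \<in> {1..card A}" "i < j"
  then show "enum A i < enum A j"
    using assms strict_sorted_list_of_set[of A] by (auto simp: enum_def sorted_wrt_iff_nth_less)
qed

lemma strict_mono_enum_unique:
  assumes "strict_mono_on {1..d} (f :: nat \<Rightarrow> 'a::linorder)" "i \<in> {1..d}"
  shows "f i = enum (f ` {1..d}) i"
proof -
  let ?l = "map f [1..<Suc d]"
  have "sorted_wrt (<) ?l"
    unfolding sorted_wrt_map
    by (rule sorted_wrt_mono_rel[OF _ sorted_wrt_upt]) (use assms(1) in \<open>auto simp: strict_mono_on_def\<close>)
  then have "sorted_list_of_set (set ?l) = ?l"
    by (intro sorted_list_of_set.idem_if_sorted_distinct) (auto simp: strict_sorted_iff)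
  moreover have "set ?l = f ` {1..d}" by (simp add: atLeastLessThanSuc_atLeastAtMost del: upt_Suc)
  moreover have "?l ! (i - 1) = f i"
    using assms(2) by (subst nth_map) (auto simp del: upt_Suc)
  ultimately show ?thesis by (simp add: enum_def del: upt_Suc)
qed

lemma two_enumerations:
  assumes "bij_betw e S A" "bij_betw e' S A"
  obtains \<pi> where "\<pi> permutes S" "\<And>i. i \<in> S \<Longrightarrow> e i = e' (\<pi> i)"
proof
  let ?\<pi> = "\<lambda>i. if i \<in> S then inv_into S e' (e i) else i"
  have "bij_betw (inv_into S e' \<circ> e) S S"
    using assms bij_betw_inv_into bij_betw_trans by blast
  then have "bij_betw ?\<pi> S S" by (rule iffD1[OF bij_betw_cong, rotated]) simp
  then show "?\<pi> permutes S" by (rule bij_imp_permutes) simp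
  fix i assume "i \<in> S"
  then show "e i = e' (?\<pi> i)"
    using assms by (simp add: bij_betw_apply bij_betw_inv_into_right)
qed

text \<open>The increasing enumeration is only a choice: by \<open>sval_eqI\<close> every
  enumeration of \<open>A\<close> gives the same value if \<open>f\<close> is symmetric in
  \<open>card A\<close> variables.\<close>

definition sval :: "nat mpoly \<Rightarrow> rat set \<Rightarrow> rat" where
  "sval f A = eval (enum A) f"

fun xy_point :: "(nat \<Rightarrow> 'a) \<Rightarrow> (nat \<Rightarrow> 'a) \<Rightarrow> xy \<Rightarrow> 'a" where
  "xy_point s t (Xv i) = s i"
| "xy_point s t (Yv j) = t j"

definition bval :: "xy mpoly \<Rightarrow> rat set \<Rightarrow> rat set \<Rightarrow> rat" where
  "bval f A B = eval (xy_point (enum A) (enum B)) f"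

lemma xy_point_comp [simp]:
  "xy_point s t \<circ> xy_map \<sigma> \<tau> = xy_point (s \<circ> \<sigma>) (t \<circ> \<tau>)" "xy_point s t \<circ> Xv = s" "xy_point s t \<circ> Yv = t"
proof (rule ext)
  fix v show "(xy_point s t \<circ> xy_map \<sigma> \<tau>) v = xy_point (s \<circ> \<sigma>) (t \<circ> \<tau>) v" by (cases v) auto
qed auto

lemma xy_point_eta [simp]: "xy_point (\<lambda>i. a (Xv i)) (\<lambda>j. a (Yv j)) = a"
proof
  fix v show "xy_point (\<lambda>i. a (Xv i)) (\<lambda>j. a (Yv j)) v = a v" by (cases v) auto
qed

lemma sval_eqI:
  assumes "f \<in> sym_polys d" "bij_betw e {1..d} A"
  shows "eval e f = sval f A"
proof -
  have "finite A" "card A = d" using assms(2) bij_betw_finite bij_betw_same_card by force+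
  with bij_enum[of A] have "bij_betw (enum A) {1..d} A" by simp
  from two_enumerations[OF assms(2) this]
  obtain \<pi> where \<pi>: "\<pi> permutes {1..d}" "\<And>i. i \<in> {1..d} \<Longrightarrow> e i = enum A (\<pi> i)" by metis
  have "eval e f = eval (enum A \<circ> \<pi>) f"
    by (rule evl.subst_cong) (use \<pi>(2) assms(1) in \<open>auto simp: sym_polys_def\<close>)
  also have "\<dots> = eval (enum A) (relabel \<pi> f)" by simp
  also have "\<dots> = sval f A" using assms(1) \<pi>(1) by (simp add: sym_polys_def sval_def)
  finally show ?thesis .
qed

lemma bval_eqI:
  assumes "f \<in> bisym_polys (m, n)" "bij_betw s {1..m} A" "bij_betw t {1..n} B"
  shows "eval (xy_point s t) f = bval f A B"
proof -
  have "finite A" "card A = m" "finite B" "card B = n"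
    using assms(2,3) bij_betw_finite bij_betw_same_card by force+
  with bij_enum[of A] bij_enum[of B] have e: "bij_betw (enum A) {1..m} A" "bij_betw (enum B) {1..n} B" by auto
  obtain \<pi> where \<pi>: "\<pi> permutes {1..m}" "\<And>i. i \<in> {1..m} \<Longrightarrow> s i = enum A (\<pi> i)"
    using two_enumerations[OF assms(2) e(1)] by metis
  obtain \<rho> where \<rho>: "\<rho> permutes {1..n}" "\<And>i. i \<in> {1..n} \<Longrightarrow> t i = enum B (\<rho> i)"
    using two_enumerations[OF assms(3) e(2)] by metis
  have "eval (xy_point s t) f = eval (xy_point (enum A) (enum B) \<circ> xy_map \<pi> \<rho>) f"
  proof (rule evl.subst_cong)
    fix v assume "v \<in> vars f"
    with assms(1) have "v \<in> Xv ` {1..m} \<union> Yv ` {1..n}" by auto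
    then show "xy_point s t v = (xy_point (enum A) (enum B) \<circ> xy_map \<pi> \<rho>) v"
      using \<pi>(2) \<rho>(2) by auto
  qed
  also have "\<dots> = eval (xy_point (enum A) (enum B)) (relabel (xy_map \<pi> \<rho>) f)" by simp
  also have "\<dots> = bval f A B" using assms(1) \<pi>(1) \<rho>(1) by (simp add: bval_def)
  finally show ?thesis .
qed

lemma bij_betw_inj_image: "inj_on e S \<Longrightarrow> bij_betw e S (e ` S)"
  by (simp add: bij_betw_def)

text \<open>Testing at injective points is enough by density, and only there are the products below
  known as sums over subsets.\<close>

lemma sym_polysI:
  assumes "vars f \<subseteq> {1..d}"
    "\<And>e \<pi>. inj_on e {1..d} \<Longrightarrow> \<pi> permutes {1..d} \<Longrightarrow> eval (e \<circ> \<pi>) f = eval e f"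
  shows "f \<in> sym_polys d"
  unfolding sym_polys_def
proof safe
  fix \<pi> assume \<pi>: "\<pi> permutes {1..d}"
  have "relabel \<pi> f - f = 0"
    by (rule eval_eq_zeroD_generic[of "{1..d}" "{}"]) (use assms(2) \<pi> in auto)
  then show "relabel \<pi> f = f" by simp
qed (use assms(1) in auto)

lemma eval_eq_zeroD_xy:
  assumes "finite Y" "\<And>s t. inj_on s {1..m} \<Longrightarrow> inj_on t {1..n} \<Longrightarrow> s ` {1..m} \<inter> Y = {} \<Longrightarrow>
    t ` {1..n} \<inter> Y = {} \<Longrightarrow> eval (xy_point s t) p = 0"
  shows "p = 0"
proof (rule eval_eq_zeroD_generic[OF _ assms(1)])
  fix a assume a: "inj_on a (Xv ` {1..m} \<union> Yv ` {1..n})" "a ` (Xv ` {1..m} \<union> Yv ` {1..n}) \<inter> Y = {}"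
  have "eval (xy_point (\<lambda>i. a (Xv i)) (\<lambda>j. a (Yv j))) p = 0"
  proof (rule assms(2))
    have "inj_on a (Xv ` {1..m})" "inj_on a (Yv ` {1..n})"
      using a(1) by (auto intro: inj_on_subset)
    then show "inj_on (\<lambda>i. a (Xv i)) {1..m}" "inj_on (\<lambda>j. a (Yv j)) {1..n}"
      unfolding inj_on_def by blast+
    show "(\<lambda>i. a (Xv i)) ` {1..m} \<inter> Y = {}" "(\<lambda>j. a (Yv j)) ` {1..n} \<inter> Y = {}"
      using a(2) by blast+
  qed
  then show "eval a p = 0" by simp
qed auto

lemma bisym_polysI:
  assumes "vars f \<subseteq> Xv ` {1..m} \<union> Yv ` {1..n}"
    "\<And>s t \<pi> \<rho>. inj_on s {1..m} \<Longrightarrow> inj_on t {1..n} \<Longrightarrow> \<pi> permutes {1..m} \<Longrightarrow> \<rho> permutes {1..n} \<Longrightarrow>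
      eval (xy_point (s \<circ> \<pi>) (t \<circ> \<rho>)) f = eval (xy_point s t) f"
  shows "f \<in> bisym_polys (m, n)"
  unfolding bisym_polys.simps
proof (intro CollectI conjI allI impI)
  fix \<pi> \<rho> assume *: "\<pi> permutes {1..m}" "\<rho> permutes {1..n}"
  have "relabel (xy_map \<pi> \<rho>) f - f = 0"
    by (rule eval_eq_zeroD_xy[of "{}" m n]) (use assms(2) * in auto)
  then show "relabel (xy_map \<pi> \<rho>) f = f" by simp
qed (use assms(1) in auto)

lemma bisym_eqI:
  assumes "f \<in> bisym_polys (m, n)" "g \<in> bisym_polys (m, n)"
    "\<And>A B. finite A \<Longrightarrow> finite B \<Longrightarrow> card A = m \<Longrightarrow> card B = n \<Longrightarrow> bval f A B = bval g A B"
  shows "f = g"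
proof -
  have "f - g = 0"
  proof (rule eval_eq_zeroD_xy[of "{}" m n])
    fix s t :: "nat \<Rightarrow> rat" assume "inj_on s {1..m}" "inj_on t {1..n}"
    then have b: "bij_betw s {1..m} (s ` {1..m})" "bij_betw t {1..n} (t ` {1..n})"
      by (auto simp: bij_betw_def)
    then have "card (s ` {1..m}) = m" "card (t ` {1..n}) = n" using bij_betw_same_card by force+
    with assms(3) bval_eqI[OF assms(1) b] bval_eqI[OF assms(2) b]
    show "eval (xy_point s t) (f - g) = 0" by simp
  qed simp
  then show ?thesis by simp
qed

section \<open>Shuffles and subsets\<close>

lemma finite_shuffle_perms [simp]: "finite (shuffle_perms d e)"
  unfolding shuffle_perms_def by (rule finite_subset[OF _ finite_permutations[of "{1..d + e}"]]) auto

lemma shuffle_perms_permutes: "\<sigma> \<in> shuffle_perms d e \<Longrightarrow> \<sigma> permutes {1..d + e}"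
  by (simp add: shuffle_perms_def)

text \<open>A shuffle is increasing on both blocks, so the image of the first block determines
  it.\<close>

lemma shuffle_perms_unique:
  assumes "\<sigma> \<in> shuffle_perms d e"
  shows "\<sigma> i = (if i \<in> {1..d} then enum (\<sigma> ` {1..d}) i
    else if i \<in> {d + 1..d + e} then enum ({1..d + e} - \<sigma> ` {1..d}) (i - d) else i)"
proof -
  have p: "\<sigma> permutes {1..d + e}" using assms by (rule shuffle_perms_permutes)
  have "strict_mono_on {1..d} \<sigma>" using assms by (simp add: shuffle_perms_def)
  note 1 = strict_mono_enum_unique[OF this]
  have "strict_mono_on {1..e} (\<lambda>i. \<sigma> (d + i))"
    using assms by (auto simp: shuffle_perms_def strict_mono_on_def)
  note 2 = strict_mono_enum_unique[OF this]
  have "(\<lambda>i. \<sigma> (d + i)) ` {1..e} = \<sigma> ` {d + 1..d + e}"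
    using image_image[of \<sigma> "(+) d" "{1..e}"] by (simp add: image_add_atLeastAtMost add.commute)
  also have "{d + 1..d + e} = {1..d + e} - {1..d}" by auto
  also have "\<sigma> ` \<dots> = {1..d + e} - \<sigma> ` {1..d}"
    using p by (simp add: image_set_diff permutes_inj permutes_image)
  finally have 3: "(\<lambda>i. \<sigma> (d + i)) ` {1..e} = {1..d + e} - \<sigma> ` {1..d}" .
  show ?thesis
  proof (cases "i \<in> {d + 1..d + e}")
    case True
    then have "\<sigma> (d + (i - d)) = enum ((\<lambda>i. \<sigma> (d + i)) ` {1..e}) (i - d)"
      by (intro 2) auto
    then have "\<sigma> (d + (i - d)) = enum ({1..d + e} - \<sigma> ` {1..d}) (i - d)"
      by (simp only: 3)
    with True show ?thesis by auto
  next
    case False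
    then show ?thesis using 1 p permutes_not_in[OF p, of i] by auto
  qed
qed

lemma shuffle_perms_exists:
  assumes "P \<subseteq> {1..d + e}" "card P = d"
  shows "\<exists>\<sigma>\<in>shuffle_perms d e. \<sigma> ` {1..d} = P"
proof -
  let ?Q = "{1..d + e} - P"
  define \<sigma> where "\<sigma> i = (if i \<in> {1..d} then enum P i
    else if i \<in> {d + 1..d + e} then enum ?Q (i - d) else i)" for i
  have fin: "finite P" "finite ?Q" using assms(1) finite_subset by auto
  have cQ: "card ?Q = e" using assms by (simp add: card_Diff_subset fin)
  have bP: "bij_betw (enum P) {1..d} P" "strict_mono_on {1..d} (enum P)"
    using bij_enum[OF fin(1)] strict_mono_enum[OF fin(1)] assms(2) by auto
  have bQ: "bij_betw (enum ?Q) {1..e} ?Q" "strict_mono_on {1..e} (enum ?Q)"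
    using bij_enum[OF fin(2)] strict_mono_enum[OF fin(2)] cQ by auto
  have 1: "bij_betw \<sigma> {1..d} P"
    using bP(1) by (rule iffD1[OF bij_betw_cong, rotated]) (simp add: \<sigma>_def)
  have "bij_betw (\<lambda>i. i - d) {d + 1..d + e} {1..e}"
    by (rule bij_betwI[where g = "\<lambda>i. i + d"]) auto
  then have "bij_betw (enum ?Q \<circ> (\<lambda>i. i - d)) {d + 1..d + e} ?Q"
    using bQ(1) by (rule bij_betw_trans)
  then have 2: "bij_betw \<sigma> {d + 1..d + e} ?Q"
    by (rule iffD1[OF bij_betw_cong, rotated]) (simp add: \<sigma>_def)
  have "bij_betw \<sigma> ({1..d} \<union> {d + 1..d + e}) (P \<union> ?Q)"
    by (rule bij_betw_combine[OF 1 2]) auto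
  moreover have "{1..d} \<union> {d + 1..d + e} = {1..d + e}" by auto
  moreover have "P \<union> ?Q = {1..d + e}" using assms(1) by auto
  ultimately have "bij_betw \<sigma> {1..d + e} {1..d + e}" by simp
  then have "\<sigma> permutes {1..d + e}"
    by (rule bij_imp_permutes) (auto simp: \<sigma>_def)
  moreover have "strict_mono_on {1..d} \<sigma>"
    using bP(2) by (auto simp: strict_mono_on_def \<sigma>_def)
  moreover have "strict_mono_on {d + 1..d + e} \<sigma>"
  proof (rule strict_mono_onI)
    fix i j assume ij: "i \<in> {d + 1..d + e}" "j \<in> {d + 1..d + e}" "i < j"
    then have "i - d \<in> {1..e}" "j - d \<in> {1..e}" "i - d < j - d" by auto
    with bQ(2) have "enum ?Q (i - d) < enum ?Q (j - d)" by (auto simp: strict_mono_on_def)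
    with ij show "\<sigma> i < \<sigma> j" by (simp add: \<sigma>_def)
  qed
  ultimately have "\<sigma> \<in> shuffle_perms d e" by (simp add: shuffle_perms_def)
  moreover have "\<sigma> ` {1..d} = P" using 1 by (simp add: bij_betw_def)
  ultimately show ?thesis by blast
qed

text \<open>The summand sees only the images of the two blocks, and a shuffle amounts to a choice of
  the first image. Every shuffle formula becomes a sum over decompositions of a set in this
  way.\<close>

lemma sum_shuffle_perms:
  fixes s :: "nat \<Rightarrow> 'a" and h :: "'a set \<Rightarrow> 'a set \<Rightarrow> 'b::comm_monoid_add"
  assumes s: "bij_betw s {1..d + e} A"
  shows "(\<Sum>\<sigma>\<in>shuffle_perms d e. h (s ` \<sigma> ` {1..d}) (s ` \<sigma> ` {d + 1..d + e})) =
    (\<Sum>A1 | A1 \<subseteq> A \<and> card A1 = d. h A1 (A - A1))"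
proof -
  have inj: "inj_on s {1..d + e}" and A: "A = s ` {1..d + e}" using s by (auto simp: bij_betw_def)
  have sub: "\<sigma> ` {1..d} \<subseteq> {1..d + e}" "\<sigma> ` {d + 1..d + e} = {1..d + e} - \<sigma> ` {1..d}"
    "card (\<sigma> ` {1..d}) = d"
    if "\<sigma> \<in> shuffle_perms d e" for \<sigma>
  proof -
    note p = shuffle_perms_permutes[OF that]
    have "\<sigma> ` {1..d} \<subseteq> \<sigma> ` {1..d + e}" by (rule image_mono) auto
    then show "\<sigma> ` {1..d} \<subseteq> {1..d + e}" using p by (simp add: permutes_image)
    have "{d + 1..d + e} = {1..d + e} - {1..d}" by auto
    then show "\<sigma> ` {d + 1..d + e} = {1..d + e} - \<sigma> ` {1..d}"
      using p by (simp add: image_set_diff permutes_inj permutes_image)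
    show "card (\<sigma> ` {1..d}) = d"
      using card_image[of \<sigma> "{1..d}"] p by (simp add: inj_on_subset[OF permutes_inj])
  qed
  have "bij_betw (\<lambda>\<sigma>. s ` \<sigma> ` {1..d}) (shuffle_perms d e) {A1. A1 \<subseteq> A \<and> card A1 = d}"
    unfolding bij_betw_def
  proof
    show "inj_on (\<lambda>\<sigma>. s ` \<sigma> ` {1..d}) (shuffle_perms d e)"
    proof (rule inj_onI)
      fix \<sigma> \<tau> assume *: "\<sigma> \<in> shuffle_perms d e" "\<tau> \<in> shuffle_perms d e"
        "s ` \<sigma> ` {1..d} = s ` \<tau> ` {1..d}"
      then have "\<sigma> ` {1..d} = \<tau> ` {1..d}"
        using inj_on_image_eq_iff[OF inj] sub(1) by metis
      then show "\<sigma> = \<tau>"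
        using shuffle_perms_unique[OF *(1)] shuffle_perms_unique[OF *(2)] by (metis ext)
    qed
    show "(\<lambda>\<sigma>. s ` \<sigma> ` {1..d}) ` shuffle_perms d e = {A1. A1 \<subseteq> A \<and> card A1 = d}"
    proof (intro equalityI subsetI)
      fix A1 assume "A1 \<in> (\<lambda>\<sigma>. s ` \<sigma> ` {1..d}) ` shuffle_perms d e"
      then obtain \<sigma> where *: "\<sigma> \<in> shuffle_perms d e" "A1 = s ` \<sigma> ` {1..d}" by auto
      have "card A1 = d"
        using sub[OF *(1)] card_image[OF inj_on_subset[OF inj sub(1)[OF *(1)]]] *(2) by simp
      moreover have "A1 \<subseteq> A" unfolding A *(2) by (rule image_mono) (rule sub(1)[OF *(1)])
      ultimately show "A1 \<in> {A1. A1 \<subseteq> A \<and> card A1 = d}" by simp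
    next
      fix A1 assume "A1 \<in> {A1. A1 \<subseteq> A \<and> card A1 = d}"
      then have A1: "A1 \<subseteq> A" "card A1 = d" by auto
      define P where "P = {i \<in> {1..d + e}. s i \<in> A1}"
      have P: "P \<subseteq> {1..d + e}" "s ` P = A1" using A1(1) by (auto simp: P_def A)
      then have "card P = d" using A1(2) card_image[OF inj_on_subset[OF inj P(1)]] by simp
      with P(1) obtain \<sigma> where "\<sigma> \<in> shuffle_perms d e" "\<sigma> ` {1..d} = P"
        using shuffle_perms_exists by metis
      with P(2) show "A1 \<in> (\<lambda>\<sigma>. s ` \<sigma> ` {1..d}) ` shuffle_perms d e"
        by (intro image_eqI[of _ _ \<sigma>]) simp_all
    qed
  qed
  note sum.reindex_bij_betw[OF this, of "\<lambda>A1. h A1 (A - A1)", symmetric]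
  moreover have "s ` \<sigma> ` {d + 1..d + e} = A - s ` \<sigma> ` {1..d}" if "\<sigma> \<in> shuffle_perms d e" for \<sigma>
    unfolding sub(2)[OF that] A by (rule inj_on_image_set_diff[OF inj]) (use sub(1)[OF that] in auto)
  ultimately show ?thesis by simp
qed

section \<open>The shuffle product of type \<open>A\<^sub>1\<close>\<close>

lemma vars_closure:
  "vars p \<subseteq> V \<Longrightarrow> vars q \<subseteq> V \<Longrightarrow> vars (p * q) \<subseteq> V"
  "vars p \<subseteq> V \<Longrightarrow> vars q \<subseteq> V \<Longrightarrow> vars (p + q) \<subseteq> V"
  "vars p \<subseteq> V \<Longrightarrow> vars q \<subseteq> V \<Longrightarrow> vars (p - q) \<subseteq> V"
  "v \<in> V \<Longrightarrow> vars (mvar v) \<subseteq> V"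
  "(\<And>v. v \<in> vars p \<Longrightarrow> \<theta> v \<in> V) \<Longrightarrow> vars (relabel \<theta> p) \<subseteq> V"
  "(\<And>i. i \<in> I \<Longrightarrow> vars (h i) \<subseteq> V) \<Longrightarrow> vars (sum h I) \<subseteq> V"
  "(\<And>i. i \<in> I \<Longrightarrow> vars (h i) \<subseteq> V) \<Longrightarrow> vars (prod h I) \<subseteq> V"
proof -
  show "vars p \<subseteq> V \<Longrightarrow> vars q \<subseteq> V \<Longrightarrow> vars (p * q) \<subseteq> V"
    "vars p \<subseteq> V \<Longrightarrow> vars q \<subseteq> V \<Longrightarrow> vars (p + q) \<subseteq> V"
    "vars p \<subseteq> V \<Longrightarrow> vars q \<subseteq> V \<Longrightarrow> vars (p - q) \<subseteq> V"
    "v \<in> V \<Longrightarrow> vars (mvar v) \<subseteq> V"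
    unfolding vars_subset_iff evl.subst_mult evl.subst_add evl.subst_diff evl.subst_mvar
    by (intro allI impI arg_cong2[of _ _ _ _ "(*)"] arg_cong2[of _ _ _ _ "(+)"] arg_cong2[of _ _ _ _ "(-)"]; blast)+
  show "(\<And>i. i \<in> I \<Longrightarrow> vars (h i) \<subseteq> V) \<Longrightarrow> vars (sum h I) \<subseteq> V"
    "(\<And>i. i \<in> I \<Longrightarrow> vars (h i) \<subseteq> V) \<Longrightarrow> vars (prod h I) \<subseteq> V"
    unfolding vars_subset_iff evl.subst_sum evl.subst_prod
    by (intro allI impI sum.cong prod.cong refl; blast)+
  assume *: "\<And>v. v \<in> vars p \<Longrightarrow> \<theta> v \<in> V"
  show "vars (relabel \<theta> p) \<subseteq> V"
    unfolding vars_subset_iff eval_relabel by (intro allI impI evl.subst_cong) (use * in auto)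
qed

text \<open>Up to sign, the resultant of the monic polynomials with root sets A and B.\<close>

definition dprod :: "rat set \<Rightarrow> rat set \<Rightarrow> rat" where
  "dprod A B = (\<Prod>a\<in>A. \<Prod>b\<in>B. b - a)"

text \<open>The value of \<open>Delta1\<close> over \<open>Delta0\<close> when the x values are
  split into A, A' and the y values into B, B'. For disjoint A, A' and disjoint B, B', all finite,
  the denominator is nonzero, whereas the numerator vanishes if A meets B' or B meets A'.\<close>

definition shuffle_kernel :: "rat set \<Rightarrow> rat set \<Rightarrow> rat set \<Rightarrow> rat set \<Rightarrow> rat" where
  "shuffle_kernel A B A' B' = dprod A B' * dprod B A' / (dprod A A' * dprod B B')"

lemma dprod_reindex:
  assumes "inj_on f I" "inj_on g J"
  shows "(\<Prod>i\<in>I. \<Prod>j\<in>J. g j - f i) = dprod (f ` I) (g ` J)"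
    and "(\<Prod>j\<in>J. \<Prod>i\<in>I. g j - f i) = dprod (f ` I) (g ` J)"
  unfolding dprod_def using assms by (simp_all add: prod.reindex) (rule prod.swap)

lemma shuffle_perms_inj:
  assumes "inj_on s {1..m + r}" "\<sigma> \<in> shuffle_perms m r"
  shows "inj_on (s \<circ> \<sigma>) {1..m + r}" "inj_on (s \<circ> \<sigma>) {1..m}" "inj_on (s \<circ> \<sigma>) {m + 1..m + r}"
    "bij_betw (s \<circ> \<sigma>) {1..m} (s ` \<sigma> ` {1..m})"
    "bij_betw (s \<circ> (\<lambda>i. \<sigma> (m + i))) {1..r} (s ` \<sigma> ` {m + 1..m + r})"
proof -
  note p = shuffle_perms_permutes[OF assms(2)]
  show 1: "inj_on (s \<circ> \<sigma>) {1..m + r}"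
    by (rule comp_inj_on) (use p assms(1) in \<open>auto simp: permutes_image inj_on_subset[OF permutes_inj]\<close>)
  show 2: "inj_on (s \<circ> \<sigma>) {1..m}" "inj_on (s \<circ> \<sigma>) {m + 1..m + r}"
    by (rule inj_on_subset[OF 1]; auto)+
  show "bij_betw (s \<circ> \<sigma>) {1..m} (s ` \<sigma> ` {1..m})"
    using 2(1) by (simp add: bij_betw_def image_comp)
  have "bij_betw (\<lambda>i. m + i) {1..r} {m + 1..m + r}"
    by (rule bij_betwI[where g = "\<lambda>i. i - m"]) auto
  moreover have "bij_betw (s \<circ> \<sigma>) {m + 1..m + r} (s ` \<sigma> ` {m + 1..m + r})"
    using 2(2) by (simp add: bij_betw_def image_comp)
  ultimately have "bij_betw ((s \<circ> \<sigma>) \<circ> (\<lambda>i. m + i)) {1..r} (s ` \<sigma> ` {m + 1..m + r})"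
    by (rule bij_betw_trans)
  then show "bij_betw (s \<circ> (\<lambda>i. \<sigma> (m + i))) {1..r} (s ` \<sigma> ` {m + 1..m + r})"
    by (simp add: comp_def)
qed

definition offdiag :: "nat \<Rightarrow> nat \<Rightarrow> (xy \<times> xy) set" where
  "offdiag M N = {(Xv i, Xv j) |i j. i \<in> {1..M} \<and> j \<in> {1..M} \<and> i \<noteq> j} \<union>
     {(Yv i, Yv j) |i j. i \<in> {1..N} \<and> j \<in> {1..N} \<and> i \<noteq> j}"

text \<open>The pairs in \<open>offdiag\<close> are ordered, so each difference occurs in both
  orientations: up to sign this is the product of the discriminants of the x and of the y variables,
  symmetric rather than alternating.\<close>

definition disc :: "nat \<Rightarrow> nat \<Rightarrow> xy mpoly" where
  "disc M N = (\<Prod>(u, v)\<in>offdiag M N. vdiff u v)"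

lemma finite_offdiag [simp]: "finite (offdiag M N)"
  by (rule finite_subset[of _ "(Xv ` {1..M} \<union> Yv ` {1..N}) \<times> (Xv ` {1..M} \<union> Yv ` {1..N})"])
    (auto simp: offdiag_def)

lemma offdiag_neq: "(u, v) \<in> offdiag M N \<Longrightarrow> u \<noteq> v"
  by (auto simp: offdiag_def)

lemma disc_neq_0 [simp]: "disc M N \<noteq> 0"
  unfolding disc_def by (auto simp: prod_zero_iff dest: offdiag_neq)

lemma eval_disc_neq_0_iff: "eval a (disc M N) \<noteq> 0 \<longleftrightarrow>
    inj_on (\<lambda>i. a (Xv i)) {1..M} \<and> inj_on (\<lambda>j. a (Yv j)) {1..N}"
proof -
  have "eval a (disc M N) = 0 \<longleftrightarrow> (\<exists>e\<in>offdiag M N. a (fst e) = a (snd e))"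
    by (simp add: disc_def prod_zero_iff case_prod_unfold) metis
  also have "\<dots> \<longleftrightarrow> (\<exists>i\<in>{1..M}. \<exists>j\<in>{1..M}. i \<noteq> j \<and> a (Xv i) = a (Xv j)) \<or>
      (\<exists>i\<in>{1..N}. \<exists>j\<in>{1..N}. i \<noteq> j \<and> a (Yv i) = a (Yv j))"
  proof
    assume "(\<exists>i\<in>{1..M}. \<exists>j\<in>{1..M}. i \<noteq> j \<and> a (Xv i) = a (Xv j)) \<or>
      (\<exists>i\<in>{1..N}. \<exists>j\<in>{1..N}. i \<noteq> j \<and> a (Yv i) = a (Yv j))"
    then show "\<exists>e\<in>offdiag M N. a (fst e) = a (snd e)"
    proof (elim disjE bexE conjE)
      fix i j assume "i \<in> {1..M}" "j \<in> {1..M}" "i \<noteq> j" "a (Xv i) = a (Xv j)"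
      then show ?thesis by (intro bexI[of _ "(Xv i, Xv j)"]) (auto simp: offdiag_def)
    next
      fix i j assume "i \<in> {1..N}" "j \<in> {1..N}" "i \<noteq> j" "a (Yv i) = a (Yv j)"
      then show ?thesis by (intro bexI[of _ "(Yv i, Yv j)"]) (auto simp: offdiag_def)
    qed
  next
    assume "\<exists>e\<in>offdiag M N. a (fst e) = a (snd e)"
    then obtain u v where "(u, v) \<in> offdiag M N" "a u = a v" by auto
    then show "(\<exists>i\<in>{1..M}. \<exists>j\<in>{1..M}. i \<noteq> j \<and> a (Xv i) = a (Xv j)) \<or>
      (\<exists>i\<in>{1..N}. \<exists>j\<in>{1..N}. i \<noteq> j \<and> a (Yv i) = a (Yv j))"
      unfolding offdiag_def by blast
  qed
  also have "\<dots> \<longleftrightarrow> \<not> (inj_on (\<lambda>i. a (Xv i)) {1..M} \<and> inj_on (\<lambda>j. a (Yv j)) {1..N})"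
    unfolding inj_on_def by blast
  finally show ?thesis by blast
qed

lemma xy_map_permutes_offdiag:
  assumes "\<pi> permutes {1..M}" "\<rho> permutes {1..N}"
  shows "map_prod (xy_map \<pi> \<rho>) (xy_map \<pi> \<rho>) ` offdiag M N = offdiag M N"
    and "inj (xy_map \<pi> \<rho>)"
proof -
  show inj: "inj (xy_map \<pi> \<rho>)"
  proof (rule injI)
    fix u v assume "xy_map \<pi> \<rho> u = xy_map \<pi> \<rho> v"
    then show "u = v"
      using permutes_inj[OF assms(1)] permutes_inj[OF assms(2)]
      by (cases u; cases v) (auto dest: injD)
  qed
  have "\<pi> i \<in> {1..M} \<longleftrightarrow> i \<in> {1..M}" "\<rho> j \<in> {1..N} \<longleftrightarrow> j \<in> {1..N}" for i j
    using assms by (auto simp: permutes_in_image simp del: atLeastAtMost_iff)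
  moreover have "\<pi> i = \<pi> j \<longleftrightarrow> i = j" "\<rho> i = \<rho> j \<longleftrightarrow> i = j" for i j
    using assms by (meson injD permutes_inj)+
  ultimately have "map_prod (xy_map \<pi> \<rho>) (xy_map \<pi> \<rho>) ` offdiag M N \<subseteq> offdiag M N"
    by (auto simp: offdiag_def simp del: atLeastAtMost_iff)
  then show "map_prod (xy_map \<pi> \<rho>) (xy_map \<pi> \<rho>) ` offdiag M N = offdiag M N"
    by (intro card_subset_eq) (auto intro!: card_image prod.inj_map inj_on_subset[OF prod.inj_map[OF inj inj]])
qed

lemma relabel_disc:
  assumes "\<pi> permutes {1..M}" "\<rho> permutes {1..N}"
  shows "relabel (xy_map \<pi> \<rho>) (disc M N) = disc M N"
proof -
  note * = xy_map_permutes_offdiag[OF assms]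
  let ?\<theta> = "xy_map \<pi> \<rho>"
  have "disc M N = (\<Prod>(u, v)\<in>map_prod ?\<theta> ?\<theta> ` offdiag M N. vdiff u v)"
    by (simp add: disc_def *(1))
  also have "\<dots> = (\<Prod>(u, v)\<in>offdiag M N. vdiff (?\<theta> u) (?\<theta> v))"
    by (subst prod.reindex) (auto simp: case_prod_unfold intro: inj_on_subset[OF prod.inj_map[OF *(2) *(2)]])
  also have "\<dots> = relabel ?\<theta> (disc M N)" by (simp add: disc_def case_prod_unfold)
  finally show ?thesis by simp
qed

context
  fixes m n r q :: nat and f g :: "xy mpoly"
  assumes f: "f \<in> bisym_polys (m, n)" and g: "g \<in> bisym_polys (r, q)"
begin

private abbreviation (input) "std \<equiv> Xv ` {1..m + r} \<union> Yv ` {1..n + q}"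

private definition "num \<sigma> \<tau> = relabel (xy_map \<sigma> \<tau>) f
  * relabel (xy_map (\<lambda>i. \<sigma> (m + i)) (\<lambda>j. \<tau> (n + j))) g * relabel (xy_map \<sigma> \<tau>) (Delta1 m n r q)"

private definition "den \<sigma> \<tau> = relabel (xy_map \<sigma> \<tau>) (Delta0 m n r q)"

private definition "convol A B = (\<Sum>A1 | A1 \<subseteq> A \<and> card A1 = m. \<Sum>B1 | B1 \<subseteq> B \<and> card B1 = n.
  bval f A1 B1 * bval g (A - A1) (B - B1) * shuffle_kernel A1 B1 (A - A1) (B - B1))"

private lemma sum_convol:
  assumes s: "inj_on s {1..m + r}" and t: "inj_on t {1..n + q}"
  shows "(\<Sum>\<sigma>\<in>shuffle_perms m r. \<Sum>\<tau>\<in>shuffle_perms n q.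
      eval (xy_point s t) (num \<sigma> \<tau>) / eval (xy_point s t) (den \<sigma> \<tau>)) =
    convol (s ` {1..m + r}) (t ` {1..n + q})"
proof -
  let ?H = "\<lambda>A1 A2 B1 B2. bval f A1 B1 * bval g A2 B2 * shuffle_kernel A1 B1 A2 B2"
  have "eval (xy_point s t) (num \<sigma> \<tau>) / eval (xy_point s t) (den \<sigma> \<tau>) =
    ?H (s ` \<sigma> ` {1..m}) (s ` \<sigma> ` {m + 1..m + r}) (t ` \<tau> ` {1..n}) (t ` \<tau> ` {n + 1..n + q})"
    if "\<sigma> \<in> shuffle_perms m r" "\<tau> \<in> shuffle_perms n q" for \<sigma> \<tau>
  proof -
    note a = shuffle_perms_inj[OF s that(1)] and b = shuffle_perms_inj[OF t that(2)]
    have "eval (xy_point s t) (relabel (xy_map \<sigma> \<tau>) (Delta1 m n r q)) =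
      dprod (s ` \<sigma> ` {1..m}) (t ` \<tau> ` {n + 1..n + q}) * dprod (t ` \<tau> ` {1..n}) (s ` \<sigma> ` {m + 1..m + r})"
      using dprod_reindex(1)[OF a(2) b(3)] dprod_reindex(2)[OF b(2) a(3)]
      by (simp add: Delta1_def image_comp)
    moreover have "eval (xy_point s t) (den \<sigma> \<tau>) =
      dprod (s ` \<sigma> ` {1..m}) (s ` \<sigma> ` {m + 1..m + r}) * dprod (t ` \<tau> ` {1..n}) (t ` \<tau> ` {n + 1..n + q})"
      using dprod_reindex(1)[OF a(2) a(3)] dprod_reindex(1)[OF b(2) b(3)]
      by (simp add: den_def Delta0_def image_comp)
    ultimately show ?thesis
      using bval_eqI[OF f a(4) b(4)] bval_eqI[OF g a(5) b(5)]
      by (simp add: num_def shuffle_kernel_def)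
  qed
  then have "(\<Sum>\<sigma>\<in>shuffle_perms m r. \<Sum>\<tau>\<in>shuffle_perms n q.
      eval (xy_point s t) (num \<sigma> \<tau>) / eval (xy_point s t) (den \<sigma> \<tau>)) =
    (\<Sum>\<sigma>\<in>shuffle_perms m r. \<Sum>\<tau>\<in>shuffle_perms n q.
      ?H (s ` \<sigma> ` {1..m}) (s ` \<sigma> ` {m + 1..m + r}) (t ` \<tau> ` {1..n}) (t ` \<tau> ` {n + 1..n + q}))"
    by (intro sum.cong) auto
  also have "\<dots> = (\<Sum>\<sigma>\<in>shuffle_perms m r. \<Sum>B1 | B1 \<subseteq> t ` {1..n + q} \<and> card B1 = n.
      ?H (s ` \<sigma> ` {1..m}) (s ` \<sigma> ` {m + 1..m + r}) B1 (t ` {1..n + q} - B1))"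
    by (intro sum.cong refl sum_shuffle_perms[OF bij_betw_inj_image[OF t]])
  also have "\<dots> = convol (s ` {1..m + r}) (t ` {1..n + q})"
    unfolding convol_def
    by (rule sum_shuffle_perms[OF bij_betw_inj_image[OF s],
      where h = "\<lambda>A1 A2. \<Sum>B1 | B1 \<subseteq> t ` {1..n + q} \<and> card B1 = n. ?H A1 A2 B1 (t ` {1..n + q} - B1)"])
  finally show ?thesis .
qed

text \<open>The pairs whose differences make up \<open>den \<sigma> \<tau>\<close>, kept as a set so
  that the complement in \<open>offdiag\<close> yields the cofactor of the denominator in
  \<open>disc\<close>.\<close>

private definition "cross \<sigma> \<tau> =
  map_prod (xy_map \<sigma> \<tau>) (xy_map \<sigma> \<tau>) ` (map_prod Xv Xv ` ({1..m} \<times> {m + 1..m + r}) \<union>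
    map_prod Yv Yv ` ({1..n} \<times> {n + 1..n + q}))"

private lemma cross_subset:
  assumes "\<sigma> \<in> shuffle_perms m r" "\<tau> \<in> shuffle_perms n q"
  shows "cross \<sigma> \<tau> \<subseteq> offdiag (m + r) (n + q)"
proof -
  note p = shuffle_perms_permutes[OF assms(1)] shuffle_perms_permutes[OF assms(2)]
  have "cross \<sigma> \<tau> \<subseteq> map_prod (xy_map \<sigma> \<tau>) (xy_map \<sigma> \<tau>) ` offdiag (m + r) (n + q)"
    unfolding cross_def by (rule image_mono) (auto simp: offdiag_def)
  then show ?thesis by (simp add: xy_map_permutes_offdiag(1)[OF p])
qed

private lemma den_eq:
  assumes "\<sigma> \<in> shuffle_perms m r" "\<tau> \<in> shuffle_perms n q"
  shows "den \<sigma> \<tau> = (\<Prod>(u, v)\<in>cross \<sigma> \<tau>. vdiff u v)"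
proof -
  note p = shuffle_perms_permutes[OF assms(1)] shuffle_perms_permutes[OF assms(2)]
  note inj = xy_map_permutes_offdiag(2)[OF p]
  have "(\<Prod>(u, v)\<in>cross \<sigma> \<tau>. vdiff u v) =
    (\<Prod>(u, v)\<in>map_prod Xv Xv ` ({1..m} \<times> {m + 1..m + r}) \<union> map_prod Yv Yv ` ({1..n} \<times> {n + 1..n + q}).
      vdiff (xy_map \<sigma> \<tau> u) (xy_map \<sigma> \<tau> v))"
    unfolding cross_def
    by (subst prod.reindex) (auto simp: case_prod_unfold intro: inj_on_subset[OF prod.inj_map[OF inj inj]])
  also have "\<dots> = (\<Prod>(u, v)\<in>map_prod Xv Xv ` ({1..m} \<times> {m + 1..m + r}). vdiff (xy_map \<sigma> \<tau> u) (xy_map \<sigma> \<tau> v)) *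
    (\<Prod>(u, v)\<in>map_prod Yv Yv ` ({1..n} \<times> {n + 1..n + q}). vdiff (xy_map \<sigma> \<tau> u) (xy_map \<sigma> \<tau> v))"
    by (rule prod.union_disjoint) auto
  also have "\<dots> = (\<Prod>(i, j)\<in>{1..m} \<times> {m + 1..m + r}. vdiff (Xv (\<sigma> i)) (Xv (\<sigma> j))) *
    (\<Prod>(i, j)\<in>{1..n} \<times> {n + 1..n + q}. vdiff (Yv (\<tau> i)) (Yv (\<tau> j)))"
    by (intro arg_cong2[of _ _ _ _ "(*)"]; subst prod.reindex)
      (auto simp: case_prod_unfold inj_on_def)
  finally show ?thesis
    by (simp add: den_def Delta0_def prod.cartesian_product case_prod_unfold)
qed

private lemma den_neq_0:
  assumes "\<sigma> \<in> shuffle_perms m r" "\<tau> \<in> shuffle_perms n q"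
  shows "den \<sigma> \<tau> \<noteq> 0"
    and "eval a (disc (m + r) (n + q)) \<noteq> 0 \<Longrightarrow> eval a (den \<sigma> \<tau>) \<noteq> 0"
proof -
  have "disc (m + r) (n + q) = (\<Prod>(u, v)\<in>offdiag (m + r) (n + q) - cross \<sigma> \<tau>. vdiff u v) * den \<sigma> \<tau>"
    unfolding disc_def den_eq[OF assms]
    by (rule prod.subset_diff[OF cross_subset[OF assms]]) simp
  then show "den \<sigma> \<tau> \<noteq> 0" "eval a (disc (m + r) (n + q)) \<noteq> 0 \<Longrightarrow> eval a (den \<sigma> \<tau>) \<noteq> 0"
    using disc_neq_0[of "m + r" "n + q"] by auto
qed

text \<open>
  Clearing denominators by the symmetric polynomial \<^const>\<open>disc\<close> gives a symmetric polynomial that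
  is divisible by each difference of variables, hence by its square, hence by \<^const>\<open>disc\<close>.
\<close>

private definition "cleared = (\<Sum>\<sigma>\<in>shuffle_perms m r. \<Sum>\<tau>\<in>shuffle_perms n q.
  num \<sigma> \<tau> * (\<Prod>(u, v)\<in>offdiag (m + r) (n + q) - cross \<sigma> \<tau>. vdiff u v))"

private lemma eval_cleared:
  assumes s: "inj_on s {1..m + r}" and t: "inj_on t {1..n + q}"
  shows "eval (xy_point s t) cleared =
    eval (xy_point s t) (disc (m + r) (n + q)) * convol (s ` {1..m + r}) (t ` {1..n + q})"
proof -
  let ?e = "eval (xy_point s t)"
  have d: "?e (disc (m + r) (n + q)) \<noteq> 0" using s t by (simp add: eval_disc_neq_0_iff)
  have "?e (num \<sigma> \<tau> * (\<Prod>(u, v)\<in>offdiag (m + r) (n + q) - cross \<sigma> \<tau>. vdiff u v)) =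
      ?e (disc (m + r) (n + q)) * (?e (num \<sigma> \<tau>) / ?e (den \<sigma> \<tau>))"
    if "\<sigma> \<in> shuffle_perms m r" "\<tau> \<in> shuffle_perms n q" for \<sigma> \<tau>
  proof -
    have "disc (m + r) (n + q) = (\<Prod>(u, v)\<in>offdiag (m + r) (n + q) - cross \<sigma> \<tau>. vdiff u v) * den \<sigma> \<tau>"
      unfolding disc_def den_eq[OF that]
      by (rule prod.subset_diff[OF cross_subset[OF that]]) simp
    then have "?e (disc (m + r) (n + q)) =
        ?e (\<Prod>(u, v)\<in>offdiag (m + r) (n + q) - cross \<sigma> \<tau>. vdiff u v) * ?e (den \<sigma> \<tau>)"
      by (metis evl.subst_mult)
    with den_neq_0(2)[OF that d] show ?thesis by (simp only: evl.subst_mult) (simp add: field_simps)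
  qed
  then show ?thesis
    unfolding cleared_def evl.subst_sum sum_convol[OF s t, symmetric] sum_distrib_left
    by (intro sum.cong) auto
qed

text \<open>At injective points the value is that of the symmetric \<open>disc\<close> times a
  function of the two coordinate sets, and neither notices a permutation.\<close>

private lemma cleared_symmetric:
  assumes "\<pi> permutes {1..m + r}" "\<rho> permutes {1..n + q}"
  shows "relabel (xy_map \<pi> \<rho>) cleared = cleared"
proof -
  have "relabel (xy_map \<pi> \<rho>) cleared - cleared = 0"
  proof (rule eval_eq_zeroD_xy[of "{}" "m + r" "n + q"])
    fix s t :: "nat \<Rightarrow> rat" assume s: "inj_on s {1..m + r}" and t: "inj_on t {1..n + q}"
    have s': "inj_on (s \<circ> \<pi>) {1..m + r}" and t': "inj_on (t \<circ> \<rho>) {1..n + q}"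
      using s t assms by (auto intro!: comp_inj_on simp: permutes_image inj_on_subset[OF permutes_inj])
    have im: "(s \<circ> \<pi>) ` {1..m + r} = s ` {1..m + r}" "(t \<circ> \<rho>) ` {1..n + q} = t ` {1..n + q}"
      using assms by (metis image_comp permutes_image)+
    have "eval (xy_point (s \<circ> \<pi>) (t \<circ> \<rho>)) (disc (m + r) (n + q)) =
      eval (xy_point s t) (relabel (xy_map \<pi> \<rho>) (disc (m + r) (n + q)))" by simp
    then show "eval (xy_point s t) (relabel (xy_map \<pi> \<rho>) cleared - cleared) = 0"
      using eval_cleared[OF s t] eval_cleared[OF s' t', unfolded im] by (simp add: relabel_disc[OF assms])
  qed simp
  then show ?thesis by simp
qed

text \<open>A denominator contains each pair of variables in at most one orientation; the cofactor
  keeps the other, which is the same difference up to sign.\<close>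

private lemma vdiff_dvd_cleared:
  assumes "(u, v) \<in> offdiag (m + r) (n + q)"
  shows "vdiff u v dvd cleared"
  unfolding cleared_def
proof (intro dvd_sum dvd_mult)
  fix \<sigma> \<tau> assume st: "\<sigma> \<in> shuffle_perms m r" "\<tau> \<in> shuffle_perms n q"
  note p = shuffle_perms_permutes[OF st(1)] shuffle_perms_permutes[OF st(2)]
  note inj = injD[OF xy_map_permutes_offdiag(2)[OF p]]
  have "(v, u) \<in> offdiag (m + r) (n + q)" using assms by (auto simp: offdiag_def)
  moreover have "(v, u) \<notin> cross \<sigma> \<tau>" if "(u, v) \<in> cross \<sigma> \<tau>"
    using that unfolding cross_def by (auto dest!: inj)
  ultimately have "(u, v) \<in> offdiag (m + r) (n + q) - cross \<sigma> \<tau> \<or>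
      (v, u) \<in> offdiag (m + r) (n + q) - cross \<sigma> \<tau>"
    using assms by auto
  then show "vdiff u v dvd (\<Prod>(u, v)\<in>offdiag (m + r) (n + q) - cross \<sigma> \<tau>. vdiff u v)"
  proof
    assume "(u, v) \<in> offdiag (m + r) (n + q) - cross \<sigma> \<tau>"
    from dvd_prodI[OF _ this, of "\<lambda>(u, v). vdiff u v"] show ?thesis by simp
  next
    assume "(v, u) \<in> offdiag (m + r) (n + q) - cross \<sigma> \<tau>"
    from dvd_prodI[OF _ this, of "\<lambda>(u, v). vdiff u v"] have
      "vdiff v u dvd (\<Prod>(u, v)\<in>offdiag (m + r) (n + q) - cross \<sigma> \<tau>. vdiff u v)" by simp
    moreover have "vdiff v u = - vdiff u v" by simp
    ultimately show ?thesis by (metis minus_dvd_iff)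
  qed
qed

private lemma relabel_transpose_cleared:
  assumes "(u, v) \<in> offdiag (m + r) (n + q)"
  shows "relabel (Transposition.transpose u v) cleared = cleared"
proof -
  have "\<exists>\<pi> \<rho>. \<pi> permutes {1..m + r} \<and> \<rho> permutes {1..n + q} \<and> Transposition.transpose u v = xy_map \<pi> \<rho>"
    using assms unfolding offdiag_def
  proof (elim UnE CollectE exE conjE)
    fix i j assume *: "(u, v) = (Xv i, Xv j)" "i \<in> {1..m + r}" "j \<in> {1..m + r}"
    have "Transposition.transpose (Xv i) (Xv j) w = xy_map (Transposition.transpose i j) id w" for w
      by (cases w) (auto simp: Transposition.transpose_def)
    with * show ?thesis by (intro exI[of _ "Transposition.transpose i j"] exI[of _ id])
      (auto simp: permutes_swap_id permutes_id)
  next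
    fix i j assume *: "(u, v) = (Yv i, Yv j)" "i \<in> {1..n + q}" "j \<in> {1..n + q}"
    have "Transposition.transpose (Yv i) (Yv j) w = xy_map id (Transposition.transpose i j) w" for w
      by (cases w) (auto simp: Transposition.transpose_def)
    with * show ?thesis by (intro exI[of _ id] exI[of _ "Transposition.transpose i j"])
      (auto simp: permutes_swap_id permutes_id)
  qed
  then show ?thesis using cleared_symmetric by metis
qed

text \<open>Swapping \<open>u\<close> and \<open>v\<close> fixes \<open>cleared\<close> and negates
  \<open>vdiff u v\<close>, so the quotient \<open>Q\<close> is alternating. On the diagonal it
  equals its own negative and vanishes, which gives a second factor.\<close>

private lemma vdiff_square_dvd_cleared:
  assumes "(u, v) \<in> offdiag (m + r) (n + q)"
  shows "vdiff u v ^ 2 dvd cleared"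
proof -
  obtain Q where Q: "cleared = vdiff u v * Q" using vdiff_dvd_cleared[OF assms] by (elim dvdE)
  let ?T = "Transposition.transpose u v"
  have "vdiff u v * (relabel ?T Q + Q) = 0"
    using relabel_transpose_cleared[OF assms] by (simp add: Q algebra_simps)
  then have "relabel ?T Q + Q = 0" using offdiag_neq[OF assms] by simp
  then have "relabel (id(v := u)) (relabel ?T Q + Q) = 0" by simp
  moreover have "id(v := u) \<circ> ?T = id(v := u)" by (auto simp: fun_eq_iff Transposition.transpose_def)
  ultimately have "relabel (id(v := u)) Q + relabel (id(v := u)) Q = 0"
    by (simp add: relabel_fuse del: fun_upd_apply)
  then have "eval a (relabel (id(v := u)) Q) + eval a (relabel (id(v := u)) Q) = eval a 0" for a
    by (metis evl.subst_add)
  then have "relabel (id(v := u)) Q = 0" by (intro eval_eq_zeroD) simp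
  then have "vdiff u v dvd Q" by (simp add: vdiff_dvd_iff)
  then show ?thesis by (simp add: Q power2_eq_square)
qed

text \<open>Up to sign, \<open>disc\<close> is a product of squares over unordered pairs. The order
  on the variables picks one orientation of each, as \<open>prod_vdiff_power_dvd\<close>
  demands.\<close>

private lemma disc_dvd_cleared: "disc (m + r) (n + q) dvd cleared"
proof -
  define E where "E = {(u, v) \<in> offdiag (m + r) (n + q). u < v}"
  have fin: "finite E" unfolding E_def by (rule finite_subset[OF _ finite_offdiag[of "m + r" "n + q"]]) auto
  have E: "E \<union> prod.swap ` E = offdiag (m + r) (n + q)" "E \<inter> prod.swap ` E = {}"
    by (auto simp: E_def image_iff offdiag_def less_xy_def)
  have "disc (m + r) (n + q) = (\<Prod>(u, v)\<in>E. vdiff u v) * (\<Prod>(u, v)\<in>prod.swap ` E. vdiff u v)"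
    unfolding disc_def E(1)[symmetric] using fin E(2) by (intro prod.union_disjoint) auto
  also have "\<dots> = (\<Prod>(u, v)\<in>E. vdiff u v * vdiff v u)"
    by (subst prod.reindex) (auto simp: prod.distrib case_prod_unfold)
  also have "\<dots> dvd (\<Prod>(u, v)\<in>E. vdiff u v ^ 2)"
  proof (rule prod_dvd_prod, clarify)
    fix u v assume "(u, v) \<in> E"
    have "vdiff u v ^ 2 = vdiff u v * vdiff v u * (- 1)" by (simp add: power2_eq_square algebra_simps)
    then show "vdiff u v * vdiff v u dvd vdiff u v ^ 2" by (rule dvdI)
  qed
  also have "\<dots> dvd cleared"
    by (rule prod_vdiff_power_dvd[OF fin])
      (auto simp: E_def dest: offdiag_neq intro: vdiff_square_dvd_cleared)
  finally show ?thesis .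
qed

private lemma vars_cleared: "vars cleared \<subseteq> std"
proof -
  have "vars (relabel (xy_map \<sigma> \<tau>) h) \<subseteq> std"
    if "\<sigma> \<in> shuffle_perms m r" "\<tau> \<in> shuffle_perms n q" "vars h \<subseteq> std" for h \<sigma> \<tau>
  proof (rule vars_closure(5))
    fix v assume "v \<in> vars h"
    with that(3) have "v \<in> std" by auto
    then show "xy_map \<sigma> \<tau> v \<in> std"
      using shuffle_perms_permutes[OF that(1)] shuffle_perms_permutes[OF that(2)]
      by (cases v) (auto simp: permutes_in_image simp del: atLeastAtMost_iff)
  qed
  moreover have "xy_map (\<lambda>i. \<sigma> (m + i)) (\<lambda>j. \<tau> (n + j)) = xy_map \<sigma> \<tau> \<circ> xy_map ((+) m) ((+) n)" for \<sigma> \<tau>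
  proof
    fix v show "xy_map (\<lambda>i. \<sigma> (m + i)) (\<lambda>j. \<tau> (n + j)) v = (xy_map \<sigma> \<tau> \<circ> xy_map ((+) m) ((+) n)) v"
      by (cases v) auto
  qed
  moreover have "vars f \<subseteq> std" using f by auto
  moreover have "vars (relabel (xy_map ((+) m) ((+) n)) g) \<subseteq> std"
  proof (rule vars_closure(5))
    fix v assume "v \<in> vars g"
    with g have "v \<in> Xv ` {1..r} \<union> Yv ` {1..q}" by auto
    then show "xy_map ((+) m) ((+) n) v \<in> std" by auto
  qed
  moreover have "vars (Delta1 m n r q) \<subseteq> std"
    unfolding Delta1_def by (intro vars_closure) auto
  ultimately have num: "vars (num \<sigma> \<tau>) \<subseteq> std"
    if "\<sigma> \<in> shuffle_perms m r" "\<tau> \<in> shuffle_perms n q" for \<sigma> \<tau>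
    unfolding num_def using that by (intro vars_closure(1)) (simp_all add: relabel_fuse[symmetric])
  show ?thesis
    unfolding cleared_def case_prod_unfold
    by (intro vars_closure num) (auto simp: offdiag_def)
qed

text \<open>This discharges the definite description in \<open>A1_prod\<close>: the quotient of
  \<open>cleared\<close> by \<open>disc\<close> is the required polynomial. Later arguments use only
  its symmetry and its values on sets.\<close>

lemma A1_prod_exists:
  obtains p where "p \<in> bisym_polys (m + r, n + q)" "A1_prod (m, n) (r, q) f g = p"
    "\<And>A B. finite A \<Longrightarrow> finite B \<Longrightarrow> card A = m + r \<Longrightarrow> card B = n + q \<Longrightarrow>
      bval p A B = (\<Sum>A1 | A1 \<subseteq> A \<and> card A1 = m. \<Sum>B1 | B1 \<subseteq> B \<and> card B1 = n.
        bval f A1 B1 * bval g (A - A1) (B - B1) * shuffle_kernel A1 B1 (A - A1) (B - B1))"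
proof -
  obtain p where p: "cleared = disc (m + r) (n + q) * p" using disc_dvd_cleared by (elim dvdE)
  have eval_p: "eval (xy_point s t) p = convol (s ` {1..m + r}) (t ` {1..n + q})"
    if s: "inj_on s {1..m + r}" and t: "inj_on t {1..n + q}" for s t
  proof -
    have "eval (xy_point s t) (disc (m + r) (n + q)) \<noteq> 0" using s t by (simp add: eval_disc_neq_0_iff)
    with eval_cleared[OF s t] show ?thesis by (simp add: p)
  qed
  have "vars (disc (m + r) (n + q)) \<subseteq> std"
    unfolding disc_def case_prod_unfold by (intro vars_closure) (auto simp: offdiag_def)
  from vars_factor[OF this vars_cleared[unfolded p] disc_neq_0] have "vars p \<subseteq> std" .
  then have sym: "p \<in> bisym_polys (m + r, n + q)"
  proof (rule bisym_polysI)
    fix s t :: "nat \<Rightarrow> rat" and \<pi> \<rho> assume *: "inj_on s {1..m + r}" "inj_on t {1..n + q}"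
      "\<pi> permutes {1..m + r}" "\<rho> permutes {1..n + q}"
    then have "inj_on (s \<circ> \<pi>) {1..m + r}" "inj_on (t \<circ> \<rho>) {1..n + q}"
      by (auto intro!: comp_inj_on simp: permutes_image inj_on_subset[OF permutes_inj])
    moreover have "(s \<circ> \<pi>) ` {1..m + r} = s ` {1..m + r}" "(t \<circ> \<rho>) ` {1..n + q} = t ` {1..n + q}"
      using * by (metis image_comp permutes_image)+
    ultimately show "eval (xy_point (s \<circ> \<pi>) (t \<circ> \<rho>)) p = eval (xy_point s t) p"
      using * by (simp add: eval_p)
  qed
  have F: "Fract p 1 = (\<Sum>(\<sigma>, \<tau>)\<in>shuffle_perms m r \<times> shuffle_perms n q. Fract (num \<sigma> \<tau>) (den \<sigma> \<tau>))"
  proof -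
    have "Fract p 1 = (\<Sum>i\<in>shuffle_perms m r \<times> shuffle_perms n q.
        Fract (num (fst i) (snd i)) (den (fst i) (snd i)))"
    \<comment> \<open>Nonvanishing of \<open>disc\<close> supplies the distinct coordinates that
      \<open>eval_p\<close> requires.\<close>
    proof (subst Fract_sum_iff[where w = "disc (m + r) (n + q)"])
      show "\<forall>a. eval a (disc (m + r) (n + q)) \<noteq> 0 \<longrightarrow>
        (\<forall>i\<in>shuffle_perms m r \<times> shuffle_perms n q. eval a (den (fst i) (snd i)) \<noteq> 0) \<longrightarrow>
        eval a p = (\<Sum>i\<in>shuffle_perms m r \<times> shuffle_perms n q.
          eval a (num (fst i) (snd i)) / eval a (den (fst i) (snd i)))"
      proof (intro allI impI)
        fix a assume "eval a (disc (m + r) (n + q)) \<noteq> 0"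
        then have "inj_on (\<lambda>i. a (Xv i)) {1..m + r}" "inj_on (\<lambda>j. a (Yv j)) {1..n + q}"
          by (simp_all add: eval_disc_neq_0_iff)
        from eval_p[OF this] sum_convol[OF this] show "eval a p = (\<Sum>i\<in>shuffle_perms m r \<times> shuffle_perms n q.
          eval a (num (fst i) (snd i)) / eval a (den (fst i) (snd i)))"
          by (simp add: sum.cartesian_product case_prod_unfold)
      qed
    qed (auto simp: den_neq_0)
    then show ?thesis by (simp add: case_prod_unfold)
  qed
  have "A1_prod (m, n) (r, q) f g = p"
    unfolding A1_prod.simps num_def[symmetric] den_def[symmetric] sum.cartesian_product F[symmetric]
    by (rule the_equality) (auto simp: eq_fract)
  moreover have "bval p A B = convol A B"
    if "finite A" "finite B" "card A = m + r" "card B = n + q" for A B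
    using eval_p[of "enum A" "enum B"] bij_enum[OF that(1)] bij_enum[OF that(2)] that(3,4)
    by (simp add: bval_def bij_betw_def)
  ultimately show ?thesis using sym that unfolding convol_def by blast
qed

end

lemma A1_prod_closed:
  assumes "f \<in> bisym_polys (m, n)" "g \<in> bisym_polys (r, q)"
  shows "A1_prod (m, n) (r, q) f g \<in> bisym_polys (m + r, n + q)"
  using A1_prod_exists[OF assms] by metis

lemma bval_A1_prod:
  assumes "f \<in> bisym_polys (m, n)" "g \<in> bisym_polys (r, q)"
    "finite A" "finite B" "card A = m + r" "card B = n + q"
  shows "bval (A1_prod (m, n) (r, q) f g) A B =
    (\<Sum>A1 | A1 \<subseteq> A \<and> card A1 = m. \<Sum>B1 | B1 \<subseteq> B \<and> card B1 = n.
        bval f A1 B1 * bval g (A - A1) (B - B1) * shuffle_kernel A1 B1 (A - A1) (B - B1))"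
proof -
  obtain p where p: "A1_prod (m, n) (r, q) f g = p"
    "\<And>A B. finite A \<Longrightarrow> finite B \<Longrightarrow> card A = m + r \<Longrightarrow> card B = n + q \<Longrightarrow>
      bval p A B = (\<Sum>A1 | A1 \<subseteq> A \<and> card A1 = m. \<Sum>B1 | B1 \<subseteq> B \<and> card B1 = n.
        bval f A1 B1 * bval g (A - A1) (B - B1) * shuffle_kernel A1 B1 (A - A1) (B - B1))"
    by (rule A1_prod_exists[OF assms(1,2)]) blast
  show ?thesis unfolding p(1) by (rule p(2)[OF assms(3-6)])
qed

section \<open>The convolution algebra of functions on pairs of finite sets\<close>

type_synonym setfun = "rat set \<Rightarrow> rat set \<Rightarrow> rat"

definition conv :: "setfun \<Rightarrow> setfun \<Rightarrow> setfun" where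
  "conv \<Phi> \<Gamma> A B = (\<Sum>A1\<in>Pow A. \<Sum>B1\<in>Pow B.
     \<Phi> A1 B1 * \<Gamma> (A - A1) (B - B1) * shuffle_kernel A1 B1 (A - A1) (B - B1))"

definition conv_unit :: setfun where
  "conv_unit A B = (if A = {} \<and> B = {} then 1 else 0)"

text \<open>Because \<open>conv\<close> is 0 on infinite sets, \<open>conv_unit\<close> is neutral
  only for functions that also vanish there.\<close>

definition finitary :: "setfun \<Rightarrow> bool" where
  "finitary \<Phi> \<longleftrightarrow> (\<forall>A B. \<not> (finite A \<and> finite B) \<longrightarrow> \<Phi> A B = 0)"

text \<open>The parity of the grading, since \<open>(m - n)^2\<close> and \<open>m + n\<close> agree
  modulo 2.\<close>

definition homog :: "nat \<Rightarrow> setfun \<Rightarrow> setfun" where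
  "homog p \<Phi> A B = (if (card A + card B) mod 2 = p then \<Phi> A B else 0)"

lemma dprod_empty [simp]: "dprod {} B = 1" "dprod A {} = 1"
  by (simp_all add: dprod_def)

lemma dprod_Un:
  "finite A \<Longrightarrow> finite A' \<Longrightarrow> A \<inter> A' = {} \<Longrightarrow> dprod (A \<union> A') B = dprod A B * dprod A' B"
  "finite B \<Longrightarrow> finite B' \<Longrightarrow> B \<inter> B' = {} \<Longrightarrow> dprod A (B \<union> B') = dprod A B * dprod A B'"
  by (simp_all add: dprod_def prod.union_disjoint prod.distrib)

lemma dprod_eq_0_iff: "finite A \<Longrightarrow> finite B \<Longrightarrow> dprod A B = 0 \<longleftrightarrow> A \<inter> B \<noteq> {}"
  by (auto simp: dprod_def prod_zero_iff)

lemma dprod_swap: "dprod B A = (- 1) ^ (card A * card B) * dprod A B"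
proof -
  have "dprod B A = (\<Prod>a\<in>A. \<Prod>b\<in>B. - 1 * (b - a))"
    unfolding dprod_def by (subst prod.swap) simp
  also have "\<dots> = (- 1) ^ (card A * card B) * dprod A B"
    unfolding dprod_def prod.distrib by (simp add: power_mult[symmetric] mult.commute)
  finally show ?thesis .
qed

lemma shuffle_kernel_empty [simp]: "shuffle_kernel {} {} A B = 1" "shuffle_kernel A B {} {} = 1"
  by (simp_all add: shuffle_kernel_def)

text \<open>As \<open>dprod\<close> is multiplicative in each argument, both sides are the product
  of the kernels of the three pairs of blocks. This is the cocycle condition that makes
  \<open>conv\<close> associative.\<close>

lemma shuffle_kernel_cocycle:
  assumes "finite A1" "finite A2" "finite A3" "finite B1" "finite B2" "finite B3"
    "A1 \<inter> A2 = {}" "A2 \<inter> A3 = {}" "B1 \<inter> B2 = {}" "B2 \<inter> B3 = {}"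
  shows "shuffle_kernel A1 B1 A2 B2 * shuffle_kernel (A1 \<union> A2) (B1 \<union> B2) A3 B3 =
    shuffle_kernel A2 B2 A3 B3 * shuffle_kernel A1 B1 (A2 \<union> A3) (B2 \<union> B3)"
  using assms by (simp add: shuffle_kernel_def dprod_Un) (simp add: mult_ac)

text \<open>Each of the four factors changes by a sign with exponent a product of two cardinalities.
  Signs count equally above and below the fraction line, so the four exponents add up to the stated
  product.\<close>

lemma shuffle_kernel_swap:
  "shuffle_kernel A' B' A B = (- 1) ^ ((card A + card B) * (card A' + card B')) * shuffle_kernel A B A' B'"
proof -
  have div: "x / ((- 1) ^ k * y) = (- 1) ^ k * (x / y)" for x y :: rat and k :: nat
    by (cases "even k") auto
  have "shuffle_kernel A' B' A B =
    ((- 1) ^ (card B * card A') * dprod B A' * ((- 1) ^ (card A * card B') * dprod A B')) /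
    ((- 1) ^ (card A * card A') * dprod A A' * ((- 1) ^ (card B * card B') * dprod B B'))"
    unfolding shuffle_kernel_def
    by (simp only: dprod_swap[of A' B] dprod_swap[of B' A] dprod_swap[of A' A] dprod_swap[of B' B])
  also have "\<dots> = (- 1) ^ (card B * card A') * (- 1) ^ (card A * card B') *
      (dprod B A' * dprod A B') / ((- 1) ^ (card A * card A' + card B * card B') * (dprod A A' * dprod B B'))"
    by (simp add: power_add algebra_simps)
  also have "\<dots> = (- 1) ^ ((card A + card B) * (card A' + card B')) * shuffle_kernel A B A' B'"
    unfolding div by (simp add: shuffle_kernel_def power_add algebra_simps)
  finally show ?thesis .
qed

text \<open>A chain \<open>A1 \<subseteq> C \<subseteq> A\<close> is the same as an ordered
  decomposition of \<open>A\<close> into three parts.\<close>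

lemma sum_Pow_assoc:
  assumes "finite A"
  shows "(\<Sum>C\<in>Pow A. \<Sum>A1\<in>Pow C. h A1 (C - A1) (A - C)) =
    (\<Sum>A1\<in>Pow A. \<Sum>A2\<in>Pow (A - A1). h A1 A2 (A - A1 - A2))"
proof -
  have fin: "finite C" if "C \<subseteq> A" for C using assms that by (rule rev_finite_subset)
  have "(\<Sum>C\<in>Pow A. \<Sum>A1\<in>Pow C. h A1 (C - A1) (A - C)) =
    (\<Sum>(C, A1)\<in>Sigma (Pow A) Pow. h A1 (C - A1) (A - C))"
    by (rule sum.Sigma) (auto simp: assms fin)
  also have "\<dots> = (\<Sum>(A1, A2)\<in>Sigma (Pow A) (\<lambda>A1. Pow (A - A1)). h A1 A2 (A - A1 - A2))"
    by (rule sum.reindex_bij_witness[where i = "\<lambda>(A1, A2). (A1 \<union> A2, A1)" and j = "\<lambda>(C, A1). (A1, C - A1)"])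
      (auto simp: Diff_eq intro!: arg_cong[where f = "h _ _"])
  also have "\<dots> = (\<Sum>A1\<in>Pow A. \<Sum>A2\<in>Pow (A - A1). h A1 A2 (A - A1 - A2))"
    by (rule sum.Sigma[symmetric]) (auto simp: assms fin)
  finally show ?thesis .
qed

lemma conv_infinite: "\<not> (finite A \<and> finite B) \<Longrightarrow> conv \<Phi> \<Gamma> A B = 0"
  unfolding conv_def by (cases "finite A") (auto simp: finite_Pow_iff)

lemma conv_assoc: "conv (conv \<Phi> \<Gamma>) \<Theta> = conv \<Phi> (conv \<Gamma> \<Theta>)"
proof (intro ext)
  fix A B
  show "conv (conv \<Phi> \<Gamma>) \<Theta> A B = conv \<Phi> (conv \<Gamma> \<Theta>) A B"
  proof (cases "finite A \<and> finite B")
    case True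
    then have fin: "finite C" if "C \<subseteq> A \<or> C \<subseteq> B" for C using that finite_subset by auto
    let ?W = "\<lambda>A1 A2 A3 B1 B2 B3. \<Phi> A1 B1 * \<Gamma> A2 B2 * \<Theta> A3 B3 *
      (shuffle_kernel A1 B1 A2 B2 * shuffle_kernel (A1 \<union> A2) (B1 \<union> B2) A3 B3)"
    have "conv (conv \<Phi> \<Gamma>) \<Theta> A B = (\<Sum>C\<in>Pow A. \<Sum>D\<in>Pow B. \<Sum>A1\<in>Pow C. \<Sum>B1\<in>Pow D.
        ?W A1 (C - A1) (A - C) B1 (D - B1) (B - D))"
      unfolding conv_def sum_distrib_right
      by (intro sum.cong refl) (auto simp: Un_absorb1 mult_ac)
    also have "\<dots> = (\<Sum>C\<in>Pow A. \<Sum>A1\<in>Pow C. \<Sum>D\<in>Pow B. \<Sum>B1\<in>Pow D.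
        ?W A1 (C - A1) (A - C) B1 (D - B1) (B - D))"
      by (intro sum.cong refl sum.swap)
    also have "\<dots> = (\<Sum>C\<in>Pow A. \<Sum>A1\<in>Pow C. \<Sum>B1\<in>Pow B. \<Sum>B2\<in>Pow (B - B1).
        ?W A1 (C - A1) (A - C) B1 B2 (B - B1 - B2))"
      using True by (intro sum.cong refl sum_Pow_assoc) simp
    also have "\<dots> = (\<Sum>A1\<in>Pow A. \<Sum>A2\<in>Pow (A - A1). \<Sum>B1\<in>Pow B. \<Sum>B2\<in>Pow (B - B1).
        ?W A1 A2 (A - A1 - A2) B1 B2 (B - B1 - B2))"
      using True by (intro sum_Pow_assoc[where
        h = "\<lambda>A1 A2 A3. \<Sum>B1\<in>Pow B. \<Sum>B2\<in>Pow (B - B1). ?W A1 A2 A3 B1 B2 (B - B1 - B2)"]) simp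
    also have "\<dots> = (\<Sum>A1\<in>Pow A. \<Sum>B1\<in>Pow B. \<Sum>A2\<in>Pow (A - A1). \<Sum>B2\<in>Pow (B - B1).
        ?W A1 A2 (A - A1 - A2) B1 B2 (B - B1 - B2))"
      by (intro sum.cong refl sum.swap)
    also have "\<dots> = conv \<Phi> (conv \<Gamma> \<Theta>) A B"
      unfolding conv_def sum_distrib_right sum_distrib_left
    proof (intro sum.cong refl)
      fix A1 B1 A2 B2 assume *: "A1 \<in> Pow A" "B1 \<in> Pow B" "A2 \<in> Pow (A - A1)" "B2 \<in> Pow (B - B1)"
      then have sub: "A1 \<subseteq> A" "A2 \<subseteq> A" "A - A1 - A2 \<subseteq> A" "B1 \<subseteq> B" "B2 \<subseteq> B" "B - B1 - B2 \<subseteq> B"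
        by auto
      have "shuffle_kernel A1 B1 A2 B2 * shuffle_kernel (A1 \<union> A2) (B1 \<union> B2) (A - A1 - A2) (B - B1 - B2) =
        shuffle_kernel A2 B2 (A - A1 - A2) (B - B1 - B2) *
        shuffle_kernel A1 B1 (A2 \<union> (A - A1 - A2)) (B2 \<union> (B - B1 - B2))"
        by (rule shuffle_kernel_cocycle) (use * sub fin in auto)
      moreover have "A2 \<union> (A - A1 - A2) = A - A1" "B2 \<union> (B - B1 - B2) = B - B1" using * by auto
      ultimately show "?W A1 A2 (A - A1 - A2) B1 B2 (B - B1 - B2) =
        \<Phi> A1 B1 * (\<Gamma> A2 B2 * \<Theta> (A - A1 - A2) (B - B1 - B2) *
          shuffle_kernel A2 B2 (A - A1 - A2) (B - B1 - B2)) *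
          shuffle_kernel A1 B1 (A - A1) (B - B1)"
        by (simp add: mult_ac)
    qed
    finally show ?thesis .
  qed (simp add: conv_infinite)
qed

lemma conv_unit_left [simp]: "finitary \<Phi> \<Longrightarrow> conv conv_unit \<Phi> = \<Phi>"
proof (intro ext)
  fix A B assume fin: "finitary \<Phi>"
  show "conv conv_unit \<Phi> A B = \<Phi> A B"
  proof (cases "finite A \<and> finite B")
    case True
    have "conv conv_unit \<Phi> A B = (\<Sum>A1\<in>Pow A. \<Sum>B1\<in>Pow B. if A1 = {} then if B1 = {} then \<Phi> A B else 0 else 0)"
      unfolding conv_def by (intro sum.cong refl) (auto simp: conv_unit_def)
    also have "\<dots> = (\<Sum>A1\<in>Pow A. if A1 = {} then \<Sum>B1\<in>Pow B. if B1 = {} then \<Phi> A B else 0 else 0)"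
      by (intro sum.cong refl) auto
    also have "\<dots> = \<Phi> A B" using True by (simp add: sum.delta)
    finally show ?thesis .
  qed (use fin in \<open>simp add: conv_infinite finitary_def\<close>)
qed

lemma conv_unit_right [simp]: "finitary \<Phi> \<Longrightarrow> conv \<Phi> conv_unit = \<Phi>"
proof (intro ext)
  fix A B assume fin: "finitary \<Phi>"
  show "conv \<Phi> conv_unit A B = \<Phi> A B"
  proof (cases "finite A \<and> finite B")
    case True
    have "conv \<Phi> conv_unit A B = (\<Sum>A1\<in>Pow A. \<Sum>B1\<in>Pow B. if A1 = A then if B1 = B then \<Phi> A B else 0 else 0)"
      unfolding conv_def by (intro sum.cong refl) (auto simp: conv_unit_def)
    also have "\<dots> = (\<Sum>A1\<in>Pow A. if A1 = A then \<Sum>B1\<in>Pow B. if B1 = B then \<Phi> A B else 0 else 0)"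
      by (intro sum.cong refl) auto
    also have "\<dots> = \<Phi> A B" using True by (simp add: sum.delta)
    finally show ?thesis .
  qed (use fin in \<open>simp add: conv_infinite finitary_def\<close>)
qed

lemma conv_add:
  "conv (\<lambda>A B. \<Phi> A B + \<Phi>' A B) \<Gamma> = (\<lambda>A B. conv \<Phi> \<Gamma> A B + conv \<Phi>' \<Gamma> A B)"
  "conv \<Gamma> (\<lambda>A B. \<Phi> A B + \<Phi>' A B) = (\<lambda>A B. conv \<Gamma> \<Phi> A B + conv \<Gamma> \<Phi>' A B)"
  by (intro ext; simp add: conv_def sum.distrib[symmetric] algebra_simps)+

lemma conv_scale:
  "conv (\<lambda>A B. c * \<Phi> A B) \<Gamma> = (\<lambda>A B. c * conv \<Phi> \<Gamma> A B)"
  "conv \<Gamma> (\<lambda>A B. c * \<Phi> A B) = (\<lambda>A B. c * conv \<Gamma> \<Phi> A B)"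
  by (intro ext; simp add: conv_def sum_distrib_left mult_ac)+

lemma conv_zero [simp]: "conv (\<lambda>A B. 0) \<Gamma> = (\<lambda>A B. 0)" "conv \<Gamma> (\<lambda>A B. 0) = (\<lambda>A B. 0)"
  by (intro ext; simp add: conv_def)+

lemma conv_supercommute:
  "conv (homog p \<Phi>) (homog q \<Gamma>) = (\<lambda>A B. (- 1) ^ (p * q) * conv (homog q \<Gamma>) (homog p \<Phi>) A B)"
proof (intro ext)
  fix A B
  show "conv (homog p \<Phi>) (homog q \<Gamma>) A B = (- 1) ^ (p * q) * conv (homog q \<Gamma>) (homog p \<Phi>) A B"
  proof (cases "finite A \<and> finite B")
    case True
    have sgn: "(- 1 :: rat) ^ (k * l) = (- 1) ^ ((k mod 2) * (l mod 2))" for k l :: nat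
      by (simp add: minus_one_power_iff)
    have "conv (homog p \<Phi>) (homog q \<Gamma>) A B = (\<Sum>A1\<in>Pow A. \<Sum>B1\<in>Pow B.
        (- 1) ^ (p * q) * (homog q \<Gamma> A1 B1 * homog p \<Phi> (A - A1) (B - B1) * shuffle_kernel A1 B1 (A - A1) (B - B1)))"
      unfolding conv_def
    \<comment> \<open>Passing to complements exchanges the two parts of each decomposition; the sign
      comes from \<open>shuffle_kernel_swap\<close>.\<close>
    proof (rule sum.reindex_bij_witness[where i = "\<lambda>C. A - C" and j = "\<lambda>C. A - C"])
      fix A1 assume A1: "A1 \<in> Pow A"
      show "(\<Sum>B1\<in>Pow B. (- 1) ^ (p * q) * (homog q \<Gamma> (A - A1) B1 * homog p \<Phi> (A - (A - A1)) (B - B1) *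
            shuffle_kernel (A - A1) B1 (A - (A - A1)) (B - B1))) =
          (\<Sum>B1\<in>Pow B. homog p \<Phi> A1 B1 * homog q \<Gamma> (A - A1) (B - B1) * shuffle_kernel A1 B1 (A - A1) (B - B1))"
      proof (rule sum.reindex_bij_witness[where i = "\<lambda>C. B - C" and j = "\<lambda>C. B - C"])
        fix B1 assume B1: "B1 \<in> Pow B"
        have dd: "A - (A - A1) = A1" "B - (B - B1) = B1" using A1 B1 by auto
        show "homog p \<Phi> A1 (B - B1) * homog q \<Gamma> (A - A1) (B - (B - B1)) *
            shuffle_kernel A1 (B - B1) (A - A1) (B - (B - B1)) =
          (- 1) ^ (p * q) * (homog q \<Gamma> (A - A1) B1 * homog p \<Phi> (A - (A - A1)) (B - B1) *
            shuffle_kernel (A - A1) B1 (A - (A - A1)) (B - B1))"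
          unfolding dd shuffle_kernel_swap[of A1 "B - B1" "A - A1" B1]
          by (subst sgn) (auto simp: homog_def mult.commute)
      qed auto
    qed auto
    then show ?thesis by (simp add: conv_def sum_distrib_left)
  qed (simp add: conv_infinite)
qed

lemma homog_conv:
  assumes "p < 2"
  shows "homog p (conv \<Phi> \<Gamma>) =
    (\<lambda>A B. \<Sum>(i, j)\<in>{(i, j). i \<in> {0, 1} \<and> j \<in> {0, 1} \<and> (i + j) mod 2 = p}. conv (homog i \<Phi>) (homog j \<Gamma>) A B)"
proof (intro ext)
  fix A B
  show "homog p (conv \<Phi> \<Gamma>) A B =
    (\<Sum>(i, j)\<in>{(i, j). i \<in> {0, 1} \<and> j \<in> {0, 1} \<and> (i + j) mod 2 = p}. conv (homog i \<Phi>) (homog j \<Gamma>) A B)"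
  proof (cases "finite A \<and> finite B")
    case True
    let ?S = "{(i, j). i \<in> {0, 1::nat} \<and> j \<in> {0, 1} \<and> (i + j) mod 2 = p}"
    have finS: "finite ?S" by (rule finite_subset[of _ "{0, 1} \<times> {0, 1}"]) auto
    have "(\<Sum>(i, j)\<in>?S. conv (homog i \<Phi>) (homog j \<Gamma>) A B) =
      (\<Sum>A1\<in>Pow A. \<Sum>B1\<in>Pow B. \<Sum>(i, j)\<in>?S. homog i \<Phi> A1 B1 * homog j \<Gamma> (A - A1) (B - B1) *
         shuffle_kernel A1 B1 (A - A1) (B - B1))"
      unfolding conv_def case_prod_unfold
      by (subst sum.swap, intro sum.cong refl, subst sum.swap) simp
    also have "\<dots> = (\<Sum>A1\<in>Pow A. \<Sum>B1\<in>Pow B. if (card A + card B) mod 2 = p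
      then \<Phi> A1 B1 * \<Gamma> (A - A1) (B - B1) * shuffle_kernel A1 B1 (A - A1) (B - B1) else 0)"
    proof (intro sum.cong refl)
      fix A1 B1 assume *: "A1 \<in> Pow A" "B1 \<in> Pow B"
      \<comment> \<open>Each decomposition has definite parities, so only the pair (i0, j0) can
        contribute, and the parities of the parts add up to that of the whole.\<close>
      define i0 j0 where "i0 = (card A1 + card B1) mod 2" and "j0 = (card (A - A1) + card (B - B1)) mod 2"
      have "card A = card A1 + card (A - A1)" "card B = card B1 + card (B - B1)"
        using * True by (auto simp: card_Diff_subset finite_subset card_mono)
      then have par: "(i0 + j0) mod 2 = (card A + card B) mod 2"
        unfolding i0_def j0_def by (simp only: mod_add_eq) (simp add: add_ac)
      have ij: "i0 \<in> {0, 1}" "j0 \<in> {0, 1}" unfolding i0_def j0_def by auto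
      have "(\<Sum>(i, j)\<in>?S. homog i \<Phi> A1 B1 * homog j \<Gamma> (A - A1) (B - B1) * shuffle_kernel A1 B1 (A - A1) (B - B1)) =
        (\<Sum>e\<in>?S. if e = (i0, j0) then \<Phi> A1 B1 * \<Gamma> (A - A1) (B - B1) * shuffle_kernel A1 B1 (A - A1) (B - B1) else 0)"
        by (intro sum.cong refl) (auto simp: homog_def i0_def j0_def split: if_splits)
      also have "\<dots> = (if (i0, j0) \<in> ?S then \<Phi> A1 B1 * \<Gamma> (A - A1) (B - B1) * shuffle_kernel A1 B1 (A - A1) (B - B1) else 0)"
        using finS by (rule sum.delta)
      finally show "(\<Sum>(i, j)\<in>?S. homog i \<Phi> A1 B1 * homog j \<Gamma> (A - A1) (B - B1) * shuffle_kernel A1 B1 (A - A1) (B - B1)) =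
        (if (card A + card B) mod 2 = p then \<Phi> A1 B1 * \<Gamma> (A - A1) (B - B1) * shuffle_kernel A1 B1 (A - A1) (B - B1) else 0)"
        using ij par by simp
    qed
    also have "\<dots> = homog p (conv \<Phi> \<Gamma>) A B"
      by (simp add: homog_def conv_def)
    finally show ?thesis by simp
  qed (auto simp: conv_infinite homog_def case_prod_unfold)
qed

lemma homog_decompose: "\<Phi> = (\<lambda>A B. homog 0 \<Phi> A B + homog 1 \<Phi> A B)"
  by (intro ext) (auto simp: homog_def)

section \<open>Models of superalgebras by functions on pairs of finite sets\<close>

text \<open>An embedding into the convolution algebra. Ring and module axioms are inherited through
  injectivity, so none is checked on polynomials or cosets. Parity components are transported as
  well because the product of \<open>tensor_algebra\<close> is built from them.\<close>

locale model =
  fixes A :: "('a, 'm) superalgebra_scheme" and \<tau> :: "'a \<Rightarrow> setfun"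
  assumes add_closed [simp]: "x \<in> carrier A \<Longrightarrow> y \<in> carrier A \<Longrightarrow> x \<oplus>\<^bsub>A\<^esub> y \<in> carrier A"
    and mult_closed [simp]: "x \<in> carrier A \<Longrightarrow> y \<in> carrier A \<Longrightarrow> x \<otimes>\<^bsub>A\<^esub> y \<in> carrier A"
    and smult_closed [simp]: "x \<in> carrier A \<Longrightarrow> c \<odot>\<^bsub>A\<^esub> x \<in> carrier A"
    and zero_closed [simp]: "\<zero>\<^bsub>A\<^esub> \<in> carrier A"
    and one_closed [simp]: "\<one>\<^bsub>A\<^esub> \<in> carrier A"
    and parity_closed [simp]: "x \<in> carrier A \<Longrightarrow> p < 2 \<Longrightarrow> parity_part A p x \<in> carrier A"
    and inj: "x \<in> carrier A \<Longrightarrow> y \<in> carrier A \<Longrightarrow> \<tau> x = \<tau> y \<Longrightarrow> x = y"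
    and finitary [simp]: "x \<in> carrier A \<Longrightarrow> finitary (\<tau> x)"
    and add: "x \<in> carrier A \<Longrightarrow> y \<in> carrier A \<Longrightarrow> \<tau> (x \<oplus>\<^bsub>A\<^esub> y) = (\<lambda>C D. \<tau> x C D + \<tau> y C D)"
    and mult: "x \<in> carrier A \<Longrightarrow> y \<in> carrier A \<Longrightarrow> \<tau> (x \<otimes>\<^bsub>A\<^esub> y) = conv (\<tau> x) (\<tau> y)"
    and smult: "x \<in> carrier A \<Longrightarrow> \<tau> (c \<odot>\<^bsub>A\<^esub> x) = (\<lambda>C D. c * \<tau> x C D)"
    and zero: "\<tau> \<zero>\<^bsub>A\<^esub> = (\<lambda>C D. 0)"
    and one: "\<tau> \<one>\<^bsub>A\<^esub> = conv_unit"
    and parity: "x \<in> carrier A \<Longrightarrow> p < 2 \<Longrightarrow> \<tau> (parity_part A p x) = homog p (\<tau> x)"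
begin

lemmas simps = add mult smult zero one parity

lemma abelian_group: "abelian_group A"
proof (rule abelian_groupI)
  fix x assume "x \<in> carrier A"
  then show "\<exists>y\<in>carrier A. y \<oplus>\<^bsub>A\<^esub> x = \<zero>\<^bsub>A\<^esub>"
    by (intro bexI[of _ "(- 1) \<odot>\<^bsub>A\<^esub> x"] inj) (simp_all add: simps)
qed (auto intro!: inj simp: simps algebra_simps)

lemma ring: "ring A"
proof (rule ringI[OF abelian_group])
  show "monoid A"
    by (rule monoidI) (auto intro!: inj simp: simps conv_assoc)
qed (auto intro!: inj simp: simps conv_add)

lemma is_algebra: "is_algebra A"
  unfolding is_algebra_def
proof (intro conjI allI ballI)
  show "Module.module (ring_of_type_algebra :: rat ring) A"
    by (rule moduleI[OF _ abelian_group])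
      (auto intro!: inj simp: simps ring_of_type_algebra_def[where 'a = rat] algebra_simps cring_from_type_algebra[where 'a = rat, unfolded ring_of_type_algebra_def[where 'a = rat]])
qed (auto intro!: inj ring simp: simps conv_scale)

end

section \<open>Graded algebras\<close>

lemma scale_eq: "scale c p = single 0 c * (p :: 'v mpoly)"
  by (simp add: scale_def mult_map_scale_conv_mult)

lemma scale_0 [simp]: "scale c 0 = 0"
  by (rule poly_mapping_eqI) (simp add: scale_def Poly_Mapping.map.rep_eq)

lemma eval_scale [simp]: "eval a (scale c p) = c * eval a p"
  by (simp add: scale_eq)

lemma relabel_scale [simp]: "relabel \<theta> (scale c p) = scale c (relabel \<theta> p)"
  by (simp add: scale_eq)

lemma vars_scale: "vars p \<subseteq> V \<Longrightarrow> vars (scale c p) \<subseteq> V"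
  unfolding vars_subset_iff eval_scale by metis

lemma vars_relabel:
  "(\<And>v. v \<in> vars p \<Longrightarrow> \<theta> v \<in> V) \<Longrightarrow> vars (relabel \<theta> p) \<subseteq> V"
  unfolding vars_subset_iff eval_relabel by (intro allI impI evl.subst_cong) auto

lemma vars_0 [simp]: "vars 0 = {}" and vars_1 [simp]: "vars 1 = {}"
  by (simp_all add: vars_def)

lemma A1_prod_closed':
  "f \<in> bisym_polys d \<Longrightarrow> g \<in> bisym_polys e \<Longrightarrow> A1_prod d e f g \<in> bisym_polys (d + e)"
  by (cases d; cases e) (simp only: add_Pair A1_prod_closed)

declare A1_prod.simps [simp del] bisym_polys.simps [simp del]

lemma graded_simps [simp]:
  "F \<in> carrier (graded_algebra H pr par) \<longleftrightarrow> (\<forall>d. lookup F d \<in> H d)"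
  "F \<oplus>\<^bsub>graded_algebra H pr par\<^esub> G = F + G"
  "\<zero>\<^bsub>graded_algebra H pr par\<^esub> = 0"
  "\<one>\<^bsub>graded_algebra H pr par\<^esub> = single 0 1"
  by (simp_all add: graded_algebra_def)

lemma lookup_graded_smult [simp]:
  "lookup (c \<odot>\<^bsub>graded_algebra H pr par\<^esub> F) d = scale c (lookup F d)"
  by (simp add: graded_algebra_def Poly_Mapping.map.rep_eq when_def)

lemma lookup_graded_parity [simp]:
  "lookup (parity_part (graded_algebra H pr par) p F) d =
    (if par d = p then lookup F d else 0)"
  by (simp add: graded_algebra_def lookup_sum lookup_single when_def sum.delta' in_keys_iff)

lemma lookup_graded_mult:
  "lookup (F \<otimes>\<^bsub>graded_algebra H pr par\<^esub> G) k =
    (\<Sum>d\<in>keys F. \<Sum>e\<in>keys G. if d + e = k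
      then pr d e (lookup F d) (lookup G e) else 0)"
  by (simp add: graded_algebra_def lookup_sum lookup_single when_def)

text \<open>Here \<open>I\<close> is a set of decompositions and \<open>dm i\<close>,
  \<open>cd i\<close> are the degrees of the two parts. Each decomposition occurs for only one pair
  of degrees, so the double sum over supports collapses to a sum over \<open>I\<close>; degrees
  outside the supports contribute 0.\<close>

lemma graded_mult_eval:
  fixes E :: "'v mpoly \<Rightarrow> rat" and \<phi> \<psi> :: "'i \<Rightarrow> 'v mpoly \<Rightarrow> rat"
  assumes "finite I" and E: "E 0 = 0" "\<And>p q. E (p + q) = E p + E q"
    and z: "\<And>i. \<phi> i 0 = 0" "\<And>i. \<psi> i 0 = 0"
    and pr: "\<And>d e. d + e = k \<Longrightarrow> E (pr d e (lookup F d) (lookup G e)) =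
      (\<Sum>i | i \<in> I \<and> dm i = d \<and> cd i = e. \<phi> i (lookup F d) * \<psi> i (lookup G e) * c i)"
    and k: "\<And>i. i \<in> I \<Longrightarrow> dm i + cd i = k"
  shows "E (lookup (F \<otimes>\<^bsub>graded_algebra H pr par\<^esub> G) k) =
    (\<Sum>i\<in>I. \<phi> i (lookup F (dm i)) * \<psi> i (lookup G (cd i)) * c i)"
proof -
  have E_sum: "E (sum h K) = (\<Sum>x\<in>K. E (h x))" for h :: "'x \<Rightarrow> 'v mpoly" and K
    by (induction K rule: infinite_finite_induct) (simp_all add: E)
  let ?t = "\<lambda>d e i. \<phi> i (lookup F d) * \<psi> i (lookup G e) * c i"
  have inner: "E (if d + e = k then pr d e (lookup F d) (lookup G e) else 0) =
      (\<Sum>i\<in>I. if cd i = e then if dm i = d then ?t d e i else 0 else 0)" for d e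
  proof (cases "d + e = k")
    case True
    have "(\<Sum>i\<in>I. if cd i = e then if dm i = d then ?t d e i else 0 else 0) =
      (\<Sum>i\<in>I. if dm i = d \<and> cd i = e then ?t d e i else 0)"
      by (intro sum.cong) auto
    also have "\<dots> = (\<Sum>i | i \<in> I \<and> dm i = d \<and> cd i = e. ?t d e i)"
      using assms(1) by (simp add: sum.inter_filter)
    finally show ?thesis using True pr by simp
  next
    case False
    then have "(\<Sum>i\<in>I. if cd i = e then if dm i = d then ?t d e i else 0 else 0) = 0"
      using k by (intro sum.neutral) auto
    with False show ?thesis by (simp add: E)
  qed
  have "E (lookup (F \<otimes>\<^bsub>graded_algebra H pr par\<^esub> G) k) =
    (\<Sum>d\<in>keys F. \<Sum>e\<in>keys G. \<Sum>i\<in>I.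
      if cd i = e then if dm i = d then ?t d e i else 0 else 0)"
    by (simp only: lookup_graded_mult E_sum inner)
  also have "\<dots> = (\<Sum>d\<in>keys F. \<Sum>i\<in>I. if dm i = d then ?t d (cd i) i else 0)"
    by (subst sum.swap, intro sum.cong refl, simp add: sum.delta' in_keys_iff z)
  also have "\<dots> = (\<Sum>i\<in>I. ?t (dm i) (cd i) i)"
    by (subst sum.swap, intro sum.cong refl, simp add: sum.delta' in_keys_iff z)
  finally show ?thesis .
qed

lemma graded_mult_closed:
  fixes H :: "'d::comm_monoid_add \<Rightarrow> 'v mpoly set"
  assumes "\<And>d. 0 \<in> H d" "\<And>d p q. p \<in> H d \<Longrightarrow> q \<in> H d \<Longrightarrow> p + q \<in> H d"
    "\<And>d e p q. p \<in> H d \<Longrightarrow> q \<in> H e \<Longrightarrow> pr d e p q \<in> H (d + e)"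
    "F \<in> carrier (graded_algebra H pr par)" "G \<in> carrier (graded_algebra H pr par)"
  shows "F \<otimes>\<^bsub>graded_algebra H pr par\<^esub> G \<in> carrier (graded_algebra H pr par)"
proof -
  have sum: "sum h K \<in> H d" if "\<And>x. x \<in> K \<Longrightarrow> h x \<in> H d" for d and h :: "'d \<Rightarrow> 'v mpoly" and K
    using that by (induction K rule: infinite_finite_induct) (auto intro: assms(1,2))
  show ?thesis
    unfolding graded_simps lookup_graded_mult
    by (intro allI sum) (use assms in auto)
qed

section \<open>The three Hall algebras as algebras of functions\<close>

lemma bisym_closed [simp]:
  "0 \<in> bisym_polys d" "p \<in> bisym_polys d \<Longrightarrow> q \<in> bisym_polys d \<Longrightarrow> p + q \<in> bisym_polys d"
  "p \<in> bisym_polys d \<Longrightarrow> scale c p \<in> bisym_polys d" "1 \<in> bisym_polys 0"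
proof -
  obtain m n where d: "d = (m, n)" by (cases d)
  show "0 \<in> bisym_polys d" by (simp add: d bisym_polys.simps)
  show "p \<in> bisym_polys d \<Longrightarrow> q \<in> bisym_polys d \<Longrightarrow> p + q \<in> bisym_polys d"
    unfolding d bisym_polys.simps mem_Collect_eq by (intro conjI vars_closure) auto
  show "p \<in> bisym_polys d \<Longrightarrow> scale c p \<in> bisym_polys d"
    unfolding d bisym_polys.simps mem_Collect_eq by (intro conjI vars_scale) auto
  show "1 \<in> bisym_polys 0" by (simp add: zero_prod_def bisym_polys.simps)
qed

lemma sym_closed [simp]:
  "0 \<in> sym_polys d" "p \<in> sym_polys d \<Longrightarrow> q \<in> sym_polys d \<Longrightarrow> p + q \<in> sym_polys d"
  "p \<in> sym_polys d \<Longrightarrow> scale c p \<in> sym_polys d" "1 \<in> sym_polys 0"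
proof -
  show "0 \<in> sym_polys d" by (simp add: sym_polys_def)
  show "p \<in> sym_polys d \<Longrightarrow> q \<in> sym_polys d \<Longrightarrow> p + q \<in> sym_polys d"
    unfolding sym_polys_def mem_Collect_eq by (intro conjI vars_closure) auto
  show "p \<in> sym_polys d \<Longrightarrow> scale c p \<in> sym_polys d"
    unfolding sym_polys_def mem_Collect_eq by (intro conjI vars_scale) auto
  show "1 \<in> sym_polys 0" by (simp add: sym_polys_def)
qed

lemma bval_simps [simp]:
  "bval 0 A B = 0" "bval 1 A B = 1" "bval (p + q) A B = bval p A B + bval q A B"
  "bval (scale c p) A B = c * bval p A B"
  by (simp_all add: bval_def)

lemma sval_simps [simp]:
  "sval 0 A = 0" "sval 1 A = 1" "sval (p + q) A = sval p A + sval q A" "sval (scale c p) A = c * sval p A"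
  by (simp_all add: sval_def)

text \<open>The cardinalities of the two sets select the graded component, so a single function
  records the whole family.\<close>

definition tA :: "(nat \<times> nat \<Rightarrow>\<^sub>0 xy mpoly) \<Rightarrow> setfun" where
  "tA F A B = (if finite A \<and> finite B then bval (lookup F (card A, card B)) A B else 0)"

definition tX :: "(nat \<Rightarrow>\<^sub>0 nat mpoly) \<Rightarrow> setfun" where
  "tX F A B = (if finite A \<and> B = {} then sval (lookup F (card A)) A else 0)"

definition tY :: "(nat \<Rightarrow>\<^sub>0 nat mpoly) \<Rightarrow> setfun" where
  "tY F A B = (if A = {} \<and> finite B then sval (lookup F (card B)) B else 0)"

text \<open>Only the size of \<open>B\<close> matters: this is the shape of a polynomial in the x
  variables alone, matching the prescription of \<open>Psi0\<close> on \<open>phi i\<close>.\<close>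

definition tJ :: "(nat \<Rightarrow>\<^sub>0 nat mpoly) \<Rightarrow> setfun" where
  "tJ F A B = (if finite A \<and> finite B \<and> card A = card B then sval (lookup F (card A)) A else 0)"

lemma parity_A1: "nat ((int m - int n)\<^sup>2 mod 2) = (m + n) mod 2"
proof -
  have "(int m - int n)\<^sup>2 mod 2 = int ((m + n) mod 2)"
    by (cases "even m"; cases "even n") (auto simp: mod2_eq_if)
  then show ?thesis by simp
qed

lemma parity_pt: "(m::nat)\<^sup>2 mod 2 = m mod 2"
  by (auto simp: mod2_eq_if)

lemma model_A1: "model coha_A1 tA"
proof
  fix F G assume F: "F \<in> carrier coha_A1" and G: "G \<in> carrier coha_A1"
  show "F \<otimes>\<^bsub>coha_A1\<^esub> G \<in> carrier coha_A1"
    using F G unfolding coha_A1_def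
    by (intro graded_mult_closed) (auto intro: A1_prod_closed')
  show "F = G" if eq: "tA F = tA G"
  proof (rule poly_mapping_eqI)
    fix d :: "nat \<times> nat"
    obtain m n where d: "d = (m, n)" by (cases d)
    show "lookup F d = lookup G d"
      unfolding d
    proof (rule bisym_eqI[of _ m n])
      fix A B :: "rat set" assume "finite A" "finite B" "card A = m" "card B = n"
      with fun_cong[OF fun_cong[OF eq, of A], of B]
      show "bval (lookup F (m, n)) A B = bval (lookup G (m, n)) A B"
        by (simp add: tA_def)
    qed (use F G in \<open>auto simp only: coha_A1_def graded_simps\<close>)
  qed
  show "tA (F \<otimes>\<^bsub>coha_A1\<^esub> G) = conv (tA F) (tA G)"
  proof (intro ext)
    fix A B
    show "tA (F \<otimes>\<^bsub>coha_A1\<^esub> G) A B = conv (tA F) (tA G) A B"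
    proof (cases "finite A \<and> finite B")
      case True
      have "bval (lookup (F \<otimes>\<^bsub>coha_A1\<^esub> G) (card A, card B)) A B =
        (\<Sum>i\<in>Pow A \<times> Pow B.
          bval (lookup F (card (fst i), card (snd i))) (fst i) (snd i) *
          bval (lookup G (card (A - fst i), card (B - snd i))) (A - fst i) (B - snd i) *
          shuffle_kernel (fst i) (snd i) (A - fst i) (B - snd i))"
        unfolding coha_A1_def
      proof (rule graded_mult_eval[where E = "\<lambda>p. bval p A B" and
          dm = "\<lambda>i. (card (fst i), card (snd i))" and cd = "\<lambda>i. (card (A - fst i), card (B - snd i))"
          and c = "\<lambda>i. shuffle_kernel (fst i) (snd i) (A - fst i) (B - snd i)"])
        fix d e :: "nat \<times> nat" assume de: "d + e = (card A, card B)"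
        obtain m n r q where d: "d = (m, n)" and e: "e = (r, q)" by (cases d; cases e)
        let ?f = "lookup F d" and ?g = "lookup G e"
        have fg: "?f \<in> bisym_polys (m, n)" "?g \<in> bisym_polys (r, q)"
          using F G by (simp_all only: d e coha_A1_def graded_simps)
        have c: "card A = m + r" "card B = n + q" using de by (simp_all add: d e)
        have set: "{i. i \<in> Pow A \<times> Pow B \<and> (card (fst i), card (snd i)) = d \<and>
            (card (A - fst i), card (B - snd i)) = e} =
          {A1. A1 \<subseteq> A \<and> card A1 = m} \<times> {B1. B1 \<subseteq> B \<and> card B1 = n}"
          using True c by (auto simp: d e card_Diff_subset finite_subset)
        show "bval (A1_prod d e ?f ?g) A B = (\<Sum>i | i \<in> Pow A \<times> Pow B \<and> (card (fst i), card (snd i)) = d \<and>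
            (card (A - fst i), card (B - snd i)) = e. bval ?f (fst i) (snd i) * bval ?g (A - fst i) (B - snd i) *
            shuffle_kernel (fst i) (snd i) (A - fst i) (B - snd i))"
          unfolding set using bval_A1_prod[OF fg _ _ c] True
          by (simp add: d e sum.cartesian_product case_prod_unfold)
      next
        fix i assume "i \<in> Pow A \<times> Pow B"
        then show "(card (fst i), card (snd i)) + (card (A - fst i), card (B - snd i)) = (card A, card B)"
          using True by (auto simp: card_Diff_subset finite_subset card_mono)
      qed (use True in auto)
      also have "\<dots> = conv (tA F) (tA G) A B"
        unfolding conv_def sum.cartesian_product case_prod_unfold
        by (intro sum.cong refl) (use True in \<open>auto simp: tA_def finite_subset\<close>)
      finally show ?thesis using True by (simp add: tA_def)
    qed (auto simp: conv_infinite tA_def)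
  qed
  show "tA (F \<oplus>\<^bsub>coha_A1\<^esub> G) = (\<lambda>A B. tA F A B + tA G A B)"
    by (intro ext) (simp add: tA_def coha_A1_def lookup_add)
next
  fix F c assume "F \<in> carrier coha_A1"
  show "tA (c \<odot>\<^bsub>coha_A1\<^esub> F) = (\<lambda>A B. c * tA F A B)"
    by (intro ext) (simp add: tA_def coha_A1_def)
next
  fix F and p :: nat assume "F \<in> carrier coha_A1"
  show "tA (parity_part coha_A1 p F) = homog p (tA F)"
    by (intro ext) (auto simp: tA_def homog_def coha_A1_def parity_A1)
next
  show "tA \<zero>\<^bsub>coha_A1\<^esub> = (\<lambda>A B. 0)" by (intro ext) (simp add: tA_def coha_A1_def)
  show "tA \<one>\<^bsub>coha_A1\<^esub> = conv_unit"
    by (intro ext) (auto simp: tA_def coha_A1_def conv_unit_def lookup_single when_def zero_prod_def)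
next
  fix F assume "F \<in> carrier coha_A1"
  show "finitary (tA F)" by (simp add: finitary_def tA_def)
next
  show "\<one>\<^bsub>coha_A1\<^esub> \<in> carrier coha_A1"
    unfolding coha_A1_def graded_simps lookup_single when_def by simp
qed (auto simp: coha_A1_def lookup_add lookup_single when_def)

section \<open>The algebras of the two quivers with one vertex\<close>

lemma sval_inject:
  assumes "f \<in> sym_polys d" "g \<in> sym_polys d"
    "\<And>A. finite A \<Longrightarrow> card A = d \<Longrightarrow> sval f A = sval g A"
  shows "f = g"
proof -
  have "f - g = 0"
  proof (rule eval_eq_zeroD_generic[of "{1..d}" "{}"])
    fix s :: "nat \<Rightarrow> rat" assume "inj_on s {1..d}"
    then have b: "bij_betw s {1..d} (s ` {1..d})" by (rule bij_betw_inj_image)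
    then have "card (s ` {1..d}) = d" using bij_betw_same_card by force
    with assms(3) sval_eqI[OF assms(1) b] sval_eqI[OF assms(2) b]
    show "eval s (f - g) = 0" by simp
  qed auto
  then show ?thesis by simp
qed

lemma relabel_Xv_bisym:
  assumes "f \<in> sym_polys m"
  shows "relabel Xv f \<in> bisym_polys (m, n)"
proof (rule bisym_polysI)
  show "vars (relabel Xv f) \<subseteq> Xv ` {1..m} \<union> Yv ` {1..n}"
    by (rule vars_relabel) (use assms in \<open>auto simp: sym_polys_def\<close>)
  fix s t :: "nat \<Rightarrow> rat" and \<pi> \<rho> assume "\<pi> permutes {1..m}"
  then have "eval s (relabel \<pi> f) = eval s f" using assms by (simp add: sym_polys_def)
  then show "eval (xy_point (s \<circ> \<pi>) (t \<circ> \<rho>)) (relabel Xv f) = eval (xy_point s t) (relabel Xv f)"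
    by simp
qed

lemma relabel_Yv_bisym:
  assumes "f \<in> sym_polys n"
  shows "relabel Yv f \<in> bisym_polys (m, n)"
proof (rule bisym_polysI)
  show "vars (relabel Yv f) \<subseteq> Xv ` {1..m} \<union> Yv ` {1..n}"
    by (rule vars_relabel) (use assms in \<open>auto simp: sym_polys_def\<close>)
  fix s t :: "nat \<Rightarrow> rat" and \<pi> \<rho> assume "\<rho> permutes {1..n}"
  then have "eval t (relabel \<rho> f) = eval t f" using assms by (simp add: sym_polys_def)
  then show "eval (xy_point (s \<circ> \<pi>) (t \<circ> \<rho>)) (relabel Yv f) = eval (xy_point s t) (relabel Yv f)"
    by simp
qed

lemma bval_relabel_XY [simp]: "bval (relabel Xv f) A B = sval f A" "bval (relabel Yv f) A B = sval f B"
  by (simp_all add: bval_def sval_def)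

text \<open>Without y variables the kernel of \<open>A1_prod\<close> reduces to the reciprocal of
  \<open>dprod\<close>, so polynomiality is inherited from the two-vertex quiver.\<close>

lemma pt_prod_exists:
  assumes f: "f \<in> sym_polys d" and g: "g \<in> sym_polys e"
  obtains p where "p \<in> sym_polys (d + e)" "pt_prod d e f g = p"
    "\<And>A. finite A \<Longrightarrow> card A = d + e \<Longrightarrow>
      sval p A = (\<Sum>A1 | A1 \<subseteq> A \<and> card A1 = d. sval f A1 * sval g (A - A1) * (1 / dprod A1 (A - A1)))"
proof -
  define P where "P = A1_prod (d, 0) (e, 0) (relabel Xv f) (relabel Xv g)"
  \<comment> \<open>No y variable occurs in \<open>P\<close>, so their image 0 is an arbitrary
    default.\<close>
  define p where "p = relabel (\<lambda>v. case v of Xv i \<Rightarrow> i | Yv _ \<Rightarrow> 0) P"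
  define C where "C A = (\<Sum>A1 | A1 \<subseteq> A \<and> card A1 = d. sval f A1 * sval g (A - A1) * (1 / dprod A1 (A - A1)))" for A
  note fg = relabel_Xv_bisym[OF f, of 0] relabel_Xv_bisym[OF g, of 0]
  have P: "P \<in> bisym_polys (d + e, 0)" using A1_prod_closed[OF fg] by (simp add: P_def)
  have bP: "bval P A {} = C A" if "finite A" "card A = d + e" for A
  proof -
    have sub: "{B1. B1 \<subseteq> {} \<and> card B1 = 0} = {{}}" by auto
    show ?thesis
      using bval_A1_prod[OF fg, of A "{}"] that unfolding sub
      by (simp add: P_def C_def shuffle_kernel_def)
  qed
  have eval_p: "eval s p = C (s ` {1..d + e})" if s: "inj_on s {1..d + e}" for s
  proof -
    have "s \<circ> (\<lambda>v. case v of Xv i \<Rightarrow> i | Yv _ \<Rightarrow> 0) = xy_point s (\<lambda>_. s 0)"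
    proof
      fix v show "(s \<circ> (\<lambda>v. case v of Xv i \<Rightarrow> i | Yv _ \<Rightarrow> 0)) v = xy_point s (\<lambda>_. s 0) v" by (cases v) auto
    qed
    then have "eval s p = eval (xy_point s (\<lambda>_. s 0)) P" by (simp add: p_def)
    also have "\<dots> = bval P (s ` {1..d + e}) {}"
      by (rule bval_eqI[OF P bij_betw_inj_image[OF s]]) (simp add: bij_betw_def)
    also have "\<dots> = C (s ` {1..d + e})" using s by (intro bP) (simp_all add: card_image)
    finally show ?thesis .
  qed
  have sym: "p \<in> sym_polys (d + e)"
  proof (rule sym_polysI)
    show "vars p \<subseteq> {1..d + e}" unfolding p_def by (rule vars_relabel) (use P in \<open>auto simp: bisym_polys.simps\<close>)
    fix s :: "nat \<Rightarrow> rat" and \<pi> assume s: "inj_on s {1..d + e}" and \<pi>: "\<pi> permutes {1..d + e}"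
    then have "inj_on (s \<circ> \<pi>) {1..d + e}"
      by (auto intro!: comp_inj_on simp: permutes_image inj_on_subset[OF permutes_inj])
    moreover have "(s \<circ> \<pi>) ` {1..d + e} = s ` {1..d + e}" using \<pi> by (metis image_comp permutes_image)
    ultimately show "eval (s \<circ> \<pi>) p = eval s p" using s by (simp add: eval_p)
  qed
  let ?num = "\<lambda>\<sigma>. relabel \<sigma> f * relabel (\<lambda>i. \<sigma> (d + i)) g"
  let ?den = "\<lambda>\<sigma>. \<Prod>\<mu>\<in>{1..d}. \<Prod>\<nu>\<in>{d + 1..d + e}. vdiff (\<sigma> \<mu>) (\<sigma> \<nu>)"
  define w where "w = (\<Prod>i\<in>{1..d + e}. \<Prod>j\<in>{1..d + e} - {i}. vdiff i j)"
  have F: "Fract p 1 = (\<Sum>\<sigma>\<in>shuffle_perms d e. Fract (?num \<sigma>) (?den \<sigma>))"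
  proof (subst Fract_sum_iff[where w = w])
    show "w \<noteq> 0" by (auto simp: w_def)
    fix \<sigma> assume \<sigma>: "\<sigma> \<in> shuffle_perms d e"
    have *: "\<sigma> \<mu> \<noteq> \<sigma> \<nu>" if "\<mu> \<in> {1..d}" "\<nu> \<in> {d + 1..d + e}" for \<mu> \<nu>
      using that inj_eq[OF permutes_inj[OF shuffle_perms_permutes[OF \<sigma>]], of \<mu> \<nu>] by auto
    show "?den \<sigma> \<noteq> 0"
    proof
      assume "?den \<sigma> = 0"
      then obtain \<mu> \<nu> where "\<mu> \<in> {1..d}" "\<nu> \<in> {d + 1..d + e}" "vdiff (\<sigma> \<mu>) (\<sigma> \<nu>) = 0"
        by (auto simp: prod_zero_iff simp del: atLeastAtMost_iff)
      with *[of \<mu> \<nu>] show False by simp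
    qed
  next
    show "\<forall>a. eval a w \<noteq> 0 \<longrightarrow> (\<forall>\<sigma>\<in>shuffle_perms d e. eval a (?den \<sigma>) \<noteq> 0) \<longrightarrow>
      eval a p = (\<Sum>\<sigma>\<in>shuffle_perms d e. eval a (?num \<sigma>) / eval a (?den \<sigma>))"
    proof (intro allI impI)
      fix s assume w: "eval s w \<noteq> 0"
      have s: "inj_on s {1..d + e}"
      proof (rule inj_onI, rule ccontr)
        fix i j assume *: "i \<in> {1..d + e}" "j \<in> {1..d + e}" "s i = s j" "i \<noteq> j"
        then have "\<exists>i\<in>{1..d + e}. \<exists>j\<in>{1..d + e} - {i}. s j - s i = 0" by force
        then have "eval s w = 0" by (simp add: w_def prod_zero_iff)
        with w show False by simp
      qed
      have "eval s (?num \<sigma>) / eval s (?den \<sigma>) = sval f (s ` \<sigma> ` {1..d}) * sval g (s ` \<sigma> ` {d + 1..d + e}) *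
        (1 / dprod (s ` \<sigma> ` {1..d}) (s ` \<sigma> ` {d + 1..d + e}))" if \<sigma>: "\<sigma> \<in> shuffle_perms d e" for \<sigma>
        using shuffle_perms_inj[OF s \<sigma>] sval_eqI[OF f shuffle_perms_inj(4)[OF s \<sigma>]]
          sval_eqI[OF g shuffle_perms_inj(5)[OF s \<sigma>]]
          dprod_reindex(1)[OF shuffle_perms_inj(2,3)[OF s \<sigma>]]
        by (simp add: image_comp)
      then have "(\<Sum>\<sigma>\<in>shuffle_perms d e. eval s (?num \<sigma>) / eval s (?den \<sigma>)) = C (s ` {1..d + e})"
        unfolding C_def
        by (subst sum_shuffle_perms[OF bij_betw_inj_image[OF s],
          where h = "\<lambda>A1 A2. sval f A1 * sval g A2 * (1 / dprod A1 A2)", symmetric]) simp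
      then show "eval s p = (\<Sum>\<sigma>\<in>shuffle_perms d e. eval s (?num \<sigma>) / eval s (?den \<sigma>))"
        by (simp only: eval_p[OF s])
    qed
  qed auto
  have "pt_prod d e f g = p"
    unfolding pt_prod_def F[symmetric] by (rule the_equality) (auto simp: eq_fract)
  moreover have "sval p A = C A" if "finite A" "card A = d + e" for A
    using eval_p[of "enum A"] bij_enum[OF that(1)] that(2) by (simp add: sval_def bij_betw_def)
  ultimately show ?thesis using sym that unfolding C_def by blast
qed

lemma pt_prod_closed: "f \<in> sym_polys d \<Longrightarrow> g \<in> sym_polys e \<Longrightarrow> pt_prod d e f g \<in> sym_polys (d + e)"
  by (rule pt_prod_exists[of f d g e]) simp_all

lemma sval_pt_prod:
  assumes "f \<in> sym_polys d" "g \<in> sym_polys e" "finite A" "card A = d + e"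
  shows "sval (pt_prod d e f g) A =
    (\<Sum>A1 | A1 \<subseteq> A \<and> card A1 = d. sval f A1 * sval g (A - A1) * (1 / dprod A1 (A - A1)))"
proof -
  obtain p where p: "pt_prod d e f g = p"
    "\<And>A. finite A \<Longrightarrow> card A = d + e \<Longrightarrow>
      sval p A = (\<Sum>A1 | A1 \<subseteq> A \<and> card A1 = d. sval f A1 * sval g (A - A1) * (1 / dprod A1 (A - A1)))"
    by (rule pt_prod_exists[OF assms(1,2)]) blast
  show ?thesis unfolding p(1) by (rule p(2)[OF assms(3,4)])
qed

lemma eval_loop_prod:
  assumes f: "f \<in> sym_polys d" and g: "g \<in> sym_polys e" and s: "inj_on s {1..d + e}"
  shows "eval s (loop_prod d e f g) =
    (\<Sum>A1 | A1 \<subseteq> s ` {1..d + e} \<and> card A1 = d. sval f A1 * sval g (s ` {1..d + e} - A1))"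
proof -
  have "eval s (loop_prod d e f g) =
    (\<Sum>\<sigma>\<in>shuffle_perms d e. sval f (s ` \<sigma> ` {1..d}) * sval g (s ` \<sigma> ` {d + 1..d + e}))"
    unfolding loop_prod_def evl.subst_sum
  proof (intro sum.cong refl)
    fix \<sigma> assume "\<sigma> \<in> shuffle_perms d e"
    note \<sigma> = shuffle_perms_inj[OF s this]
    show "eval s (relabel \<sigma> f * relabel (\<lambda>i. \<sigma> (d + i)) g) =
      sval f (s ` \<sigma> ` {1..d}) * sval g (s ` \<sigma> ` {d + 1..d + e})"
      using sval_eqI[OF f \<sigma>(4)] sval_eqI[OF g \<sigma>(5)] by simp
  qed
  then show ?thesis
    using sum_shuffle_perms[OF bij_betw_inj_image[OF s], where h = "\<lambda>A1 A2. sval f A1 * sval g A2"] by simp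
qed

lemma loop_prod_closed:
  assumes f: "f \<in> sym_polys d" and g: "g \<in> sym_polys e"
  shows "loop_prod d e f g \<in> sym_polys (d + e)"
proof (rule sym_polysI)
  show "vars (loop_prod d e f g) \<subseteq> {1..d + e}"
    unfolding loop_prod_def
  proof (intro vars_closure(1,6) vars_relabel)
    fix \<sigma> v assume \<sigma>: "\<sigma> \<in> shuffle_perms d e"
    have *: "\<sigma> i \<in> {1..d + e} \<longleftrightarrow> i \<in> {1..d + e}" for i
      using shuffle_perms_permutes[OF \<sigma>] by (rule permutes_in_image)
    show "\<sigma> v \<in> {1..d + e}" if "v \<in> vars f"
      unfolding * using that f by (auto simp: sym_polys_def)
    show "\<sigma> (d + v) \<in> {1..d + e}" if "v \<in> vars g"
      unfolding * using that g by (auto simp: sym_polys_def)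
  qed
  fix s :: "nat \<Rightarrow> rat" and \<pi> assume s: "inj_on s {1..d + e}" and \<pi>: "\<pi> permutes {1..d + e}"
  then have "inj_on (s \<circ> \<pi>) {1..d + e}"
    by (auto intro!: comp_inj_on simp: permutes_image inj_on_subset[OF permutes_inj])
  moreover have "(s \<circ> \<pi>) ` {1..d + e} = s ` {1..d + e}" using \<pi> by (metis image_comp permutes_image)
  ultimately show "eval (s \<circ> \<pi>) (loop_prod d e f g) = eval s (loop_prod d e f g)"
    using eval_loop_prod[OF f g s] eval_loop_prod[OF f g, of "s \<circ> \<pi>"] by simp
qed

lemma sval_loop_prod:
  assumes "f \<in> sym_polys d" "g \<in> sym_polys e" "finite A" "card A = d + e"
  shows "sval (loop_prod d e f g) A = (\<Sum>A1 | A1 \<subseteq> A \<and> card A1 = d. sval f A1 * sval g (A - A1) * 1)"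
  using eval_loop_prod[OF assms(1,2), of "enum A"] bij_enum[OF assms(3)] assms(4)
  by (simp add: sval_def bij_betw_def)

lemma carrier_coha [simp]:
  "F \<in> carrier coha_pt \<longleftrightarrow> (\<forall>d. lookup F d \<in> sym_polys d)"
  "F \<in> carrier coha_J \<longleftrightarrow> (\<forall>d. lookup F d \<in> sym_polys d)"
  "H \<in> carrier coha_A1 \<longleftrightarrow> (\<forall>d. lookup H d \<in> bisym_polys d)"
  by (simp_all add: coha_pt_def coha_J_def coha_A1_def)

lemma sval_graded_mult:
  assumes pr: "\<And>d e f g. f \<in> sym_polys d \<Longrightarrow> g \<in> sym_polys e \<Longrightarrow> card A = d + e \<Longrightarrow>
      sval (pr d e f g) A = (\<Sum>A1 | A1 \<subseteq> A \<and> card A1 = d. sval f A1 * sval g (A - A1) * c A1)"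
    and FG: "\<And>d. lookup F d \<in> sym_polys d" "\<And>d. lookup G d \<in> sym_polys d"
    and A: "finite A"
  shows "sval (lookup (F \<otimes>\<^bsub>graded_algebra H pr par\<^esub> G) (card A)) A =
    (\<Sum>A1\<in>Pow A. sval (lookup F (card A1)) A1 *
      sval (lookup G (card (A - A1))) (A - A1) * c A1)"
proof (rule graded_mult_eval[where E = "\<lambda>p. sval p A" and dm = card and cd = "\<lambda>A1. card (A - A1)"])
  fix d e assume de: "d + e = card A"
  have set: "{A1. A1 \<in> Pow A \<and> card A1 = d \<and> card (A - A1) = e} = {A1. A1 \<subseteq> A \<and> card A1 = d}"
    using A de by (auto simp: card_Diff_subset finite_subset)
  show "sval (pr d e (lookup F d) (lookup G e)) A =
    (\<Sum>A1 | A1 \<in> Pow A \<and> card A1 = d \<and> card (A - A1) = e. sval (lookup F d) A1 *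
      sval (lookup G e) (A - A1) * c A1)"
    unfolding set using de by (intro pr FG) simp
next
  fix A1 assume "A1 \<in> Pow A"
  then show "card A1 + card (A - A1) = card A"
    using A by (auto simp: card_Diff_subset finite_subset card_mono)
qed (use A in auto)

lemma sval_pt_mult:
  assumes "F \<in> carrier coha_pt" "G \<in> carrier coha_pt" "finite A"
  shows "sval (lookup (F \<otimes>\<^bsub>coha_pt\<^esub> G) (card A)) A =
    (\<Sum>A1\<in>Pow A. sval (lookup F (card A1)) A1 *
      sval (lookup G (card (A - A1))) (A - A1) * (1 / dprod A1 (A - A1)))"
  unfolding coha_pt_def by (rule sval_graded_mult[OF sval_pt_prod]) (use assms in auto)

lemma sval_J_mult:
  assumes "F \<in> carrier coha_J" "G \<in> carrier coha_J" "finite A"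
  shows "sval (lookup (F \<otimes>\<^bsub>coha_J\<^esub> G) (card A)) A =
    (\<Sum>A1\<in>Pow A. sval (lookup F (card A1)) A1 *
      sval (lookup G (card (A - A1))) (A - A1) * 1)"
  unfolding coha_J_def by (rule sval_graded_mult[OF sval_loop_prod]) (use assms in auto)

lemma graded_sym_inject:
  assumes "\<And>d. lookup F d \<in> sym_polys d" "\<And>d. lookup G d \<in> sym_polys d"
    "\<And>A. finite A \<Longrightarrow> sval (lookup F (card A)) A = sval (lookup G (card A)) A"
  shows "F = G"
proof (rule poly_mapping_eqI)
  fix d show "lookup F d = lookup G d"
    by (rule sval_inject[OF assms(1,2)]) (use assms(3) in auto)
qed

lemma coha_pt_closed:
  assumes "F \<in> carrier coha_pt" "G \<in> carrier coha_pt"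
  shows "F \<oplus>\<^bsub>coha_pt\<^esub> G \<in> carrier coha_pt" "F \<otimes>\<^bsub>coha_pt\<^esub> G \<in> carrier coha_pt"
    "c \<odot>\<^bsub>coha_pt\<^esub> F \<in> carrier coha_pt" "\<zero>\<^bsub>coha_pt\<^esub> \<in> carrier coha_pt"
    "\<one>\<^bsub>coha_pt\<^esub> \<in> carrier coha_pt" "parity_part coha_pt p F \<in> carrier coha_pt"
proof -
  show "F \<otimes>\<^bsub>coha_pt\<^esub> G \<in> carrier coha_pt"
    using assms unfolding coha_pt_def by (intro graded_mult_closed) (auto intro: pt_prod_closed)
  show "\<one>\<^bsub>coha_pt\<^esub> \<in> carrier coha_pt"
    unfolding coha_pt_def graded_simps lookup_single when_def by simp
qed (use assms in \<open>auto simp: coha_pt_def lookup_add\<close>)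

lemma coha_J_closed:
  assumes "F \<in> carrier coha_J" "G \<in> carrier coha_J"
  shows "F \<oplus>\<^bsub>coha_J\<^esub> G \<in> carrier coha_J" "F \<otimes>\<^bsub>coha_J\<^esub> G \<in> carrier coha_J"
    "c \<odot>\<^bsub>coha_J\<^esub> F \<in> carrier coha_J" "\<zero>\<^bsub>coha_J\<^esub> \<in> carrier coha_J"
    "\<one>\<^bsub>coha_J\<^esub> \<in> carrier coha_J" "parity_part coha_J p F \<in> carrier coha_J"
proof -
  show "F \<otimes>\<^bsub>coha_J\<^esub> G \<in> carrier coha_J"
    using assms unfolding coha_J_def by (intro graded_mult_closed) (auto intro: loop_prod_closed)
  show "\<one>\<^bsub>coha_J\<^esub> \<in> carrier coha_J"
    unfolding coha_J_def graded_simps lookup_single when_def by simp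
qed (use assms in \<open>auto simp: coha_J_def lookup_add\<close>)

lemma model_X: "model coha_pt tX"
proof
  fix F G assume F: "F \<in> carrier coha_pt" and G: "G \<in> carrier coha_pt"
  show "F = G" if eq: "tX F = tX G"
  proof (rule graded_sym_inject)
    fix A :: "rat set" assume "finite A"
    with fun_cong[OF fun_cong[OF eq, of A], of "{}"]
    show "sval (lookup F (card A)) A = sval (lookup G (card A)) A"
      by (simp add: tX_def)
  qed (use F G in auto)
  show "F \<otimes>\<^bsub>coha_pt\<^esub> G \<in> carrier coha_pt"
    by (rule coha_pt_closed[OF F G])
  show "tX (F \<otimes>\<^bsub>coha_pt\<^esub> G) = conv (tX F) (tX G)"
  proof (intro ext)
    fix A B
    show "tX (F \<otimes>\<^bsub>coha_pt\<^esub> G) A B = conv (tX F) (tX G) A B"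
    proof (cases "finite A \<and> B = {}")
      case True
      then show ?thesis
        by (auto simp: tX_def conv_def sval_pt_mult[OF F G] shuffle_kernel_def finite_subset intro!: sum.cong)
    next
      case False
      then have "conv (tX F) (tX G) A B = 0"
        by (cases "finite A \<and> finite B")
          (simp add: conv_infinite, auto simp: conv_def tX_def intro!: sum.neutral split: if_splits)
      with False show ?thesis by (auto simp: tX_def)
    qed
  qed
next
  fix F and p :: nat assume "F \<in> carrier coha_pt"
  show "tX (parity_part coha_pt p F) = homog p (tX F)"
    by (intro ext) (auto simp: tX_def homog_def coha_pt_def parity_pt)
qed (auto intro!: ext coha_pt_closed simp del: carrier_coha simp: finitary_def conv_unit_def tX_def coha_pt_def lookup_add lookup_one lookup_single when_def)

lemma model_Y: "model coha_pt tY"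
proof
  fix F G assume F: "F \<in> carrier coha_pt" and G: "G \<in> carrier coha_pt"
  show "F = G" if eq: "tY F = tY G"
  proof (rule graded_sym_inject)
    fix A :: "rat set" assume "finite A"
    with fun_cong[OF fun_cong[OF eq, of "{}"], of A]
    show "sval (lookup F (card A)) A = sval (lookup G (card A)) A"
      by (simp add: tY_def)
  qed (use F G in auto)
  show "F \<otimes>\<^bsub>coha_pt\<^esub> G \<in> carrier coha_pt"
    by (rule coha_pt_closed[OF F G])
  show "tY (F \<otimes>\<^bsub>coha_pt\<^esub> G) = conv (tY F) (tY G)"
  proof (intro ext)
    fix A B
    show "tY (F \<otimes>\<^bsub>coha_pt\<^esub> G) A B = conv (tY F) (tY G) A B"
    proof (cases "A = {} \<and> finite B")
      case True
      then show ?thesis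
        by (auto simp: tY_def conv_def sval_pt_mult[OF F G] shuffle_kernel_def finite_subset intro!: sum.cong)
    next
      case False
      then have "conv (tY F) (tY G) A B = 0"
        by (cases "finite A \<and> finite B")
          (simp add: conv_infinite, auto simp: conv_def tY_def intro!: sum.neutral split: if_splits)
      with False show ?thesis by (auto simp: tY_def)
    qed
  qed
next
  fix F and p :: nat assume "F \<in> carrier coha_pt"
  show "tY (parity_part coha_pt p F) = homog p (tY F)"
    by (intro ext) (auto simp: tY_def homog_def coha_pt_def parity_pt)
qed (auto intro!: ext coha_pt_closed simp del: carrier_coha simp: finitary_def conv_unit_def tY_def coha_pt_def lookup_add lookup_one lookup_single when_def)

text \<open>Lagrange interpolation of \<open>\<Prod>a\<in>A. (a - t)\<close> at the points of \<open>B\<close>, evaluated at \<open>x\<close>.\<close>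

lemma sum_shuffle_kernel_singleton:
  assumes A: "finite A" and B: "finite B" "card B = Suc (card A)" and x: "x \<notin> A"
  shows "(\<Sum>b\<in>B. shuffle_kernel {x} {b} A (B - {b})) = 1"
proof -
  define lin :: "rat \<Rightarrow> rat poly" where "lin a = [:a, - 1:]" for a
  have poly_lin: "poly (\<Prod>a\<in>C. lin a) t = dprod {t} C" for C t
    by (simp add: lin_def poly_prod dprod_def)
  have deg: "degree (\<Prod>a\<in>C. lin a) \<le> card C" if "finite C" for C
    using degree_prod_sum_le[OF that, of lin] by (simp add: lin_def)
  \<comment> \<open>The Lagrange interpolant at the points of \<open>B\<close>. Since
    \<open>card B = Suc (card A)\<close>, it reproduces the product over \<open>A\<close>
    exactly.\<close>
  define q where "q = (\<Sum>b\<in>B. smult (dprod {b} A / dprod {b} (B - {b})) (\<Prod>a\<in>B - {b}. lin a))"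
  have "(\<Prod>a\<in>A. lin a) = q"
  proof (rule poly_eqI_degree[of B])
    fix b0 assume b0: "b0 \<in> B"
    have "poly q b0 = (\<Sum>b\<in>B. if b = b0 then dprod {b0} A else 0)"
      unfolding q_def poly_sum poly_smult poly_lin
    proof (intro sum.cong refl)
      fix b assume b: "b \<in> B"
      show "dprod {b} A / dprod {b} (B - {b}) * dprod {b0} (B - {b}) = (if b = b0 then dprod {b0} A else 0)"
        using b b0 B(1) dprod_eq_0_iff[of "{b0}" "B - {b}"] by auto
    qed
    also have "\<dots> = dprod {b0} A" using B(1) b0 by simp
    finally show "poly (\<Prod>a\<in>A. lin a) b0 = poly q b0" by (simp add: poly_lin)
  next
    show "degree (\<Prod>a\<in>A. lin a) < card B" using deg[OF A] B(2) by simp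
    have "degree q \<le> card A"
      unfolding q_def
    proof (rule degree_sum_le[OF B(1)])
      fix b assume "b \<in> B"
      with deg[of "B - {b}"] B have "degree (\<Prod>a\<in>B - {b}. lin a) \<le> card A" by simp
      then show "degree (smult (dprod {b} A / dprod {b} (B - {b})) (\<Prod>a\<in>B - {b}. lin a)) \<le> card A"
        using degree_smult_le le_trans by blast
    qed
    then show "degree q < card B" using B(2) by simp
  qed
  then have "dprod {x} A = poly q x" by (metis poly_lin)
  also have "\<dots> = (\<Sum>b\<in>B. dprod {x} A * shuffle_kernel {x} {b} A (B - {b}))"
    unfolding q_def poly_sum poly_smult poly_lin
    by (intro sum.cong refl) (use dprod_eq_0_iff[of "{x}" A] A x in \<open>auto simp: shuffle_kernel_def\<close>)
  finally have "dprod {x} A * (\<Sum>b\<in>B. shuffle_kernel {x} {b} A (B - {b})) = dprod {x} A"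
    by (simp add: sum_distrib_left)
  moreover have "dprod {x} A \<noteq> 0" using dprod_eq_0_iff[of "{x}" A] A x by simp
  ultimately show ?thesis by simp
qed

text \<open>This identity makes \<open>tJ\<close> multiplicative. The induction peels off a point
  \<open>x\<close> with a partner \<open>b\<close>: the singleton case is applied once inside
  \<open>B1\<close> to introduce \<open>b\<close>, and once in all of \<open>B\<close> to sum it out
  again.\<close>

lemma sum_shuffle_kernel:
  assumes "finite A1" "finite A2" "finite B" "A1 \<inter> A2 = {}" "card B = card A1 + card A2"
  shows "(\<Sum>B1 | B1 \<subseteq> B \<and> card B1 = card A1. shuffle_kernel A1 B1 A2 (B - B1)) = 1"
  using assms
proof (induction A1 arbitrary: B rule: finite_induct)
  case empty
  then have "{B1. B1 \<subseteq> B \<and> card B1 = card ({} :: rat set)} = {{}}"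
    by (auto simp: finite_subset dest: finite_subset[of _ B])
  then show ?case by simp
next
  case (insert x A1)
  let ?P = "{B1. B1 \<subseteq> B \<and> card B1 = card (insert x A1)}"
  let ?Q = "\<lambda>b. {B1. B1 \<subseteq> B - {b} \<and> card B1 = card A1}"
  let ?t = "\<lambda>b B1. shuffle_kernel {x} {b} (A1 \<union> A2) (B - {b}) * shuffle_kernel A1 B1 A2 (B - {b} - B1)"
  have fin: "finite B1" if "B1 \<subseteq> B" for B1 using that insert.prems(2) finite_subset by blast
  have finP: "finite ?P" by (rule finite_subset[of _ "Pow B"]) (use insert.prems(2) in auto)
  have finQ: "finite (?Q b)" for b by (rule finite_subset[of _ "Pow B"]) (use insert.prems(2) in auto)
  have "(\<Sum>B1\<in>?P. shuffle_kernel (insert x A1) B1 A2 (B - B1)) =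
    (\<Sum>B1\<in>?P. \<Sum>b\<in>B1. ?t b (B1 - {b}))"
  proof (intro sum.cong refl)
    fix B1 assume B1: "B1 \<in> ?P"
    then have fB: "finite B1" using fin by auto
    \<comment> \<open>Insert 1, expanded over the partner of \<open>x\<close> in \<open>B1\<close>,
      so that the cocycle identity can split off the pair.\<close>
    have "shuffle_kernel (insert x A1) B1 A2 (B - B1) =
      (\<Sum>b\<in>B1. shuffle_kernel {x} {b} A1 (B1 - {b})) * shuffle_kernel (insert x A1) B1 A2 (B - B1)"
      using B1 insert.hyps fB by (subst sum_shuffle_kernel_singleton) auto
    also have "\<dots> = (\<Sum>b\<in>B1. ?t b (B1 - {b}))"
      unfolding sum_distrib_right
    proof (intro sum.cong refl)
      fix b assume b: "b \<in> B1"
      have *: "{b} \<union> (B1 - {b}) = B1" "(B1 - {b}) \<union> (B - B1) = B - {b}" "B - {b} - (B1 - {b}) = B - B1"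
        using b B1 by auto
      have "shuffle_kernel {x} {b} A1 (B1 - {b}) * shuffle_kernel ({x} \<union> A1) ({b} \<union> (B1 - {b})) A2 (B - B1) =
        shuffle_kernel A1 (B1 - {b}) A2 (B - B1) *
        shuffle_kernel {x} {b} (A1 \<union> A2) ((B1 - {b}) \<union> (B - B1))"
        by (rule shuffle_kernel_cocycle) (use insert fB in auto)
      then show "shuffle_kernel {x} {b} A1 (B1 - {b}) * shuffle_kernel (insert x A1) B1 A2 (B - B1) =
          ?t b (B1 - {b})"
        unfolding * by (simp add: mult.commute)
    qed
    finally show "shuffle_kernel (insert x A1) B1 A2 (B - B1) = (\<Sum>b\<in>B1. ?t b (B1 - {b}))" .
  qed
  also have "\<dots> = (\<Sum>(B1, b)\<in>Sigma ?P (\<lambda>B1. B1). ?t b (B1 - {b}))"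
    by (rule sum.Sigma) (use finP fin in auto)
  \<comment> \<open>Choose the partner \<open>b\<close> first and the rest of \<open>B1\<close>
    afterwards; the induction hypothesis then applies in \<open>B - {b}\<close>.\<close>
  also have "\<dots> = (\<Sum>(b, B1)\<in>Sigma B ?Q. ?t b B1)"
  proof (rule sum.reindex_bij_witness[where i = "\<lambda>(b, B1). (insert b B1, b)" and j = "\<lambda>(B1, b). (b, B1 - {b})"])
    fix p assume "p \<in> Sigma ?P (\<lambda>B1. B1)"
    then show "(case case p of (B1, b) \<Rightarrow> (b, B1 - {b}) of (b, B1) \<Rightarrow> (insert b B1, b)) = p"
      "(case p of (B1, b) \<Rightarrow> (b, B1 - {b})) \<in> Sigma B ?Q"
      using insert.hyps fin by (auto simp: insert_absorb)
    show "(case case p of (B1, b) \<Rightarrow> (b, B1 - {b}) of (b, B1) \<Rightarrow> ?t b B1) = (case p of (B1, b) \<Rightarrow> ?t b (B1 - {b}))"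
      by (simp add: case_prod_unfold)
  next
    fix p assume p: "p \<in> Sigma B ?Q"
    obtain b B1 where [simp]: "p = (b, B1)" by (cases p)
    from p have *: "b \<in> B" "B1 \<subseteq> B - {b}" "card B1 = card A1" by auto
    then have "b \<notin> B1" "finite B1" using fin by auto
    with * show "(case case p of (b, B1) \<Rightarrow> (insert b B1, b) of (B1, b) \<Rightarrow> (b, B1 - {b})) = p"
      "(case p of (b, B1) \<Rightarrow> (insert b B1, b)) \<in> Sigma ?P (\<lambda>B1. B1)"
      using insert.hyps by auto
  qed
  also have "\<dots> = (\<Sum>b\<in>B. \<Sum>B1\<in>?Q b. ?t b B1)"
    by (rule sum.Sigma[symmetric]) (use insert.prems(2) finQ in auto)
  also have "\<dots> = (\<Sum>b\<in>B. shuffle_kernel {x} {b} (A1 \<union> A2) (B - {b}))"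
  proof (intro sum.cong refl)
    fix b assume "b \<in> B"
    then have "(\<Sum>B1\<in>?Q b. shuffle_kernel A1 B1 A2 (B - {b} - B1)) = 1"
      using insert by (intro insert.IH) auto
    then show "(\<Sum>B1\<in>?Q b. ?t b B1) = shuffle_kernel {x} {b} (A1 \<union> A2) (B - {b})"
      by (simp add: sum_distrib_left[symmetric])
  qed
  also have "\<dots> = 1"
    using insert by (intro sum_shuffle_kernel_singleton) (auto simp: card_Un_disjoint)
  finally show ?case .
qed

text \<open>For a fixed \<open>A1\<close> the values do not depend on which \<open>B1\<close> of the
  same size is taken, and the kernels of these \<open>B1\<close> add up to 1. What remains is the
  product of \<open>coha_J\<close>, which has no kernel.\<close>

lemma model_J: "model coha_J tJ"
proof
  fix F G assume F: "F \<in> carrier coha_J" and G: "G \<in> carrier coha_J"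
  show "F = G" if eq: "tJ F = tJ G"
  proof (rule graded_sym_inject)
    fix A :: "rat set" assume "finite A"
    with fun_cong[OF fun_cong[OF eq, of A], of A]
    show "sval (lookup F (card A)) A = sval (lookup G (card A)) A"
      by (simp add: tJ_def)
  qed (use F G in auto)
  show "F \<otimes>\<^bsub>coha_J\<^esub> G \<in> carrier coha_J"
    by (rule coha_J_closed[OF F G])
  show "tJ (F \<otimes>\<^bsub>coha_J\<^esub> G) = conv (tJ F) (tJ G)"
  proof (intro ext)
    fix A B
    show "tJ (F \<otimes>\<^bsub>coha_J\<^esub> G) A B = conv (tJ F) (tJ G) A B"
    proof (cases "finite A \<and> finite B")
      case True
      then have fin: "finite C" if "C \<subseteq> A \<or> C \<subseteq> B" for C using that finite_subset by blast
      let ?f = "\<lambda>A1. sval (lookup F (card A1)) A1"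
      let ?g = "\<lambda>A1. sval (lookup G (card A1)) A1"
      show ?thesis
      proof (cases "card A = card B")
        case eq: True
        have "conv (tJ F) (tJ G) A B = (\<Sum>A1\<in>Pow A. ?f A1 * ?g (A - A1) *
          (\<Sum>B1\<in>Pow B. if card B1 = card A1 then shuffle_kernel A1 B1 (A - A1) (B - B1) else 0))"
          unfolding conv_def sum_distrib_left
          by (intro sum.cong refl) (use True eq fin in \<open>auto simp: tJ_def card_Diff_subset\<close>)
        also have "\<dots> = (\<Sum>A1\<in>Pow A. ?f A1 * ?g (A - A1) *
          (\<Sum>B1 | B1 \<subseteq> B \<and> card B1 = card A1. shuffle_kernel A1 B1 (A - A1) (B - B1)))"
          using True by (simp add: sum.inter_filter[symmetric])
        also have "\<dots> = (\<Sum>A1\<in>Pow A. ?f A1 * ?g (A - A1) * 1)"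
        proof (intro sum.cong refl arg_cong2[of _ _ _ _ "(*)"] sum_shuffle_kernel)
          fix A1 assume "A1 \<in> Pow A"
          then show "card B = card A1 + card (A - A1)"
            using True eq card_Diff_subset[of A1 A] card_mono[of A A1] fin[of A1] by simp
        qed (use True fin in auto)
        finally show ?thesis using True eq sval_J_mult[OF F G, of A] by (simp add: tJ_def)
      next
        case neq: False
        have "tJ F A1 B1 * tJ G (A - A1) (B - B1) = 0" if "A1 \<subseteq> A" "B1 \<subseteq> B" for A1 B1
        proof -
          have "card A = card A1 + card (A - A1)" "card B = card B1 + card (B - B1)"
            using that True fin by (auto simp: card_Diff_subset card_mono)
          with neq show ?thesis by (auto simp: tJ_def)
        qed
        then have "conv (tJ F) (tJ G) A B = 0" unfolding conv_def by (intro sum.neutral ballI) simp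
        with neq show ?thesis by (simp add: tJ_def)
      qed
    qed (auto simp: conv_infinite tJ_def)
  qed
next
  fix F and p :: nat assume "F \<in> carrier coha_J"
  show "tJ (parity_part coha_J p F) = homog p (tJ F)"
    by (intro ext) (auto simp: tJ_def homog_def coha_J_def)
qed (auto intro!: ext coha_J_closed simp del: carrier_coha simp: finitary_def conv_unit_def tJ_def coha_J_def lookup_add lookup_one lookup_single when_def)

section \<open>Embeddings of the three factors into the two-vertex algebra\<close>

definition psi0 :: "(nat \<Rightarrow>\<^sub>0 nat mpoly) \<Rightarrow> (nat \<times> nat \<Rightarrow>\<^sub>0 xy mpoly)" where
  "psi0 G = (\<Sum>k\<in>keys G. single (k, k) (relabel Xv (lookup G k)))"

lemma lookup_psi0: "lookup (psi0 G) (m, n) = (if m = n then relabel Xv (lookup G m) else 0)"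
  by (auto simp: psi0_def lookup_sum lookup_single when_def sum.delta' in_keys_iff intro!: sum.neutral)

lemma lookup_incl:
  "lookup (incl_X F) (m, n) = (if n = 0 then relabel Xv (lookup F m) else 0)"
  "lookup (incl_Y F) (m, n) = (if m = 0 then relabel Yv (lookup F n) else 0)"
  by (auto simp: incl_X_def incl_Y_def lookup_sum lookup_single when_def sum.delta' in_keys_iff)

lemma tA_incl: "tA (incl_X F) = tX F" "tA (incl_Y F) = tY F" "tA (psi0 G) = tJ G"
  by (intro ext; auto simp: tA_def tX_def tY_def tJ_def lookup_incl lookup_psi0)+

lemma incl_closed:
  "F \<in> carrier coha_pt \<Longrightarrow> incl_X F \<in> carrier coha_A1"
  "F \<in> carrier coha_pt \<Longrightarrow> incl_Y F \<in> carrier coha_A1"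
  "G \<in> carrier coha_J \<Longrightarrow> psi0 G \<in> carrier coha_A1"
  by (auto simp: lookup_incl lookup_psi0 relabel_Xv_bisym relabel_Yv_bisym)

section \<open>The homomorphism \<open>\<Psi>\<^sup>0\<close>\<close>

text \<open>If \<open>card A = length js\<close>, the full symmetrization of one monomial, with
  orderings counted separately even when exponents repeat. This is the value of a product of
  \<open>phi j\<close>.\<close>

definition monomial_sum :: "nat list \<Rightarrow> rat set \<Rightarrow> rat" where
  "monomial_sum js A = (\<Sum>xs\<in>permutations_of_set A. \<Prod>t<length js. (xs ! t) ^ (js ! t))"

lemma monomial_sum_Nil [simp]: "monomial_sum [] {} = 1"
  by (simp add: monomial_sum_def)

lemma monomial_sum_Cons:
  assumes "finite A" "A \<noteq> {}"
  shows "monomial_sum (j # js) A = (\<Sum>a\<in>A. a ^ j * monomial_sum js (A - {a}))"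
proof -
  have "monomial_sum (j # js) A = (\<Sum>a\<in>A. \<Sum>ys\<in>(#) a ` permutations_of_set (A - {a}).
      \<Prod>t<length (j # js). (ys ! t) ^ ((j # js) ! t))"
    unfolding monomial_sum_def permutations_of_set_nonempty[OF assms(2)]
    by (rule sum.UNION_disjoint) (use assms(1) in auto)
  also have "\<dots> = (\<Sum>a\<in>A. a ^ j * monomial_sum js (A - {a}))"
  proof (rule sum.cong[OF refl])
    fix a assume "a \<in> A"
    show "(\<Sum>ys\<in>(#) a ` permutations_of_set (A - {a}). \<Prod>t<length (j # js). (ys ! t) ^ ((j # js) ! t)) =
      a ^ j * monomial_sum js (A - {a})"
      unfolding monomial_sum_def sum_distrib_left
      by (subst sum.reindex) (auto simp: prod.lessThan_Suc_shift simp del: prod.lessThan_Suc)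
  qed
  finally show ?thesis .
qed

primrec phi_prod :: "nat list \<Rightarrow> (nat \<Rightarrow>\<^sub>0 nat mpoly)" where
  "phi_prod [] = \<one>\<^bsub>coha_J\<^esub>"
| "phi_prod (j # js) = phi j \<otimes>\<^bsub>coha_J\<^esub> phi_prod js"

lemma phi_closed: "phi j \<in> carrier coha_J"
proof -
  have "relabel \<pi> (mvar 1 ^ j) = mvar 1 ^ j" if "\<pi> permutes {1..1}" for \<pi> :: "nat \<Rightarrow> nat"
    using permutes_in_image[OF that, of 1] by simp
  moreover have "vars (mvar (1::nat) ^ j) \<subseteq> {1..1}"
    unfolding vars_subset_iff by simp
  ultimately have "mvar 1 ^ j \<in> sym_polys 1" by (simp add: sym_polys_def)
  then show ?thesis by (simp add: phi_def lookup_single when_def)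
qed

lemma phi_prod_closed: "phi_prod js \<in> carrier coha_J"
proof (induction js)
  case (Cons j js)
  show ?case unfolding phi_prod.simps by (rule coha_J_closed(2)[OF phi_closed Cons.IH])
qed (simp add: model.one_closed[OF model_J] del: carrier_coha)

lemma sval_phi:
  "sval (lookup (phi j) (card {a})) {a} = a ^ j"
  "card A \<noteq> 1 \<Longrightarrow> sval (lookup (phi j) (card A)) A = 0"
  by (simp_all add: phi_def lookup_single when_def sval_def enum_def)

lemma sval_phi_prod:
  assumes "finite A"
  shows "sval (lookup (phi_prod js) (card A)) A =
    (if card A = length js then monomial_sum js A else 0)"
  using assms
proof (induction js arbitrary: A)
  case Nil
  then show ?case by (auto simp: coha_J_def lookup_one when_def)
next
  case (Cons j js)
  have "sval (lookup (phi_prod (j # js)) (card A)) A =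
    (\<Sum>A1\<in>Pow A. sval (lookup (phi j) (card A1)) A1 *
      sval (lookup (phi_prod js) (card (A - A1))) (A - A1))"
    using sval_J_mult[OF phi_closed phi_prod_closed Cons.prems] by simp
  also have "\<dots> = (\<Sum>A1\<in>(\<lambda>a. {a}) ` A. sval (lookup (phi j) (card A1)) A1 *
      sval (lookup (phi_prod js) (card (A - A1))) (A - A1))"
  proof (rule sum.mono_neutral_right)
    show "\<forall>A1\<in>Pow A - (\<lambda>a. {a}) ` A. sval (lookup (phi j) (card A1)) A1 *
      sval (lookup (phi_prod js) (card (A - A1))) (A - A1) = 0"
    proof
      fix A1 assume "A1 \<in> Pow A - (\<lambda>a. {a}) ` A"
      then have "card A1 \<noteq> 1" by (auto simp: card_1_singleton_iff)
      then show "sval (lookup (phi j) (card A1)) A1 *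
        sval (lookup (phi_prod js) (card (A - A1))) (A - A1) = 0"
        by (simp add: sval_phi(2))
    qed
  qed (use Cons.prems in auto)
  also have "\<dots> = (\<Sum>a\<in>A. a ^ j * sval (lookup (phi_prod js) (card (A - {a}))) (A - {a}))"
    by (subst sum.reindex) (auto simp: sval_phi(1) simp del: card_insert_disjoint)
  also have "\<dots> = (\<Sum>a\<in>A. a ^ j * (if card (A - {a}) = length js then monomial_sum js (A - {a}) else 0))"
    by (simp only: Cons.IH[OF finite_Diff[OF Cons.prems]])
  also have "\<dots> = (if card A = length (j # js) then monomial_sum (j # js) A else 0)"
  proof (cases "card A = length (j # js)")
    case True
    then have "A \<noteq> {}" by auto
    with True Cons.prems show ?thesis by (simp add: monomial_sum_Cons)
  next
    case False
    have "card (A - {a}) \<noteq> length js" if "a \<in> A" for a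
      using False that Cons.prems card_gt_0_iff[of A] by auto
    with False show ?thesis by simp
  qed
  finally show ?case .
qed

definition exponents :: "nat \<Rightarrow> (nat \<Rightarrow>\<^sub>0 nat) \<Rightarrow> nat list" where
  "exponents k m = map (\<lambda>t. lookup m (Suc t)) [0..<k]"

lemma length_exponents [simp]: "length (exponents k m) = k"
  by (simp add: exponents_def)

lemma permutations_of_set_bij:
  assumes "xs \<in> permutations_of_set A"
  shows "bij_betw (\<lambda>i. xs ! (i - 1)) {1..card A} A"
proof -
  have "bij_betw ((!) xs) {..<card A} A"
    using bij_betw_nth[of xs] assms length_finite_permutations_of_set[OF assms]
    by (auto simp: permutations_of_set_def)
  moreover have "bij_betw (\<lambda>i. i - 1) {1..card A} {..<card A}"
    by (rule bij_betwI[where g = Suc]) auto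
  ultimately have "bij_betw ((!) xs \<circ> (\<lambda>i. i - 1)) {1..card A} A" by (rule bij_betw_trans[rotated])
  then show ?thesis by (simp add: comp_def)
qed

lemma power_prod_exponents:
  assumes "keys m \<subseteq> {1..k}"
  shows "evl.power_prod (\<lambda>i. xs ! (i - 1)) m = (\<Prod>t<length (exponents k m). (xs ! t) ^ (exponents k m ! t))"
proof -
  have "evl.power_prod (\<lambda>i. xs ! (i - 1)) m = (\<Prod>v\<in>{1..k}. (xs ! (v - 1)) ^ lookup m v)"
    using assms by (intro evl.power_prod_superset) auto
  also have "\<dots> = (\<Prod>t<k. (xs ! t) ^ lookup m (Suc t))"
    by (rule prod.reindex_bij_witness[where i = Suc and j = "\<lambda>v. v - 1"]) auto
  finally show ?thesis by (simp add: exponents_def)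
qed

text \<open>Sum over all orderings of \<open>A\<close>: by symmetry each gives the same value of
  \<open>f\<close>, while monomial by monomial the sum is a symmetrization.\<close>

lemma sval_monomial_sum:
  assumes "f \<in> sym_polys (card A)" "finite A"
  shows "fact (card A) * sval f A =
    (\<Sum>m\<in>keys f. lookup f m * monomial_sum (exponents (card A) m) A)"
proof -
  have "fact (card A) * sval f A = (\<Sum>xs\<in>permutations_of_set A. sval f A)"
    using assms(2) by (simp add: card_permutations_of_set)
  also have "\<dots> = (\<Sum>xs\<in>permutations_of_set A. eval (\<lambda>i. xs ! (i - 1)) f)"
    by (intro sum.cong refl sval_eqI[OF assms(1) permutations_of_set_bij, symmetric])
  also have "\<dots> = (\<Sum>m\<in>keys f. \<Sum>xs\<in>permutations_of_set A.
      lookup f m * evl.power_prod (\<lambda>i. xs ! (i - 1)) m)"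
    unfolding evl.subst_def by (rule sum.swap)
  also have "\<dots> = (\<Sum>m\<in>keys f. lookup f m * monomial_sum (exponents (card A) m) A)"
    unfolding monomial_sum_def sum_distrib_left
  proof (intro sum.cong refl arg_cong2[of _ _ _ _ "(*)"] power_prod_exponents)
    fix m assume "m \<in> keys f"
    then show "keys m \<subseteq> {1..card A}"
      using assms(1) by (auto simp: sym_polys_def vars_def)
  qed
  finally show ?thesis .
qed

lemma lookup_coha_J_smult [simp]:
  "lookup (c \<odot>\<^bsub>coha_J\<^esub> F) d = scale c (lookup F d)"
  by (simp add: coha_J_def)

text \<open>The elements \<open>phi i\<close> generate the algebra, because a symmetric polynomial
  is a combination of symmetrized monomials. The uniqueness of \<open>Psi0\<close> rests on
  this.\<close>

lemma coha_J_induct [consumes 1, case_names zero phi_prod add smult]: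
  assumes G: "G \<in> carrier coha_J"
    and zero: "P \<zero>\<^bsub>coha_J\<^esub>" and phi_prod: "\<And>js. P (phi_prod js)"
    and add: "\<And>x y. x \<in> carrier coha_J \<Longrightarrow> y \<in> carrier coha_J \<Longrightarrow> P x \<Longrightarrow> P y \<Longrightarrow> P (x \<oplus>\<^bsub>coha_J\<^esub> y)"
    and smult: "\<And>c x. x \<in> carrier coha_J \<Longrightarrow> P x \<Longrightarrow> P (c \<odot>\<^bsub>coha_J\<^esub> x)"
  shows "P G"
proof -
  define S where "S = {x \<in> carrier coha_J. P x}"
  have sum: "sum h K \<in> S" if "\<And>k. k \<in> K \<Longrightarrow> h k \<in> S" for h :: "'x \<Rightarrow> _" and K
    using that
  proof (induction K rule: infinite_finite_induct)
    case (insert x K)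
    then have "h x \<in> S" "sum h K \<in> S" by auto
    then have "h x \<oplus>\<^bsub>coha_J\<^esub> sum h K \<in> S"
      using add coha_J_closed(1) by (auto simp: S_def simp del: carrier_coha)
    with insert.hyps show ?case by (simp add: coha_J_def)
  qed (use zero coha_J_closed(4)[OF G G] in \<open>auto simp: S_def coha_J_def simp del: carrier_coha\<close>)
  \<comment> \<open>Dividing by \<open>fact k\<close> undoes the number of orderings in
    \<open>sval_monomial_sum\<close>.\<close>
  let ?t = "\<lambda>k m. (lookup (lookup G k) m / fact k) \<odot>\<^bsub>coha_J\<^esub> phi_prod (exponents k m)"
  have "G = (\<Sum>k\<in>keys G. \<Sum>m\<in>keys (lookup G k). ?t k m)" (is "G = ?R")
  proof (rule graded_sym_inject)
    have "?R \<in> S"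
      by (intro sum) (use phi_prod phi_prod_closed smult coha_J_closed(3)[OF phi_prod_closed phi_prod_closed] in \<open>auto simp: S_def simp del: carrier_coha\<close>)
    then show "lookup ?R d \<in> sym_polys d" for d by (simp add: S_def)
    fix A :: "rat set" assume A: "finite A"
    have sval_sum: "sval (lookup (sum h K) d) A = (\<Sum>k\<in>K. sval (lookup (h k) d) A)"
      for h :: "'x \<Rightarrow> _" and K d
      by (simp add: lookup_sum sval_def)
    have "sval (lookup ?R (card A)) A = (\<Sum>k\<in>keys G.
        if k = card A then \<Sum>m\<in>keys (lookup G k).
          lookup (lookup G k) m / fact k * monomial_sum (exponents k m) A else 0)"
      unfolding sval_sum
      by (intro sum.cong refl) (auto simp: lookup_coha_J_smult sval_phi_prod[OF A] intro!: sum.cong sum.neutral)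
    also have "\<dots> = sval (lookup G (card A)) A"
    proof (cases "card A \<in> keys G")
      case True
      have "(\<Sum>m\<in>keys (lookup G (card A)).
          lookup (lookup G (card A)) m / fact (card A) * monomial_sum (exponents (card A) m) A) =
          (fact (card A) * sval (lookup G (card A)) A) / fact (card A)"
        using G A by (subst sval_monomial_sum) (auto simp: sum_divide_distrib)
      with True show ?thesis by (simp add: sum.delta)
    qed (simp add: in_keys_iff)
    finally show "sval (lookup G (card A)) A = sval (lookup ?R (card A)) A" ..
  qed (use G in auto)
  also have "\<dots> \<in> S"
    by (intro sum) (use phi_prod phi_prod_closed smult coha_J_closed(3)[OF phi_prod_closed phi_prod_closed] in \<open>auto simp: S_def simp del: carrier_coha\<close>)
  finally show ?thesis by (simp add: S_def)
qed

lemma coha_A1_diag_simps [simp]: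
  "F \<in> carrier coha_A1_diag \<longleftrightarrow> F \<in> carrier coha_A1 \<and> (\<forall>(m, n)\<in>keys F. m = n)"
  "x \<otimes>\<^bsub>coha_A1_diag\<^esub> y = x \<otimes>\<^bsub>coha_A1\<^esub> y" "x \<oplus>\<^bsub>coha_A1_diag\<^esub> y = x \<oplus>\<^bsub>coha_A1\<^esub> y"
  "c \<odot>\<^bsub>coha_A1_diag\<^esub> x = c \<odot>\<^bsub>coha_A1\<^esub> x" "\<one>\<^bsub>coha_A1_diag\<^esub> = \<one>\<^bsub>coha_A1\<^esub>"
  "\<zero>\<^bsub>coha_A1_diag\<^esub> = \<zero>\<^bsub>coha_A1\<^esub>"
  unfolding coha_A1_diag_def by (simp_all del: carrier_coha)

lemma psi0_hom: "restrict psi0 (carrier coha_J) \<in> algebra_homs coha_J coha_A1_diag"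
proof -
  interpret J: model coha_J tJ by (rule model_J)
  interpret A: model coha_A1 tA by (rule model_A1)
  note [simp del] = carrier_coha
  have 1: "psi0 G \<in> carrier coha_A1_diag" if "G \<in> carrier coha_J" for G
    using incl_closed(3)[OF that] by (auto simp: in_keys_iff lookup_psi0 split: if_splits)
  have 2: "psi0 (x \<otimes>\<^bsub>coha_J\<^esub> y) = psi0 x \<otimes>\<^bsub>coha_A1\<^esub> psi0 y"
    "psi0 (x \<oplus>\<^bsub>coha_J\<^esub> y) = psi0 x \<oplus>\<^bsub>coha_A1\<^esub> psi0 y"
    "psi0 (c \<odot>\<^bsub>coha_J\<^esub> x) = c \<odot>\<^bsub>coha_A1\<^esub> psi0 x"
    if "x \<in> carrier coha_J" "y \<in> carrier coha_J" for x y c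
    using that by (auto intro!: A.inj simp: incl_closed A.simps J.simps tA_incl)
  have 3: "psi0 \<one>\<^bsub>coha_J\<^esub> = \<one>\<^bsub>coha_A1\<^esub>"
    by (auto intro!: A.inj simp: incl_closed A.simps J.simps tA_incl)
  show ?thesis
    unfolding algebra_homs_def ring_hom_def linear_maps_def
    using 1 2 3 by auto
qed

lemma psi0_phi: "psi0 (phi i) = single (1, 1) (mvar (Xv 1) ^ i)"
proof (rule poly_mapping_eqI)
  fix d :: "nat \<times> nat"
  show "lookup (psi0 (phi i)) d = lookup (single (1, 1) (mvar (Xv 1) ^ i)) d"
    by (cases d) (auto simp: lookup_psi0 phi_def lookup_single when_def)
qed

lemma hom_coha_J_unique:
  assumes F: "F \<in> algebra_homs coha_J coha_A1_diag" and F': "F' \<in> algebra_homs coha_J coha_A1_diag"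
    and eq: "\<And>i. F (phi i) = F' (phi i)" and G: "G \<in> carrier coha_J"
  shows "F G = F' G"
proof -
  interpret J: model coha_J tJ by (rule model_J)
  interpret A: model coha_A1 tA by (rule model_A1)
  note [simp del] = carrier_coha
  have hom: "K (x \<otimes>\<^bsub>coha_J\<^esub> y) = K x \<otimes>\<^bsub>coha_A1\<^esub> K y" "K (x \<oplus>\<^bsub>coha_J\<^esub> y) = K x \<oplus>\<^bsub>coha_A1\<^esub> K y"
    "K (c \<odot>\<^bsub>coha_J\<^esub> x) = c \<odot>\<^bsub>coha_A1\<^esub> K x" "K \<one>\<^bsub>coha_J\<^esub> = \<one>\<^bsub>coha_A1\<^esub>" "K x \<in> carrier coha_A1"
    if "K \<in> algebra_homs coha_J coha_A1_diag" "x \<in> carrier coha_J" "y \<in> carrier coha_J" for K x y c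
    using that unfolding algebra_homs_def ring_hom_def linear_maps_def by auto
  have z: "\<zero>\<^bsub>coha_J\<^esub> = 0 \<odot>\<^bsub>coha_J\<^esub> \<one>\<^bsub>coha_J\<^esub>"
    by (rule J.inj) (simp_all add: J.simps)
  have one: "F \<one>\<^bsub>coha_J\<^esub> = F' \<one>\<^bsub>coha_J\<^esub>"
    using hom(4)[OF F, of "\<one>\<^bsub>coha_J\<^esub>" "\<one>\<^bsub>coha_J\<^esub>"] hom(4)[OF F', of "\<one>\<^bsub>coha_J\<^esub>" "\<one>\<^bsub>coha_J\<^esub>"] by simp
  show ?thesis
    using G
  proof (induction rule: coha_J_induct)
    case zero
    show ?case
      using hom(3)[OF F, of "\<one>\<^bsub>coha_J\<^esub>" "\<one>\<^bsub>coha_J\<^esub>" 0] hom(3)[OF F', of "\<one>\<^bsub>coha_J\<^esub>" "\<one>\<^bsub>coha_J\<^esub>" 0] one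
      by (simp add: z)
  next
    case (phi_prod js)
    show ?case
    proof (induction js)
      case (Cons j js)
      then show ?case
        using hom(1)[OF F phi_closed phi_prod_closed] hom(1)[OF F' phi_closed phi_prod_closed] eq by simp
    qed (simp add: one)
  next
    case (add x y)
    then show ?case using hom(2)[OF F] hom(2)[OF F'] by simp
  next
    case (smult c x)
    then show ?case using hom(3)[OF F] hom(3)[OF F'] by simp
  qed
qed

lemma Psi0_eq: "Psi0 = restrict psi0 (carrier coha_J)"
  unfolding Psi0_def
proof (rule the_equality)
  note [simp del] = carrier_coha
  show "restrict psi0 (carrier coha_J) \<in> algebra_homs coha_J coha_A1_diag \<and>
      restrict psi0 (carrier coha_J) \<in> extensional (carrier coha_J) \<and>
      (\<forall>i. restrict psi0 (carrier coha_J) (phi i) = single (1, 1) (mvar (Xv 1) ^ i))"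
    using psi0_hom phi_closed psi0_phi by simp
  fix F assume F: "F \<in> algebra_homs coha_J coha_A1_diag \<and> F \<in> extensional (carrier coha_J) \<and>
     (\<forall>i. F (phi i) = single (1, 1) (mvar (Xv 1) ^ i))"
  show "F = restrict psi0 (carrier coha_J)"
  proof (rule extensionalityI[of _ "carrier coha_J"])
    fix G assume G: "G \<in> carrier coha_J"
    have "F (phi i) = restrict psi0 (carrier coha_J) (phi i)" for i
      using F phi_closed psi0_phi by simp
    then show "F G = restrict psi0 (carrier coha_J) G"
      by (rule hom_coha_J_unique[OF conjunct1[OF F] psi0_hom _ G])
  next
    show "F \<in> extensional (carrier coha_J)" using F by (elim conjE)
    show "restrict psi0 (carrier coha_J) \<in> extensional (carrier coha_J)" by (rule restrict_extensional)
  qed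
qed

section \<open>Models of tensor products\<close>

definition lin :: "('k \<Rightarrow> rat) \<Rightarrow> ('k \<Rightarrow>\<^sub>0 rat) \<Rightarrow> rat" where
  "lin h u = (\<Sum>k\<in>keys u. lookup u k * h k)"

lemma lookup_scale [simp]: "lookup (scale c u) k = c * lookup u k"
  by (simp add: scale_def Poly_Mapping.map.rep_eq when_def)

lemma lin_0 [simp]: "lin h 0 = 0"
  and lin_single [simp]: "lin h (single k c) = c * h k"
  and lin_add [simp]: "lin h (u + v) = lin h u + lin h v"
proof -
  show "lin h (u + v) = lin h u + lin h v"
    unfolding lin_def by (rule setsum_keys_plus_distrib) (auto simp: algebra_simps)
qed (simp_all add: lin_def)

lemma lin_scale [simp]: "lin h (scale c u) = c * lin h u"
proof -
  have "keys (scale c u) \<subseteq> keys u" by (auto simp: in_keys_iff)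
  then have "lin h (scale c u) = (\<Sum>k\<in>keys u. lookup (scale c u) k * h k)"
    unfolding lin_def by (intro sum_keys_superset) auto
  then show ?thesis by (simp add: lin_def sum_distrib_left mult.assoc)
qed

lemma lin_uminus [simp]: "lin h (- u) = - lin h u"
  using lin_add[of h u "- u"] by simp

lemma lin_diff [simp]: "lin h (u - v) = lin h u - lin h v"
  using lin_add[of h u "- v"] by simp

lemma lin_sum [simp]: "lin h (sum f K) = (\<Sum>x\<in>K. lin h (f x))"
  by (induction K rule: infinite_finite_induct) auto

lemma conv_sum:
  "conv (\<lambda>C D. \<Sum>k\<in>K. c k * f k C D) \<Gamma> = (\<lambda>C D. \<Sum>k\<in>K. c k * conv (f k) \<Gamma> C D)"
  "conv \<Gamma> (\<lambda>C D. \<Sum>k\<in>K. c k * f k C D) = (\<lambda>C D. \<Sum>k\<in>K. c k * conv \<Gamma> (f k) C D)"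
  by (induction K rule: infinite_finite_induct; simp add: conv_add conv_scale)+

text \<open>By associativity only the two middle factors have to be exchanged, and
  \<open>conv_supercommute\<close> does so one parity at a time. The signs are those of
  \<open>koszul_mult\<close>.\<close>

lemma conv_koszul:
  "conv (conv \<Phi> \<Gamma>) (conv \<Phi>' \<Gamma>') C D = (\<Sum>p\<in>{0, 1}. \<Sum>q\<in>{0, 1}.
     (- 1) ^ (p * q) * conv (conv \<Phi> (homog q \<Phi>')) (conv (homog p \<Gamma>) \<Gamma>') C D)"
proof -
  have swap: "conv (homog 0 \<Gamma>) (homog 0 \<Phi>') = conv (homog 0 \<Phi>') (homog 0 \<Gamma>)"
    "conv (homog 0 \<Gamma>) (homog 1 \<Phi>') = conv (homog 1 \<Phi>') (homog 0 \<Gamma>)"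
    "conv (homog 1 \<Gamma>) (homog 0 \<Phi>') = conv (homog 0 \<Phi>') (homog 1 \<Gamma>)"
    "conv (homog 1 \<Gamma>) (homog 1 \<Phi>') = (\<lambda>A B. - 1 * conv (homog 1 \<Phi>') (homog 1 \<Gamma>) A B)"
    by (subst conv_supercommute, simp)+
  have "conv (conv \<Phi> \<Gamma>) (conv \<Phi>' \<Gamma>') = conv \<Phi> (conv (conv \<Gamma> \<Phi>') \<Gamma>')"
    by (simp add: conv_assoc)
  also have "conv \<Gamma> \<Phi>' = conv (\<lambda>A B. homog 0 \<Gamma> A B + homog 1 \<Gamma> A B) (\<lambda>A B. homog 0 \<Phi>' A B + homog 1 \<Phi>' A B)"
    by (simp only: homog_decompose[symmetric])
  also have "\<dots> = (\<lambda>A B. (conv (homog 0 \<Phi>') (homog 0 \<Gamma>) A B + conv (homog 1 \<Phi>') (homog 0 \<Gamma>) A B) +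
      (conv (homog 0 \<Phi>') (homog 1 \<Gamma>) A B + - 1 * conv (homog 1 \<Phi>') (homog 1 \<Gamma>) A B))"
    unfolding conv_add swap ..
  finally show ?thesis
    unfolding conv_add conv_scale by (simp add: conv_assoc)
qed

lemma bilinear_rels_uminus: "u \<in> bilinear_rels A B \<Longrightarrow> - u \<in> bilinear_rels A B"
proof -
  assume "u \<in> bilinear_rels A B"
  then have "scale (- 1) u \<in> bilinear_rels A B" by (rule bilinear_rels.scale)
  also have "scale (- 1) u = - u" by (rule poly_mapping_eqI) simp
  finally show ?thesis .
qed

lemma free_space_closed [simp]:
  "0 \<in> free_space A B"
  "u \<in> free_space A B \<Longrightarrow> v \<in> free_space A B \<Longrightarrow> u + v \<in> free_space A B"
  "u \<in> free_space A B \<Longrightarrow> v \<in> free_space A B \<Longrightarrow> u - v \<in> free_space A B"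
  "u \<in> free_space A B \<Longrightarrow> scale c u \<in> free_space A B"
  "a \<in> carrier A \<Longrightarrow> b \<in> carrier B \<Longrightarrow> single (a, b) c \<in> free_space A B"
proof -
  show "u \<in> free_space A B \<Longrightarrow> v \<in> free_space A B \<Longrightarrow> u + v \<in> free_space A B"
    using keys_add[of u v] by (auto simp: free_space_def)
  show "u \<in> free_space A B \<Longrightarrow> v \<in> free_space A B \<Longrightarrow> u - v \<in> free_space A B"
  proof -
    have "keys (u - v) \<subseteq> keys u \<union> keys v"
      by (auto simp: in_keys_iff lookup_minus)
    then show "u \<in> free_space A B \<Longrightarrow> v \<in> free_space A B \<Longrightarrow> u - v \<in> free_space A B"
      by (auto simp: free_space_def)
  qed
  show "u \<in> free_space A B \<Longrightarrow> scale c u \<in> free_space A B"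
    by (auto simp: free_space_def in_keys_iff)
qed (auto simp: free_space_def)

lemma free_space_sum: "(\<And>x. x \<in> K \<Longrightarrow> f x \<in> free_space A B) \<Longrightarrow> sum f K \<in> free_space A B"
  by (induction K rule: infinite_finite_induct) auto

definition linear_functional :: "('a, 'm) superalgebra_scheme \<Rightarrow> ('a \<Rightarrow> rat) \<Rightarrow> bool" where
  "linear_functional A s \<longleftrightarrow>
     (\<forall>x\<in>carrier A. \<forall>y\<in>carrier A. s (x \<oplus>\<^bsub>A\<^esub> y) = s x + s y) \<and>
     (\<forall>c. \<forall>x\<in>carrier A. s (c \<odot>\<^bsub>A\<^esub> x) = c * s x)"

locale two_models = A: model A \<alpha> + B: model B \<beta>
  for A :: "('a, 'm) superalgebra_scheme" and \<alpha> and B :: "('b, 'n) superalgebra_scheme" and \<beta>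
begin

definition img :: "('a \<times> 'b \<Rightarrow>\<^sub>0 rat) \<Rightarrow> setfun" where
  "img u C D = lin (\<lambda>(a, b). conv (\<alpha> a) (\<beta> b) C D) u"

lemma rels_free: "u \<in> bilinear_rels A B \<Longrightarrow> u \<in> free_space A B"
  by (induction rule: bilinear_rels.induct) auto

lemma img_rels: "u \<in> bilinear_rels A B \<Longrightarrow> img u C D = 0"
  by (induction rule: bilinear_rels.induct)
    (simp_all add: img_def A.simps B.simps conv_add conv_scale)

text \<open>
  If the bilinear pairings of \<open>u\<close> with the functionals \<open>s\<close> and \<open>t i\<close> vanish, then a relation between
  the left tensor factors allows one to shorten \<open>u\<close> modulo \<^const>\<open>bilinear_rels\<close>.
\<close>

context
  fixes I :: "'i set" and t :: "'i \<Rightarrow> 'b \<Rightarrow> rat" and S :: "'i \<Rightarrow> ('a \<Rightarrow> rat) set"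
  assumes t: "\<And>i. i \<in> I \<Longrightarrow> linear_functional B (t i)"
    and S: "\<And>i s. i \<in> I \<Longrightarrow> s \<in> S i \<Longrightarrow> linear_functional A s"
    and sepB: "\<And>b. b \<in> carrier B \<Longrightarrow> (\<And>i. i \<in> I \<Longrightarrow> t i b = 0) \<Longrightarrow> b = \<zero>\<^bsub>B\<^esub>"
    and sepA: "\<And>i a. i \<in> I \<Longrightarrow> a \<in> carrier A \<Longrightarrow> (\<And>s. s \<in> S i \<Longrightarrow> s a = 0) \<Longrightarrow> a = \<zero>\<^bsub>A\<^esub>"
begin

private abbreviation "R \<equiv> bilinear_rels A B"
private abbreviation "tens x y \<equiv> single (x, y) (1::rat)"
private definition "eqv u v \<longleftrightarrow> u - v \<in> R"

private lemma eqv_refl [simp]: "eqv u u" by (simp add: eqv_def bilinear_rels.zero)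

private lemma eqv_sym: "eqv u v \<Longrightarrow> eqv v u"
  using bilinear_rels_uminus[of "u - v"] by (simp add: eqv_def)

private lemma eqv_trans [trans]: "eqv u v \<Longrightarrow> eqv v w \<Longrightarrow> eqv u w"
  using bilinear_rels.add[of "u - v" A B "v - w"] by (simp add: eqv_def)

private lemma eqv_add: "eqv u v \<Longrightarrow> eqv u' v' \<Longrightarrow> eqv (u + u') (v + v')"
  using bilinear_rels.add[of "u - v" A B "u' - v'"] by (simp add: eqv_def algebra_simps)

private lemma eqv_add_left:
  "x \<in> carrier A \<Longrightarrow> x' \<in> carrier A \<Longrightarrow> y \<in> carrier B \<Longrightarrow> eqv (tens (x \<oplus>\<^bsub>A\<^esub> x') y) (tens x y + tens x' y)"
  using bilinear_rels.add_left[of x A x' y B] by (simp add: eqv_def algebra_simps)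

private lemma eqv_add_right:
  "x \<in> carrier A \<Longrightarrow> y \<in> carrier B \<Longrightarrow> y' \<in> carrier B \<Longrightarrow> eqv (tens x (y \<oplus>\<^bsub>B\<^esub> y')) (tens x y + tens x y')"
  using bilinear_rels.add_right[of x A y B y'] by (simp add: eqv_def algebra_simps)

private lemma eqv_scale_right:
  assumes "x \<in> carrier A" "y \<in> carrier B"
  shows "eqv (single (x, y) c) (tens x (c \<odot>\<^bsub>B\<^esub> y))"
proof (rule eqv_sym)
  show "eqv (tens x (c \<odot>\<^bsub>B\<^esub> y)) (single (x, y) c)"
    using bilinear_rels.scale_right[OF assms] by (simp add: eqv_def)
qed

private lemma eqv_scale_left:
  assumes "x \<in> carrier A" "y \<in> carrier B"
  shows "eqv (tens (c \<odot>\<^bsub>A\<^esub> x) y) (tens x (c \<odot>\<^bsub>B\<^esub> y))"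
proof -
  have "eqv (tens (c \<odot>\<^bsub>A\<^esub> x) y) (single (x, y) c)"
    using bilinear_rels.scale_left[OF assms] by (simp add: eqv_def)
  also have "eqv \<dots> (tens x (c \<odot>\<^bsub>B\<^esub> y))" by (rule eqv_scale_right[OF assms])
  finally show ?thesis .
qed

private lemma eqv_zero:
  assumes "x \<in> carrier A" "y \<in> carrier B"
  shows "eqv (tens x \<zero>\<^bsub>B\<^esub>) 0" "eqv (tens \<zero>\<^bsub>A\<^esub> y) 0"
proof -
  have "0 \<odot>\<^bsub>B\<^esub> \<zero>\<^bsub>B\<^esub> = \<zero>\<^bsub>B\<^esub>" by (rule B.inj) (simp_all add: B.simps)
  then show "eqv (tens x \<zero>\<^bsub>B\<^esub>) 0"
    using eqv_sym[OF eqv_scale_right[OF assms(1) B.zero_closed, of 0]] by simp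
  have "0 \<odot>\<^bsub>A\<^esub> \<zero>\<^bsub>A\<^esub> = \<zero>\<^bsub>A\<^esub>" by (rule A.inj) (simp_all add: A.simps)
  then show "eqv (tens \<zero>\<^bsub>A\<^esub> y) 0"
    using bilinear_rels.scale_left[OF A.zero_closed assms(2), of 0] by (simp add: eqv_def)
qed

private definition "lcomb \<mu> ps = foldr (\<lambda>p acc. (\<mu> p \<odot>\<^bsub>A\<^esub> fst p) \<oplus>\<^bsub>A\<^esub> acc) ps \<zero>\<^bsub>A\<^esub>"

private lemma lcomb_closed: "fst ` set ps \<subseteq> carrier A \<Longrightarrow> lcomb \<mu> ps \<in> carrier A"
  by (induction ps) (auto simp: lcomb_def)

private lemma functional_zero: "linear_functional A s \<Longrightarrow> s \<zero>\<^bsub>A\<^esub> = 0"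
proof -
  assume "linear_functional A s"
  then have "s (0 \<odot>\<^bsub>A\<^esub> \<zero>\<^bsub>A\<^esub>) = 0" by (simp add: linear_functional_def)
  moreover have "0 \<odot>\<^bsub>A\<^esub> \<zero>\<^bsub>A\<^esub> = \<zero>\<^bsub>A\<^esub>" by (rule A.inj) (simp_all add: A.simps)
  ultimately show ?thesis by simp
qed

private lemma functional_lcomb:
  assumes "linear_functional A s" "fst ` set ps \<subseteq> carrier A"
  shows "s (lcomb \<mu> ps) = (\<Sum>p\<leftarrow>ps. \<mu> p * s (fst p))"
  using assms(2)
proof (induction ps)
  case (Cons p ps)
  then have "lcomb \<mu> ps \<in> carrier A" by (intro lcomb_closed) simp
  with Cons assms(1) show ?case by (simp add: lcomb_def linear_functional_def)
qed (simp add: lcomb_def functional_zero[OF assms(1)])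

private lemma eqv_lcomb:
  assumes "fst ` set ps \<subseteq> carrier A" "y \<in> carrier B"
  shows "eqv (tens (lcomb \<mu> ps) y) (\<Sum>p\<leftarrow>ps. tens (fst p) (\<mu> p \<odot>\<^bsub>B\<^esub> y))"
  using assms(1)
proof (induction ps)
  case (Cons p ps)
  then have "lcomb \<mu> ps \<in> carrier A" by (intro lcomb_closed) simp
  with Cons.prems assms(2) have "eqv (tens (lcomb \<mu> (p # ps)) y) (tens (\<mu> p \<odot>\<^bsub>A\<^esub> fst p) y + tens (lcomb \<mu> ps) y)"
    by (simp add: lcomb_def eqv_add_left)
  also have "eqv \<dots> (tens (fst p) (\<mu> p \<odot>\<^bsub>B\<^esub> y) + (\<Sum>p\<leftarrow>ps. tens (fst p) (\<mu> p \<odot>\<^bsub>B\<^esub> y)))"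
  proof (rule eqv_add[OF eqv_scale_left])
    show "eqv (tens (lcomb \<mu> ps) y) (\<Sum>p\<leftarrow>ps. tens (fst p) (\<mu> p \<odot>\<^bsub>B\<^esub> y))"
      using Cons by simp
  qed (use Cons.prems assms(2) in auto)
  finally show ?case by simp
qed (use eqv_zero(2)[OF A.zero_closed assms(2)] in \<open>simp add: lcomb_def\<close>)

private lemma eqv_merge:
  assumes "set ps \<subseteq> carrier A \<times> carrier B" "y \<in> carrier B"
  shows "eqv ((\<Sum>p\<leftarrow>ps. tens (fst p) (snd p)) + (\<Sum>p\<leftarrow>ps. tens (fst p) (\<mu> p \<odot>\<^bsub>B\<^esub> y)))
    (\<Sum>p\<leftarrow>ps. tens (fst p) (snd p \<oplus>\<^bsub>B\<^esub> (\<mu> p \<odot>\<^bsub>B\<^esub> y)))"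
  using assms(1)
proof (induction ps)
  case (Cons p ps)
  then have "fst p \<in> carrier A" "snd p \<in> carrier B" by auto
  then have "eqv (tens (fst p) (snd p) + tens (fst p) (\<mu> p \<odot>\<^bsub>B\<^esub> y)) (tens (fst p) (snd p \<oplus>\<^bsub>B\<^esub> (\<mu> p \<odot>\<^bsub>B\<^esub> y)))"
    using assms(2) by (intro eqv_sym[OF eqv_add_right]) simp_all
  from eqv_add[OF this Cons.IH] Cons.prems show ?case by (simp add: add_ac)
qed simp

private lemma sum_tens_rels:
  assumes "set ps \<subseteq> carrier A \<times> carrier B"
    "\<And>i s. i \<in> I \<Longrightarrow> s \<in> S i \<Longrightarrow> (\<Sum>p\<leftarrow>ps. s (fst p) * t i (snd p)) = 0"
  shows "eqv (\<Sum>p\<leftarrow>ps. tens (fst p) (snd p)) 0"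
  using assms
proof (induction "length ps" arbitrary: ps)
  case (Suc n)
  then obtain x y qs where ps: "ps = (x, y) # qs" and len: "length qs = n"
    by (cases ps) auto
  have xy: "x \<in> carrier A" "y \<in> carrier B" and qs: "set qs \<subseteq> carrier A \<times> carrier B" "fst ` set qs \<subseteq> carrier A"
    using Suc.prems(1) by (auto simp: ps)
  show ?case
  proof (cases "y = \<zero>\<^bsub>B\<^esub>")
    case True
    have tz: "t i y = 0" if "i \<in> I" for i
    proof -
      have "t i (0 \<odot>\<^bsub>B\<^esub> \<zero>\<^bsub>B\<^esub>) = 0" using t[OF that] by (simp add: linear_functional_def)
      moreover have "0 \<odot>\<^bsub>B\<^esub> \<zero>\<^bsub>B\<^esub> = \<zero>\<^bsub>B\<^esub>" by (rule B.inj) (simp_all add: B.simps)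
      ultimately show ?thesis using True by simp
    qed
    have "eqv (\<Sum>p\<leftarrow>qs. tens (fst p) (snd p)) 0"
    proof (rule Suc.hyps(1))
      show "(\<Sum>p\<leftarrow>qs. s (fst p) * t i (snd p)) = 0" if "i \<in> I" "s \<in> S i" for i s
        using Suc.prems(2)[OF that] tz[OF that(1)] by (simp add: ps)
    qed (use len qs in auto)
    from eqv_add[OF eqv_zero(1)[OF xy] this] True show ?thesis by (simp add: ps)
  next
    case False
    then obtain i where i: "i \<in> I" "t i y \<noteq> 0" using sepB[OF xy(2)] by blast
    \<comment> \<open>For this \<open>i\<close> and every \<open>s\<close> in \<open>S i\<close> the
      vanishing pairing is a linear equation in \<open>s x\<close> with nonzero coefficient
      \<open>t i y\<close>. Solving it gives the coefficients of \<open>x\<close> in the remaining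
      left factors.\<close>
    define \<mu> where "\<mu> p = - t i (snd p) / t i y" for p :: "'a \<times> 'b"
    have lc: "lcomb \<mu> qs \<in> carrier A" by (rule lcomb_closed[OF qs(2)])
    have "x \<oplus>\<^bsub>A\<^esub> ((- 1) \<odot>\<^bsub>A\<^esub> lcomb \<mu> qs) = \<zero>\<^bsub>A\<^esub>"
    proof (rule sepA[OF i(1)])
      fix s assume s: "s \<in> S i"
      note ls = S[OF i(1) s]
      have "t i y * s (x \<oplus>\<^bsub>A\<^esub> ((- 1) \<odot>\<^bsub>A\<^esub> lcomb \<mu> qs)) = t i y * s x - (\<Sum>p\<leftarrow>qs. t i y * (\<mu> p * s (fst p)))"
        using ls lc xy by (simp add: linear_functional_def functional_lcomb[OF ls qs(2)] sum_list_const_mult right_diff_distrib)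
      also have "(\<lambda>p. t i y * (\<mu> p * s (fst p))) = (\<lambda>p. - (s (fst p) * t i (snd p)))"
        using i(2) by (simp add: \<mu>_def fun_eq_iff)
      also have "(\<Sum>p\<leftarrow>qs. - (s (fst p) * t i (snd p))) = - (\<Sum>p\<leftarrow>qs. s (fst p) * t i (snd p))"
        by (induction qs) simp_all
      also have "t i y * s x - - (\<Sum>p\<leftarrow>qs. s (fst p) * t i (snd p)) = 0"
        using Suc.prems(2)[OF i(1) s] by (simp add: ps mult.commute)
      finally show "s (x \<oplus>\<^bsub>A\<^esub> ((- 1) \<odot>\<^bsub>A\<^esub> lcomb \<mu> qs)) = 0" using i(2) by simp
    qed (use xy lc in simp)
    then have "\<alpha> (x \<oplus>\<^bsub>A\<^esub> ((- 1) \<odot>\<^bsub>A\<^esub> lcomb \<mu> qs)) = (\<lambda>C D. 0)" by (simp add: A.zero)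
    then have "\<alpha> x = \<alpha> (lcomb \<mu> qs)" using xy lc by (simp add: A.simps fun_eq_iff)
    then have x: "x = lcomb \<mu> qs" using A.inj xy lc by blast
    \<comment> \<open>Substituting the combination for \<open>x\<close> and collecting by left
      factor only adds multiples of \<open>y\<close> to the right factors.\<close>
    let ?qs' = "map (\<lambda>p. (fst p, snd p \<oplus>\<^bsub>B\<^esub> (\<mu> p \<odot>\<^bsub>B\<^esub> y))) qs"
    have "eqv (\<Sum>p\<leftarrow>ps. tens (fst p) (snd p))
      ((\<Sum>p\<leftarrow>qs. tens (fst p) (snd p)) + (\<Sum>p\<leftarrow>qs. tens (fst p) (\<mu> p \<odot>\<^bsub>B\<^esub> y)))"
      using eqv_add[OF eqv_lcomb[OF qs(2) xy(2), of \<mu>] eqv_refl[of "\<Sum>p\<leftarrow>qs. tens (fst p) (snd p)"]]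
      by (simp add: ps x[symmetric] add.commute)
    also have "eqv \<dots> (\<Sum>p\<leftarrow>?qs'. tens (fst p) (snd p))"
      using eqv_merge[OF qs(1) xy(2), of \<mu>] by (simp add: comp_def)
    also have "eqv \<dots> 0"
    proof (rule Suc.hyps(1))
      show "set ?qs' \<subseteq> carrier A \<times> carrier B" using qs(1) xy by auto
      fix j s assume j: "j \<in> I" and s: "s \<in> S j"
      \<comment> \<open>The hypothesis survives for every \<open>j\<close>, not only for the chosen
        \<open>i\<close>, because \<open>x\<close> equals the combination itself.\<close>
      have "(\<Sum>p\<leftarrow>?qs'. s (fst p) * t j (snd p)) =
        (\<Sum>p\<leftarrow>qs. s (fst p) * t j (snd p) + \<mu> p * s (fst p) * t j y)"
        unfolding map_map
      proof (intro arg_cong[where f = sum_list] map_cong refl)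
        fix p assume "p \<in> set qs"
        then have "fst p \<in> carrier A" "snd p \<in> carrier B" using qs(1) by auto
        then show "((\<lambda>p. s (fst p) * t j (snd p)) \<circ> (\<lambda>p. (fst p, snd p \<oplus>\<^bsub>B\<^esub> (\<mu> p \<odot>\<^bsub>B\<^esub> y)))) p =
            s (fst p) * t j (snd p) + \<mu> p * s (fst p) * t j y"
          using t[OF j] xy by (simp add: linear_functional_def algebra_simps)
      qed
      also have "\<dots> = (\<Sum>p\<leftarrow>qs. s (fst p) * t j (snd p)) + s x * t j y"
        unfolding x functional_lcomb[OF S[OF j s] qs(2)]
        by (simp add: sum_list_addf sum_list_mult_const)
      also have "\<dots> = 0" using Suc.prems(2)[OF j s] by (simp add: ps)
      finally show "(\<Sum>p\<leftarrow>?qs'. s (fst p) * t j (snd p)) = 0" .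
    qed (use len in simp)
    finally show ?thesis .
  qed
qed simp

text \<open>The functionals on the left factor may depend on the index of the one on the right. In
  both applications the left factor is evaluated only at sets disjoint from the one attached to
  \<open>i\<close>, and these still separate its elements.\<close>

lemma kernel_criterion:
  assumes u: "u \<in> free_space A B"
    and pair: "\<And>i s. i \<in> I \<Longrightarrow> s \<in> S i \<Longrightarrow> lin (\<lambda>(a, b). s a * t i b) u = 0"
  shows "u \<in> bilinear_rels A B"
proof -
  obtain ks where ks: "distinct ks" "set ks = keys u"
    using finite_distinct_list[of "keys u"] by auto
  have mem: "fst k \<in> carrier A" "snd k \<in> carrier B" if "k \<in> set ks" for k
    using u that ks(2) by (auto simp: free_space_def)
  let ?ps = "map (\<lambda>k. (fst k, lookup u k \<odot>\<^bsub>B\<^esub> snd k)) ks"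
  have u_eq: "u = (\<Sum>k\<leftarrow>ks. single k (lookup u k))"
    using poly_mapping_sum_single[of u] ks by (simp add: sum_list_distinct_conv_sum_set)
  have e: "eqv (\<Sum>k\<leftarrow>js. single k (lookup u k))
      (\<Sum>k\<leftarrow>js. tens (fst k) (lookup u k \<odot>\<^bsub>B\<^esub> snd k))" if "set js \<subseteq> set ks" for js
    using that
  proof (induction js)
    case (Cons k js)
    then show ?case using eqv_add[OF eqv_scale_right[of "fst k" "snd k" "lookup u k"]] mem by simp
  qed simp
  have "eqv u (\<Sum>p\<leftarrow>?ps. tens (fst p) (snd p))"
    using e[OF order_refl] unfolding u_eq[symmetric] by (simp add: comp_def)
  also have "eqv \<dots> 0"
  proof (rule sum_tens_rels)
    show "set ?ps \<subseteq> carrier A \<times> carrier B" using mem by auto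
    fix i s assume i: "i \<in> I" and s: "s \<in> S i"
    have "(\<Sum>p\<leftarrow>?ps. s (fst p) * t i (snd p)) = (\<Sum>k\<leftarrow>ks. lookup u k * (s (fst k) * t i (snd k)))"
      unfolding map_map
      by (intro arg_cong[where f = sum_list] map_cong refl)
        (use t[OF i] mem in \<open>simp add: linear_functional_def\<close>)
    also have "\<dots> = lin (\<lambda>(a, b). s a * t i b) u"
      using ks by (simp add: lin_def sum_list_distinct_conv_sum_set case_prod_unfold)
    finally show "(\<Sum>p\<leftarrow>?ps. s (fst p) * t i (snd p)) = 0" using pair[OF i s] by simp
  qed
  finally show ?thesis by (simp add: eqv_def)
qed

end

end

text \<open>With \<open>img_rels\<close>, cosets become exactly the fibres of \<open>img\<close> on
  the free space: operations on representatives are well defined, and the tensor product embeds into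
  functions.\<close>

locale tensor_model = two_models +
  assumes kernel: "u \<in> free_space A B \<Longrightarrow> (\<And>C D. img u C D = 0) \<Longrightarrow> u \<in> bilinear_rels A B"
begin

lemma tensor_class_eq:
  assumes u: "u \<in> free_space A B"
  shows "tensor_class A B u = {v \<in> free_space A B. img v = img u}"
proof (intro equalityI subsetI)
  fix v assume "v \<in> tensor_class A B u"
  then obtain n where n: "v = u + n" "n \<in> bilinear_rels A B" by (auto simp: tensor_class_def)
  have "img v C D = img u C D" for C D using img_rels[OF n(2)] by (simp add: img_def n(1))
  then show "v \<in> {v \<in> free_space A B. img v = img u}"
    using u rels_free[OF n(2)] by (auto simp: n(1))
next
  fix v assume "v \<in> {v \<in> free_space A B. img v = img u}"
  then have v: "v \<in> free_space A B" "img v = img u" by auto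
  then have "img (v - u) C D = 0" for C D by (simp add: img_def fun_eq_iff)
  then have "v - u \<in> bilinear_rels A B" using u v by (intro kernel) auto
  then show "v \<in> tensor_class A B u"
    unfolding tensor_class_def by (intro CollectI exI[of _ "v - u"]) simp
qed

definition timg :: "('a \<times> 'c \<Rightarrow>\<^sub>0 rat) set \<Rightarrow> setfun" where
  "timg U = img (SOME u. u \<in> U)"

lemma timg_class [simp]:
  assumes "u \<in> free_space A B"
  shows "timg (tensor_class A B u) = img u"
proof -
  have "u \<in> tensor_class A B u" using assms by (simp add: tensor_class_eq)
  then have "(SOME v. v \<in> tensor_class A B u) \<in> tensor_class A B u" by (rule someI)
  then show ?thesis using assms by (simp add: timg_def tensor_class_eq)
qed

text \<open>The unions in \<open>tensor_algebra\<close> run over all representatives; they collapse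
  to one coset once \<open>h\<close> respects \<open>img\<close>.\<close>

lemma union_classes2:
  assumes "u \<in> free_space A B" "v \<in> free_space A B" "h u v \<in> free_space A B"
    "\<And>u' v'. u' \<in> free_space A B \<Longrightarrow> v' \<in> free_space A B \<Longrightarrow> img u' = img u \<Longrightarrow> img v' = img v \<Longrightarrow>
      h u' v' \<in> free_space A B \<and> img (h u' v') = img (h u v)"
  shows "(\<Union>u'\<in>tensor_class A B u. \<Union>v'\<in>tensor_class A B v. tensor_class A B (h u' v')) = tensor_class A B (h u v)"
proof -
  have eq: "tensor_class A B (h u' v') = tensor_class A B (h u v)"
    if "u' \<in> tensor_class A B u" "v' \<in> tensor_class A B v" for u' v'
    using assms(4)[of u' v'] that assms(1-3) by (simp add: tensor_class_eq)
  have "u \<in> tensor_class A B u" "v \<in> tensor_class A B v" using assms(1,2) by (simp_all add: tensor_class_eq)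
  then show ?thesis using eq by blast
qed

lemma union_classes:
  assumes "u \<in> free_space A B" "h u \<in> free_space A B"
    "\<And>u'. u' \<in> free_space A B \<Longrightarrow> img u' = img u \<Longrightarrow> h u' \<in> free_space A B \<and> img (h u') = img (h u)"
  shows "(\<Union>u'\<in>tensor_class A B u. tensor_class A B (h u')) = tensor_class A B (h u)"
proof -
  have eq: "tensor_class A B (h u') = tensor_class A B (h u)" if "u' \<in> tensor_class A B u" for u'
    using assms(3)[of u'] that assms(1,2) by (simp add: tensor_class_eq)
  have "u \<in> tensor_class A B u" using assms(1) by (simp add: tensor_class_eq)
  then show ?thesis using eq by blast
qed

lemma img_add: "img (u + v) = (\<lambda>C D. img u C D + img v C D)"
  and img_scale: "img (scale c u) = (\<lambda>C D. c * img u C D)"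
  and img_zero: "img 0 = (\<lambda>C D. 0)"
  and img_single: "img (single (a, b) c) = (\<lambda>C D. c * conv (\<alpha> a) (\<beta> b) C D)"
  by (simp_all add: img_def fun_eq_iff)

lemma free_memD: "u \<in> free_space A B \<Longrightarrow> (a, b) \<in> keys u \<Longrightarrow> a \<in> carrier A \<and> b \<in> carrier B"
  by (auto simp: free_space_def)

lemma koszul_free:
  assumes "u \<in> free_space A B" "v \<in> free_space A B"
  shows "koszul_mult A B u v \<in> free_space A B"
  unfolding koszul_mult_def case_prod_unfold
  by (intro free_space_sum free_space_closed(5) A.mult_closed B.mult_closed A.parity_closed B.parity_closed)
    (use assms in \<open>auto simp: free_space_def\<close>)

lemma img_koszul:
  assumes u: "u \<in> free_space A B" and v: "v \<in> free_space A B"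
  shows "img (koszul_mult A B u v) = conv (img u) (img v)"
proof (intro ext)
  fix C D
  have "img (koszul_mult A B u v) C D =
    (\<Sum>k\<in>keys u. \<Sum>l\<in>keys v. \<Sum>p\<in>{0, 1}. \<Sum>q\<in>{0, 1}.
      (- 1) ^ (p * q) * lookup u k * lookup v l *
      conv (\<alpha> (fst k \<otimes>\<^bsub>A\<^esub> parity_part A q (fst l))) (\<beta> (parity_part B p (snd k) \<otimes>\<^bsub>B\<^esub> snd l)) C D)"
    unfolding img_def koszul_mult_def case_prod_unfold lin_sum lin_single by simp
  also have "\<dots> = (\<Sum>k\<in>keys u. \<Sum>l\<in>keys v. lookup u k * (lookup v l *
      conv (conv (\<alpha> (fst k)) (\<beta> (snd k))) (conv (\<alpha> (fst l)) (\<beta> (snd l))) C D))"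
  proof (intro sum.cong[OF refl])
    fix k l assume "k \<in> keys u" "l \<in> keys v"
    then have m: "fst k \<in> carrier A" "snd k \<in> carrier B" "fst l \<in> carrier A" "snd l \<in> carrier B"
      using u v by (auto simp: free_space_def)
    then show "(\<Sum>p\<in>{0, 1}. \<Sum>q\<in>{0, 1}. (- 1) ^ (p * q) * lookup u k * lookup v l *
      conv (\<alpha> (fst k \<otimes>\<^bsub>A\<^esub> parity_part A q (fst l))) (\<beta> (parity_part B p (snd k) \<otimes>\<^bsub>B\<^esub> snd l)) C D) =
      lookup u k * (lookup v l *
      conv (conv (\<alpha> (fst k)) (\<beta> (snd k))) (conv (\<alpha> (fst l)) (\<beta> (snd l))) C D)"
      by (subst conv_koszul) (simp add: A.simps B.simps algebra_simps)
  qed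
  also have "\<dots> = conv (img u) (img v) C D"
    unfolding img_def[abs_def] lin_def case_prod_unfold conv_sum sum_distrib_left ..
  finally show "img (koszul_mult A B u v) C D = conv (img u) (img v) C D" .
qed

lemma parity_free:
  assumes "u \<in> free_space A B"
  shows "free_parity_part A B p u \<in> free_space A B"
  unfolding free_parity_part_def case_prod_unfold
  by (intro free_space_sum free_space_closed(5) A.parity_closed B.parity_closed)
    (use assms in \<open>auto simp: free_space_def\<close>)

lemma img_parity:
  assumes u: "u \<in> free_space A B" and p: "p < 2"
  shows "img (free_parity_part A B p u) = homog p (img u)"
proof (intro ext)
  fix C D
  let ?S = "{(i, j). i \<in> {0, 1::nat} \<and> j \<in> {0, 1} \<and> (i + j) mod 2 = p}"
  have "img (free_parity_part A B p u) C D = (\<Sum>k\<in>keys u. \<Sum>e\<in>?S.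
      lookup u k * conv (\<alpha> (parity_part A (fst e) (fst k))) (\<beta> (parity_part B (snd e) (snd k))) C D)"
    unfolding img_def free_parity_part_def case_prod_unfold lin_sum lin_single by simp
  also have "\<dots> = (\<Sum>k\<in>keys u. lookup u k * homog p (conv (\<alpha> (fst k)) (\<beta> (snd k))) C D)"
    unfolding homog_conv[OF p] sum_distrib_left case_prod_unfold
  proof (intro sum.cong[OF refl])
    fix k e assume "k \<in> keys u" and e: "e \<in> {e. fst e \<in> {0, 1::nat} \<and> snd e \<in> {0, 1} \<and> (fst e + snd e) mod 2 = p}"
    then have m: "fst k \<in> carrier A" "snd k \<in> carrier B" using u by (auto simp: free_space_def)
    have "fst e < 2" "snd e < 2" using e by auto
    with m show "lookup u k * conv (\<alpha> (parity_part A (fst e) (fst k))) (\<beta> (parity_part B (snd e) (snd k))) C D =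
      lookup u k * conv (homog (fst e) (\<alpha> (fst k))) (homog (snd e) (\<beta> (snd k))) C D"
      by (simp add: A.parity B.parity)
  qed
  also have "\<dots> = homog p (img u) C D"
    by (simp add: homog_def img_def lin_def case_prod_unfold)
  finally show "img (free_parity_part A B p u) C D = homog p (img u) C D" .
qed

abbreviation (input) "T \<equiv> tensor_algebra A B"

lemma carrier_T: "U \<in> carrier T \<longleftrightarrow> (\<exists>u\<in>free_space A B. U = tensor_class A B u)"
  by (auto simp: tensor_algebra_def)

lemma T_ops:
  assumes u: "u \<in> free_space A B" and v: "v \<in> free_space A B"
  shows "tensor_class A B u \<oplus>\<^bsub>T\<^esub> tensor_class A B v = tensor_class A B (u + v)"
    "tensor_class A B u \<otimes>\<^bsub>T\<^esub> tensor_class A B v = tensor_class A B (koszul_mult A B u v)"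
    "c \<odot>\<^bsub>T\<^esub> tensor_class A B u = tensor_class A B (scale c u)"
    "p < 2 \<Longrightarrow> parity_part T p (tensor_class A B u) = tensor_class A B (free_parity_part A B p u)"
    "\<zero>\<^bsub>T\<^esub> = tensor_class A B 0"
    "\<one>\<^bsub>T\<^esub> = tensor_class A B (single (\<one>\<^bsub>A\<^esub>, \<one>\<^bsub>B\<^esub>) 1)"
proof -
  show "tensor_class A B u \<oplus>\<^bsub>T\<^esub> tensor_class A B v = tensor_class A B (u + v)"
    using u v by (simp add: tensor_algebra_def) (rule union_classes2, auto simp: img_add)
  show "tensor_class A B u \<otimes>\<^bsub>T\<^esub> tensor_class A B v = tensor_class A B (koszul_mult A B u v)"
    using u v by (simp add: tensor_algebra_def) (rule union_classes2, auto simp: koszul_free img_koszul)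
  show "c \<odot>\<^bsub>T\<^esub> tensor_class A B u = tensor_class A B (scale c u)"
    using u by (simp add: tensor_algebra_def) (rule union_classes, auto simp: img_scale)
  show "p < 2 \<Longrightarrow> parity_part T p (tensor_class A B u) = tensor_class A B (free_parity_part A B p u)"
    using u by (simp add: tensor_algebra_def) (rule union_classes, auto simp: parity_free img_parity)
qed (simp_all add: tensor_algebra_def pure_tensor_def)

lemma finitary_img: "finitary (img u)"
  by (simp add: finitary_def img_def lin_def case_prod_unfold conv_infinite)

text \<open>The tensor product is again a model, so the construction can be iterated and the triple
  product inherits the algebra axioms.\<close>

lemma model_T: "model T timg"
proof
  fix U V assume "U \<in> carrier T" "V \<in> carrier T"
  then obtain u v where u: "u \<in> free_space A B" "U = tensor_class A B u"
    and v: "v \<in> free_space A B" "V = tensor_class A B v" by (auto simp: carrier_T)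
  note ops = T_ops[OF u(1) v(1)]
  show "U \<oplus>\<^bsub>T\<^esub> V \<in> carrier T" "U \<otimes>\<^bsub>T\<^esub> V \<in> carrier T"
    using u v by (auto simp: ops carrier_T koszul_free)
  show "U = V" if "timg U = timg V"
  proof -
    have "img u = img v" using that u v by simp
    with u v show ?thesis by (simp add: tensor_class_eq)
  qed
  show "timg (U \<oplus>\<^bsub>T\<^esub> V) = (\<lambda>C D. timg U C D + timg V C D)" "timg (U \<otimes>\<^bsub>T\<^esub> V) = conv (timg U) (timg V)"
    using u v by (simp_all add: ops img_add img_koszul koszul_free)
next
  fix U c assume "U \<in> carrier T"
  then obtain u where u: "u \<in> free_space A B" "U = tensor_class A B u" by (auto simp: carrier_T)
  note ops = T_ops[OF u(1) u(1)]
  show "c \<odot>\<^bsub>T\<^esub> U \<in> carrier T" using u by (auto simp: ops carrier_T)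
  show "timg (c \<odot>\<^bsub>T\<^esub> U) = (\<lambda>C D. c * timg U C D)" using u by (simp add: ops img_scale)
  show "finitary (timg U)" using u by (simp add: finitary_img)
next
  fix U and p :: nat assume "U \<in> carrier T" and p: "p < 2"
  then obtain u where u: "u \<in> free_space A B" "U = tensor_class A B u" by (auto simp: carrier_T)
  note ops = T_ops(4)[OF u(1) u(1) p]
  show "parity_part T p U \<in> carrier T" using u by (auto simp: ops carrier_T parity_free)
  show "timg (parity_part T p U) = homog p (timg U)" using u p by (simp add: ops parity_free img_parity)
next
  note ops = T_ops(5,6)[of 0 0]
  show "\<zero>\<^bsub>T\<^esub> \<in> carrier T" "\<one>\<^bsub>T\<^esub> \<in> carrier T" by (auto simp: ops carrier_T)
  show "timg \<zero>\<^bsub>T\<^esub> = (\<lambda>C D. 0)" by (simp add: ops img_zero)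
  have "finitary conv_unit" by (simp add: finitary_def conv_unit_def)
  then show "timg \<one>\<^bsub>T\<^esub> = conv_unit" by (simp add: ops img_single A.one B.one)
qed

lemma pure_tensor_closed: "a \<in> carrier A \<Longrightarrow> b \<in> carrier B \<Longrightarrow> pure_tensor A B a b \<in> carrier T"
  by (auto simp: carrier_T pure_tensor_def)

lemma timg_pure: "a \<in> carrier A \<Longrightarrow> b \<in> carrier B \<Longrightarrow> timg (pure_tensor A B a b) = conv (\<alpha> a) (\<beta> b)"
  by (simp add: pure_tensor_def img_single)

lemma tensor_induct [consumes 1, case_names zero add smult pure]:
  assumes "U \<in> carrier T" "P \<zero>\<^bsub>T\<^esub>"
    "\<And>U V. U \<in> carrier T \<Longrightarrow> V \<in> carrier T \<Longrightarrow> P U \<Longrightarrow> P V \<Longrightarrow> P (U \<oplus>\<^bsub>T\<^esub> V)"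
    "\<And>c U. U \<in> carrier T \<Longrightarrow> P U \<Longrightarrow> P (c \<odot>\<^bsub>T\<^esub> U)"
    "\<And>a b. a \<in> carrier A \<Longrightarrow> b \<in> carrier B \<Longrightarrow> P (pure_tensor A B a b)"
  shows "P U"
proof -
  obtain u where u: "u \<in> free_space A B" "U = tensor_class A B u" using assms(1) by (auto simp: carrier_T)
  let ?s = "\<lambda>k. single k (lookup u k)"
  have "sum ?s K \<in> free_space A B \<and> P (tensor_class A B (sum ?s K))" if "finite K" "K \<subseteq> keys u" for K
    using that
  proof (induction K rule: finite_induct)
    case empty
    show ?case using assms(2) T_ops(5)[of 0 0] by simp
  next
    case (insert k K)
    obtain a b where k: "k = (a, b)" by (cases k)
    have ab: "a \<in> carrier A" "b \<in> carrier B" using insert.prems u(1) free_memD k by auto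
    have f: "?s k \<in> free_space A B" using ab by (simp add: k)
    have "P (lookup u k \<odot>\<^bsub>T\<^esub> pure_tensor A B a b)"
      by (intro assms(4,5) pure_tensor_closed ab)
    also have "lookup u k \<odot>\<^bsub>T\<^esub> pure_tensor A B a b = tensor_class A B (?s k)"
    proof -
      have "scale (lookup u k) (single (a, b) 1) = ?s k"
        by (rule poly_mapping_eqI) (simp add: k lookup_single when_def)
      then show ?thesis using ab T_ops(3)[of "single (a, b) 1" 0] by (simp add: pure_tensor_def)
    qed
    finally have "P (tensor_class A B (?s k) \<oplus>\<^bsub>T\<^esub> tensor_class A B (sum ?s K))"
      using insert f by (intro assms(3)) (auto simp: carrier_T)
    then show ?case using insert f T_ops(1)[of "?s k" "sum ?s K"] by simp
  qed
  from this[of "keys u"] show ?thesis using u(2) poly_mapping_sum_single[of u] by simp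
qed

end

section \<open>Evaluation of triple products\<close>

text \<open>The x-factor leaves no y values, so its second block is empty, and \<open>tJ\<close>
  sees its second argument only through the size. Writing that argument as \<open>A - C\<close>
  expresses every value through values at nested pairs.\<close>

lemma conv_XJ:
  assumes fin: "finite A" "finite B"
  shows "conv (tX f) (tJ g) A B = (\<Sum>C\<in>Pow A. if card (A - C) = card B
    then tX f C {} * tJ g (A - C) (A - C) * (dprod C B / dprod C (A - C)) else 0)"
  unfolding conv_def
proof (intro sum.cong[OF refl])
  fix C assume C: "C \<in> Pow A"
  have "(\<Sum>D\<in>Pow B. tX f C D * tJ g (A - C) (B - D) * shuffle_kernel C D (A - C) (B - D)) =
    (\<Sum>D\<in>{{}}. tX f C D * tJ g (A - C) (B - D) * shuffle_kernel C D (A - C) (B - D))"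
    by (rule sum.mono_neutral_right) (use fin in \<open>auto simp: tX_def\<close>)
  also have "\<dots> = (if card (A - C) = card B
      then tX f C {} * tJ g (A - C) (A - C) * (dprod C B / dprod C (A - C)) else 0)"
    using fin C by (auto simp: tJ_def shuffle_kernel_def finite_subset)
  finally show "(\<Sum>D\<in>Pow B. tX f C D * tJ g (A - C) (B - D) * shuffle_kernel C D (A - C) (B - D)) =
    (if card (A - C) = card B then tX f C {} * tJ g (A - C) (A - C) * (dprod C B / dprod C (A - C)) else 0)" .
qed

text \<open>Only \<open>C = A - Z\<close> survives: any other \<open>C\<close> either meets
  \<open>Z\<close>, so that a numerator vanishes, or leaves a complement of the wrong size.\<close>

lemma conv_XJ_subset:
  assumes fin: "finite A" and Z: "Z \<subseteq> A"
  shows "conv (tX f) (tJ g) A Z = tX f (A - Z) {} * tJ g Z Z"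
proof -
  have finZ: "finite Z" using Z fin by (rule finite_subset)
  have "conv (tX f) (tJ g) A Z = (\<Sum>C\<in>{A - Z}. if card (A - C) = card Z
    then tX f C {} * tJ g (A - C) (A - C) * (dprod C Z / dprod C (A - C)) else 0)"
    unfolding conv_XJ[OF fin finZ]
  proof (rule sum.mono_neutral_right)
    show "\<forall>C\<in>Pow A - {A - Z}. (if card (A - C) = card Z
      then tX f C {} * tJ g (A - C) (A - C) * (dprod C Z / dprod C (A - C)) else 0) = 0"
    proof
      fix C assume C: "C \<in> Pow A - {A - Z}"
      then have finC: "finite C" using fin finite_subset by auto
      show "(if card (A - C) = card Z then tX f C {} * tJ g (A - C) (A - C) * (dprod C Z / dprod C (A - C)) else 0) = 0"
      proof (cases "C \<inter> Z = {}")
        case True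
        then have "Z \<subseteq> A - C" using Z by auto
        moreover have "Z \<noteq> A - C" using C by auto
        ultimately have "card Z \<noteq> card (A - C)" using card_subset_eq[of "A - C" Z] fin by auto
        then show ?thesis by simp
      next
        case False
        then have "dprod C Z = 0" using finC finZ by (simp add: dprod_eq_0_iff)
        then show ?thesis by simp
      qed
    qed
  qed (use fin Z in auto)
  moreover have "A - (A - Z) = Z" using Z by auto
  moreover have "dprod (A - Z) Z \<noteq> 0" using fin finZ by (simp add: dprod_eq_0_iff) auto
  ultimately show ?thesis by simp
qed

lemma conv_Y:
  assumes fin: "finite A" "finite B"
  shows "conv \<Phi> (tY h) A B = (\<Sum>B1\<in>Pow B. \<Phi> A B1 * tY h {} (B - B1) * (dprod A (B - B1) / dprod B1 (B - B1)))"
proof -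
  have "conv \<Phi> (tY h) A B = (\<Sum>A1\<in>{A}. \<Sum>B1\<in>Pow B.
      \<Phi> A1 B1 * tY h (A - A1) (B - B1) * shuffle_kernel A1 B1 (A - A1) (B - B1))"
    unfolding conv_def
    by (rule sum.mono_neutral_right) (use fin in \<open>auto simp: tY_def intro!: sum.neutral split: if_splits\<close>)
  then show ?thesis by (simp add: shuffle_kernel_def)
qed

text \<open>Points with distinct coordinates avoiding \<open>Z\<close> are dense, so sets disjoint
  from \<open>Z\<close> detect a symmetric polynomial.\<close>

lemma tX_separates:
  assumes f: "f \<in> carrier coha_pt" and Z: "finite Z"
    and zero: "\<And>C. finite C \<Longrightarrow> C \<inter> Z = {} \<Longrightarrow> tX f C {} = 0"
  shows "f = \<zero>\<^bsub>coha_pt\<^esub>"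
proof -
  have "lookup f d = 0" for d
  proof (rule eval_eq_zeroD_generic[of "{1..d}" Z])
    fix s :: "nat \<Rightarrow> rat" assume s: "inj_on s {1..d}" "s ` {1..d} \<inter> Z = {}"
    have "eval s (lookup f d) = sval (lookup f d) (s ` {1..d})"
      using f by (intro sval_eqI[of _ d] bij_betw_inj_image s) simp
    also have "\<dots> = tX f (s ` {1..d}) {}" using card_image[OF s(1)] by (simp add: tX_def)
    also have "\<dots> = 0" using s by (intro zero) auto
    finally show "eval s (lookup f d) = 0" .
  qed (use Z in auto)
  then have "f = 0" by (intro poly_mapping_eqI) simp
  then show ?thesis by (simp add: coha_pt_def)
qed

lemma linear_tX: "linear_functional coha_pt (\<lambda>f. tX f A B)"
  unfolding linear_functional_def by (simp add: model.add[OF model_X] model.smult[OF model_X] del: carrier_coha)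

lemma linear_tY: "linear_functional coha_pt (\<lambda>f. tY f A B)"
  unfolding linear_functional_def by (simp add: model.add[OF model_Y] model.smult[OF model_Y] del: carrier_coha)

lemma linear_tJ: "linear_functional coha_J (\<lambda>f. tJ f A B)"
  unfolding linear_functional_def by (simp add: model.add[OF model_J] model.smult[OF model_J] del: carrier_coha)

lemma tensor_model_XJ: "tensor_model coha_pt tX coha_J tJ"
proof -
  interpret two_models coha_pt tX coha_J tJ
    by (intro two_models.intro model_X model_J)
  note [simp del] = carrier_coha
  show ?thesis
  proof
    fix u assume u: "u \<in> free_space coha_pt coha_J" and zero: "\<And>C D. img u C D = 0"
    show "u \<in> bilinear_rels coha_pt coha_J"
    proof (rule kernel_criterion[where I = "{Z. finite Z}" and t = "\<lambda>Z g. tJ g Z Z"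
          and S = "\<lambda>Z. {\<lambda>f. tX f C {} |C. finite C \<and> C \<inter> Z = {}}", OF _ _ _ _ u])
      show "linear_functional coha_J (\<lambda>g. tJ g Z Z)" for Z by (rule linear_tJ)
      show "linear_functional coha_pt s" if "s \<in> {\<lambda>f. tX f C {} |C. finite C \<and> C \<inter> Z = {}}" for s Z
        using that linear_tX by auto
      show "g = \<zero>\<^bsub>coha_J\<^esub>" if g: "g \<in> carrier coha_J" and "\<And>Z. Z \<in> {Z. finite Z} \<Longrightarrow> tJ g Z Z = 0" for g
      proof (rule B.inj[OF g B.zero_closed])
        show "tJ g = tJ \<zero>\<^bsub>coha_J\<^esub>"
        proof (intro ext)
          fix C D
          have "tJ g C D = (if finite C \<and> finite D \<and> card C = card D then tJ g C C else 0)"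
            by (simp add: tJ_def)
          also have "\<dots> = 0" using that(2)[of C] by auto
          finally show "tJ g C D = tJ \<zero>\<^bsub>coha_J\<^esub> C D" by (simp add: B.zero)
        qed
      qed
      show "f = \<zero>\<^bsub>coha_pt\<^esub>" if "Z \<in> {Z. finite Z}" "f \<in> carrier coha_pt"
        "\<And>s. s \<in> {\<lambda>f. tX f C {} |C. finite C \<and> C \<inter> Z = {}} \<Longrightarrow> s f = 0" for f Z
        using that by (intro tX_separates[of f Z]) auto
      fix Z s assume "Z \<in> {Z. finite Z}" "s \<in> {\<lambda>f. tX f C {} |C. finite C \<and> C \<inter> Z = {}}"
      then obtain C where C: "finite Z" "finite C" "C \<inter> Z = {}" "s = (\<lambda>f. tX f C {})" by auto
      have "C \<union> Z - Z = C" using C by auto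
      \<comment> \<open>At the nested pair the two factors are evaluated independently, so the
        pairings of the criterion are values of the image.\<close>
      then have "lin (\<lambda>(f, g). s f * tJ g Z Z) u = img u (C \<union> Z) Z"
        unfolding img_def using C by (simp add: conv_XJ_subset)
      then show "lin (\<lambda>(f, g). s f * tJ g Z Z) u = 0" by (simp add: zero)
    qed
  qed
qed

interpretation T1: tensor_model coha_pt tX coha_J tJ
  by (rule tensor_model_XJ)

text \<open>The weights do not depend on \<open>x\<close>, so the formula for pure tensors extends
  linearly. It makes an element of the inner tensor product known from its values at nested
  pairs.\<close>

lemma T1_formula:
  assumes x: "x \<in> carrier T1.T" and fin: "finite A" "finite B"
  shows "T1.timg x A B = (\<Sum>C\<in>Pow A. if card (A - C) = card B
    then T1.timg x A (A - C) * (dprod C B / dprod C (A - C)) else 0)"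
proof -
  interpret M: model T1.T T1.timg by (rule T1.model_T)
  note [simp del] = carrier_coha
  show ?thesis
    using x
  proof (induction rule: T1.tensor_induct)
    case (pure f g)
    have "conv (tX f) (tJ g) A (A - C) = tX f C {} * tJ g (A - C) (A - C)" if "C \<in> Pow A" for C
    proof -
      have "A - (A - C) = C" using that by auto
      then show ?thesis using conv_XJ_subset[of A "A - C" f g] fin by simp
    qed
    with pure show ?case by (simp add: T1.timg_pure conv_XJ[OF fin] cong: if_cong)
  next
    case zero
    then show ?case by (simp add: M.zero cong: if_cong)
  next
    case (add U V)
    then show ?case
      by (simp add: M.add sum.distrib[symmetric] if_distrib[where f = "\<lambda>x. x + _"] distrib_right cong: if_cong)
        (intro sum.cong refl, simp add: add_divide_distrib)
  next
    case (smult c U)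
    then show ?case
      by (simp add: M.smult sum_distrib_left if_distrib[where f = "\<lambda>x. c * x"] mult.assoc cong: if_cong)
  qed
qed

text \<open>The kernel of a triple product: the x values split into \<open>C\<close> for the first
  and \<open>Z\<close> for the middle factor, the y values into \<open>B1\<close> for the middle and
  \<open>D\<close> for the last.\<close>

definition triple_kernel :: "rat set \<Rightarrow> rat set \<Rightarrow> rat set \<Rightarrow> rat set \<Rightarrow> rat" where
  "triple_kernel C Z B1 D = dprod C B1 / dprod C Z * (dprod (C \<union> Z) D / dprod B1 D)"

lemma triple_formula:
  assumes x: "x \<in> carrier T1.T" and fin: "finite A" "finite B"
  shows "conv (T1.timg x) (tY h) A B = (\<Sum>B1\<in>Pow B. \<Sum>C\<in>Pow A. if card (A - C) = card B1
    then T1.timg x A (A - C) * tY h {} (B - B1) * triple_kernel C (A - C) B1 (B - B1) else 0)"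
  unfolding conv_Y[OF fin]
proof (intro sum.cong[OF refl])
  fix B1 assume "B1 \<in> Pow B"
  then have B1: "finite B1" using fin finite_subset by auto
  show "T1.timg x A B1 * tY h {} (B - B1) * (dprod A (B - B1) / dprod B1 (B - B1)) =
    (\<Sum>C\<in>Pow A. if card (A - C) = card B1
      then T1.timg x A (A - C) * tY h {} (B - B1) * triple_kernel C (A - C) B1 (B - B1) else 0)"
    unfolding T1_formula[OF x fin(1) B1] sum_distrib_right
  proof (intro sum.cong[OF refl])
    fix C assume "C \<in> Pow A"
    then have "C \<union> (A - C) = A" by auto
    then show "(if card (A - C) = card B1 then T1.timg x A (A - C) * (dprod C B1 / dprod C (A - C)) else 0) *
        tY h {} (B - B1) * (dprod A (B - B1) / dprod B1 (B - B1)) =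
      (if card (A - C) = card B1 then T1.timg x A (A - C) * tY h {} (B - B1) *
        triple_kernel C (A - C) B1 (B - B1) else 0)"
      by (simp add: triple_kernel_def)
  qed
qed

text \<open>A numerator contains a zero factor as soon as a common value of \<open>A\<close> and
  \<open>B\<close> is assigned to an outer factor on either side.\<close>

lemma triple_kernel_nonzero:
  assumes "finite A" "finite B" "C \<subseteq> A" "B1 \<subseteq> B" "triple_kernel C (A - C) B1 (B - B1) \<noteq> 0"
  shows "A \<inter> B \<subseteq> (A - C) \<inter> B1"
proof -
  have fin: "finite C" "finite B1" using assms finite_subset by auto
  have "C \<union> (A - C) = A" using assms(3) by auto
  then have "dprod C B1 \<noteq> 0" "dprod A (B - B1) \<noteq> 0" using assms(5) by (auto simp: triple_kernel_def)
  then have "C \<inter> B1 = {}" "A \<inter> (B - B1) = {}" using fin assms(1,2) by (auto simp: dprod_eq_0_iff)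
  with assms(3,4) show ?thesis by auto
qed

text \<open>The factors joining \<open>A \<inter> B\<close> to the outer blocks cancel; the rest is
  the nonzero leading coefficient.\<close>

lemma triple_kernel_diag:
  assumes "finite A" "finite B"
  shows "triple_kernel (A - B) (A \<inter> B) (A \<inter> B) (B - A) = dprod (A - B) (B - A)"
proof -
  have "dprod (A - B) (A \<inter> B) \<noteq> 0" "dprod (A \<inter> B) (B - A) \<noteq> 0"
    using assms by (subst dprod_eq_0_iff; auto)+
  moreover have "dprod (A - B \<union> A \<inter> B) (B - A) = dprod (A - B) (B - A) * dprod (A \<inter> B) (B - A)"
    using assms by (intro dprod_Un) auto
  ultimately show ?thesis by (simp add: triple_kernel_def)
qed

text \<open>Density arguments on tensors need their functions to come from polynomials.\<close>

lemma T1_polynomial: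
  assumes "x \<in> carrier T1.T"
  shows "\<exists>F\<in>carrier coha_A1. tA F = T1.timg x"
proof -
  interpret M: model T1.T T1.timg by (rule T1.model_T)
  interpret A1: model coha_A1 tA by (rule model_A1)
  note [simp del] = carrier_coha
  show ?thesis
    using assms
  proof (induction rule: T1.tensor_induct)
    case zero
    show ?case by (rule bexI[of _ "\<zero>\<^bsub>coha_A1\<^esub>"]) (simp_all add: M.zero A1.zero)
  next
    case (add U V)
    then obtain F G where "F \<in> carrier coha_A1" "tA F = T1.timg U" "G \<in> carrier coha_A1" "tA G = T1.timg V" by auto
    with add.hyps show ?case by (intro bexI[of _ "F \<oplus>\<^bsub>coha_A1\<^esub> G"]) (simp_all add: M.add A1.add)
  next
    case (smult c U)
    then obtain F where "F \<in> carrier coha_A1" "tA F = T1.timg U" by auto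
    with smult.hyps show ?case by (intro bexI[of _ "c \<odot>\<^bsub>coha_A1\<^esub> F"]) (simp_all add: M.smult A1.smult)
  next
    case (pure f g)
    then show ?case
      by (intro bexI[of _ "incl_X f \<otimes>\<^bsub>coha_A1\<^esub> psi0 g"])
        (simp_all add: T1.timg_pure A1.mult incl_closed tA_incl)
  qed
qed

lemma bij_betw_append:
  fixes m n :: nat
  assumes "bij_betw s {1..m} A" "bij_betw t {1..n} B" "A \<inter> B = {}"
  shows "bij_betw (\<lambda>i. if i \<le> m then s i else t (i - m)) {1..m + n} (A \<union> B)"
proof -
  let ?e = "\<lambda>i. if i \<le> m then s i else t (i - m)"
  have "bij_betw ?e {1..m} A"
    using assms(1) by (rule iffD1[OF bij_betw_cong, rotated]) simp
  moreover have "bij_betw ?e {m + 1..m + n} B"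
  proof -
    have "bij_betw (\<lambda>i. i - m) {m + 1..m + n} {1..n}"
      by (rule bij_betwI[where g = "\<lambda>i. i + m"]) auto
    from bij_betw_trans[OF this assms(2)] show ?thesis
      by (rule iffD1[OF bij_betw_cong, rotated]) simp
  qed
  ultimately have "bij_betw ?e ({1..m} \<union> {m + 1..m + n}) (A \<union> B)"
    using assms(3) by (rule bij_betw_combine)
  moreover have "{1..m} \<union> {m + 1..m + n} = {1..m + n}" by auto
  ultimately show ?thesis by simp
qed

text \<open>On nested pairs of given sizes the function is polynomial, so vanishing away from
  \<open>D\<close> implies vanishing on all nested pairs, and \<open>T1_formula\<close> carries this
  to all pairs.\<close>

lemma T1_separates:
  assumes x: "x \<in> carrier T1.T" and D: "finite D"
    and zero: "\<And>A Z. finite A \<Longrightarrow> Z \<subseteq> A \<Longrightarrow> A \<inter> D = {} \<Longrightarrow> T1.timg x A Z = 0"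
  shows "x = \<zero>\<^bsub>T1.T\<^esub>"
proof -
  interpret M: model T1.T T1.timg by (rule T1.model_T)
  obtain F where F: "F \<in> carrier coha_A1" "tA F = T1.timg x" using T1_polynomial[OF x] by auto
  have sub: "T1.timg x A Z = 0" if A: "finite A" and Z: "Z \<subseteq> A" for A Z
  proof -
    define n r where "n = card Z" and "r = card (A - Z)"
    have finZ: "finite Z" using A Z finite_subset by auto
    have cA: "card A = n + r"
      unfolding n_def r_def using A Z finZ card_mono[OF A Z] by (simp add: card_Diff_subset)
    define f where "f = lookup F (n + r, n)"
    have f: "f \<in> bisym_polys (n + r, n)" using F(1) by (simp add: f_def)
    \<comment> \<open>Identifying each y variable with the x variable of the same index turns the
      values at nested pairs into those of one polynomial in \<open>n + r\<close> variables.\<close>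
    have ev: "eval s (relabel (\<lambda>v. case v of Xv i \<Rightarrow> i | Yv j \<Rightarrow> j) f) = T1.timg x (s ` {1..n + r}) (s ` {1..n})"
      if s: "inj_on s {1..n + r}" for s
    proof -
      have s': "inj_on s {1..n}" using s by (rule inj_on_subset) auto
      have "s \<circ> (\<lambda>v. case v of Xv i \<Rightarrow> i | Yv j \<Rightarrow> j) = xy_point s s"
      proof
        fix v show "(s \<circ> (\<lambda>v. case v of Xv i \<Rightarrow> i | Yv j \<Rightarrow> j)) v = xy_point s s v" by (cases v) auto
      qed
      then have "eval s (relabel (\<lambda>v. case v of Xv i \<Rightarrow> i | Yv j \<Rightarrow> j) f) = bval f (s ` {1..n + r}) (s ` {1..n})"
        using bval_eqI[OF f bij_betw_inj_image[OF s] bij_betw_inj_image[OF s']] by simp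
      also have "\<dots> = tA F (s ` {1..n + r}) (s ` {1..n})"
        using card_image[OF s] card_image[OF s'] by (simp add: tA_def f_def)
      finally show ?thesis by (simp add: F(2))
    qed
    have p: "relabel (\<lambda>v. case v of Xv i \<Rightarrow> i | Yv j \<Rightarrow> j) f = 0"
    proof (rule eval_eq_zeroD_generic[of "{1..n + r}" D])
      fix s :: "nat \<Rightarrow> rat" assume s: "inj_on s {1..n + r}" "s ` {1..n + r} \<inter> D = {}"
      have "s ` {1..n} \<subseteq> s ` {1..n + r}" by (rule image_mono) auto
      then show "eval s (relabel (\<lambda>v. case v of Xv i \<Rightarrow> i | Yv j \<Rightarrow> j) f) = 0"
        unfolding ev[OF s(1)] using s(2) by (intro zero) auto
    qed (use D in auto)
    \<comment> \<open>An enumeration of \<open>A\<close> that lists \<open>Z\<close> first, as the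
      identification of variables requires.\<close>
    let ?s = "\<lambda>i. if i \<le> n then enum Z i else enum (A - Z) (i - n)"
    have b: "bij_betw ?s {1..n + r} (Z \<union> (A - Z))"
      unfolding n_def r_def by (intro bij_betw_append bij_enum) (use A finZ in auto)
    have "?s ` {1..n} = enum Z ` {1..n}" by (intro image_cong) auto
    also have "\<dots> = Z" using bij_enum[OF finZ] by (simp add: n_def bij_betw_def)
    finally have "?s ` {1..n} = Z" .
    moreover have "?s ` {1..n + r} = A" using b Z by (auto simp: bij_betw_def)
    ultimately show ?thesis using ev[of ?s] b p by (simp add: bij_betw_def)
  qed
  show ?thesis
  proof (rule M.inj[OF x M.zero_closed], intro ext)
    fix A B show "T1.timg x A B = T1.timg \<zero>\<^bsub>T1.T\<^esub> A B"
    proof (cases "finite A \<and> finite B")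
      case True
      then have "T1.timg x A B = 0"
        using T1_formula[OF x, of A B] sub[of A] by (simp add: sum.neutral cong: if_cong)
      then show ?thesis by (simp add: M.zero)
    qed (use M.finitary[OF x] M.zero in \<open>auto simp: finitary_def\<close>)
  qed
qed

lemma linear_timg: "linear_functional T1.T (\<lambda>x. T1.timg x A B)"
  unfolding linear_functional_def by (simp add: model.add[OF T1.model_T] model.smult[OF T1.model_T])

text \<open>Injectivity of \<open>Psi\<close> is proved here. A value of the image is a combination
  of pairings with a leading one whose middle blocks are \<open>A \<inter> B\<close>; the others
  have a smaller last set and vanish by induction on its size.\<close>

lemma tensor_model_outer: "tensor_model T1.T T1.timg coha_pt tY"
proof -
  interpret two_models T1.T T1.timg coha_pt tY
    by (intro two_models.intro T1.model_T model_Y)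
  note [simp del] = carrier_coha
  show ?thesis
  proof
    fix u assume u: "u \<in> free_space T1.T coha_pt" and zero: "\<And>C D. img u C D = 0"
    \<comment> \<open>The pairing of \<open>u\<close> with evaluation of the inner tensor at (A, Z)
      and of the last factor at \<open>D\<close>; the criterion asks for its vanishing when
      \<open>A\<close> and \<open>D\<close> are disjoint.\<close>
    define E where "E A Z D = lin (\<lambda>(x, h). T1.timg x A Z * tY h {} D) u" for A Z D
    have img_u: "img u A B = (\<Sum>B1\<in>Pow B. \<Sum>C\<in>Pow A. if card (A - C) = card B1
      then E A (A - C) (B - B1) * triple_kernel C (A - C) B1 (B - B1) else 0)"
      if fin: "finite A" "finite B" for A B
    proof -
      have "img u A B = (\<Sum>k\<in>keys u. \<Sum>B1\<in>Pow B. \<Sum>C\<in>Pow A. if card (A - C) = card B1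
        then lookup u k * (T1.timg (fst k) A (A - C) * tY (snd k) {} (B - B1)) *
          triple_kernel C (A - C) B1 (B - B1) else 0)"
        unfolding img_def lin_def case_prod_unfold
      proof (intro sum.cong[OF refl])
        fix k assume "k \<in> keys u"
        then have "fst k \<in> carrier T1.T" using u by (auto simp: free_space_def)
        from triple_formula[OF this fin, of "snd k"]
        show "lookup u k * conv (T1.timg (fst k)) (tY (snd k)) A B =
          (\<Sum>B1\<in>Pow B. \<Sum>C\<in>Pow A. if card (A - C) = card B1
            then lookup u k * (T1.timg (fst k) A (A - C) * tY (snd k) {} (B - B1)) *
              triple_kernel C (A - C) B1 (B - B1) else 0)"
          by (simp add: sum_distrib_left if_distrib[where f = "\<lambda>x. _ * x"] mult.assoc cong: if_cong)
      qed
      also have "\<dots> = (\<Sum>B1\<in>Pow B. \<Sum>C\<in>Pow A. \<Sum>k\<in>keys u. if card (A - C) = card B1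
        then lookup u k * (T1.timg (fst k) A (A - C) * tY (snd k) {} (B - B1)) *
          triple_kernel C (A - C) B1 (B - B1) else 0)"
        by (subst sum.swap, rule sum.cong[OF refl], rule sum.swap)
      also have "\<dots> = (\<Sum>B1\<in>Pow B. \<Sum>C\<in>Pow A. if card (A - C) = card B1
        then E A (A - C) (B - B1) * triple_kernel C (A - C) B1 (B - B1) else 0)"
        unfolding E_def lin_def case_prod_unfold sum_distrib_right
        by (intro sum.cong[OF refl]) (simp only: if_distrib sum.neutral_const split: if_splits, simp)
      finally show ?thesis .
    qed
    text \<open>Only pairings with a smaller set \<open>D\<close> interfere.\<close>
    have E0: "E A Z D = 0" if "finite A" "finite D" "Z \<subseteq> A" "A \<inter> D = {}" for A Z D
      using that
    proof (induction "card D" arbitrary: A Z D rule: less_induct)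
      case less
      have finZ: "finite Z" using less.prems finite_subset by blast
      \<comment> \<open>This makes \<open>A \<inter> B = Z\<close> and \<open>B - A = D\<close>, so
        \<open>E A Z D\<close> is the leading pairing at (A, B).\<close>
      define B where "B = Z \<union> D"
      have AB: "finite A" "finite B" "A \<inter> B = Z" "A - B = A - Z" "B - A = D" "B - Z = D"
        using less.prems finZ by (auto simp: B_def)
      have "dprod (A - Z) D \<noteq> 0"
        using dprod_eq_0_iff[of "A - Z" D] less.prems by blast
      then have nonzero: "triple_kernel (A - Z) Z Z D \<noteq> 0"
        using triple_kernel_diag[OF AB(1,2)] by (simp add: AB(3-5))
      have off: "(if card (A - C) = card B1
          then E A (A - C) (B - B1) * triple_kernel C (A - C) B1 (B - B1) else 0) =
          (if B1 = Z then if C = A - Z then E A Z D * triple_kernel (A - Z) Z Z D else 0 else 0)"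
        if B1: "B1 \<in> Pow B" and C: "C \<in> Pow A" for B1 C
      proof (cases "card (A - C) = card B1 \<and> triple_kernel C (A - C) B1 (B - B1) \<noteq> 0")
        case True
        have "A \<inter> B \<subseteq> (A - C) \<inter> B1"
          using AB B1 C True by (intro triple_kernel_nonzero) auto
        then have sub: "Z \<subseteq> A - C" "Z \<subseteq> B1" using AB by auto
        have finB1: "finite B1" using B1 AB finite_subset by auto
        show ?thesis
        proof (cases "B1 = Z")
          case eq: True
          then have "A - C = Z" using True sub(1) card_subset_eq[of "A - C" Z] AB(1) by simp
          moreover from this have "C = A - Z" using C by auto
          ultimately show ?thesis using eq True AB by simp
        next
          case False
          \<comment> \<open>A block strictly larger than \<open>Z\<close> takes elements from
            \<open>D\<close>, so the induction hypothesis applies to what is left.\<close>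
          with sub(2) B1 AB(6) have BD: "B - B1 \<subset> D" by auto
          have "E A (A - C) (B - B1) = 0"
          proof (rule less.hyps)
            show "card (B - B1) < card D" using less.prems(2) BD by (rule psubset_card_mono)
            show "finite A" "finite (B - B1)" "A - C \<subseteq> A" using AB(1,2) by auto
            show "A \<inter> (B - B1) = {}" using BD less.prems(4) by blast
          qed
          with False show ?thesis by simp
        qed
      next
        case False
        have "A - (A - Z) = Z" using less.prems(3) by auto
        then have "\<not> (B1 = Z \<and> C = A - Z)" using False nonzero AB(6) by auto
        moreover have "(if card (A - C) = card B1
          then E A (A - C) (B - B1) * triple_kernel C (A - C) B1 (B - B1) else 0) = 0"
          using False by (cases "card (A - C) = card B1") simp_all
        ultimately show ?thesis by presburger
      qed
      have "img u A B = (\<Sum>B1\<in>Pow B. \<Sum>C\<in>Pow A. if B1 = Z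
          then if C = A - Z then E A Z D * triple_kernel (A - Z) Z Z D else 0 else 0)"
        unfolding img_u[OF AB(1,2)] by (intro sum.cong[OF refl] off)
      also have "\<dots> = (\<Sum>B1\<in>Pow B. if B1 = Z
          then \<Sum>C\<in>Pow A. if C = A - Z then E A Z D * triple_kernel (A - Z) Z Z D else 0 else 0)"
        by (intro sum.cong) auto
      also have "\<dots> = E A Z D * triple_kernel (A - Z) Z Z D"
        using AB by (simp add: sum.delta B_def)
      finally show ?case using nonzero zero[of A B] by simp
    qed
    show "u \<in> bilinear_rels T1.T coha_pt"
    proof (rule kernel_criterion[where I = "{D. finite D}" and t = "\<lambda>D h. tY h {} D"
          and S = "\<lambda>D. {\<lambda>x. T1.timg x A Z |A Z. finite A \<and> Z \<subseteq> A \<and> A \<inter> D = {}}", OF _ _ _ _ u])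
      show "linear_functional coha_pt (\<lambda>h. tY h {} D)" for D by (rule linear_tY)
      show "linear_functional T1.T s" if "s \<in> {\<lambda>x. T1.timg x A Z |A Z. finite A \<and> Z \<subseteq> A \<and> A \<inter> D = {}}" for s D
        using that linear_timg by auto
      show "h = \<zero>\<^bsub>coha_pt\<^esub>" if h: "h \<in> carrier coha_pt" and "\<And>D. D \<in> {D. finite D} \<Longrightarrow> tY h {} D = 0" for h
      proof (rule B.inj[OF h B.zero_closed])
        show "tY h = tY \<zero>\<^bsub>coha_pt\<^esub>"
        proof (intro ext)
          fix C D show "tY h C D = tY \<zero>\<^bsub>coha_pt\<^esub> C D"
            using that(2)[of D] by (cases "C = {} \<and> finite D") (auto simp: B.zero tY_def split: if_splits)
        qed
      qed
      show "x = \<zero>\<^bsub>T1.T\<^esub>" if "D \<in> {D. finite D}" "x \<in> carrier T1.T"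
        "\<And>s. s \<in> {\<lambda>x. T1.timg x A Z |A Z. finite A \<and> Z \<subseteq> A \<and> A \<inter> D = {}} \<Longrightarrow> s x = 0" for x D
        using that by (intro T1_separates[of x D]) auto
      fix D s assume "D \<in> {D. finite D}" "s \<in> {\<lambda>x. T1.timg x A Z |A Z. finite A \<and> Z \<subseteq> A \<and> A \<inter> D = {}}"
      then obtain A Z where *: "finite D" "finite A" "Z \<subseteq> A" "A \<inter> D = {}" "s = (\<lambda>x. T1.timg x A Z)" by auto
      show "lin (\<lambda>(x, h). s x * tY h {} D) u = 0"
        using E0[OF *(2,1,3,4)] by (simp add: E_def *(5))
    qed
  qed
qed

interpretation T2: tensor_model T1.T T1.timg coha_pt tY
  by (rule tensor_model_outer)

interpretation A1: model coha_A1 tA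
  by (rule model_A1)

interpretation M2: model coha_tensor T2.timg
  by (rule T2.model_T)

declare carrier_coha [simp del]

section \<open>The map \<open>\<Psi>\<close>\<close>

lemma timg_tensor3:
  assumes "f \<in> carrier coha_pt" "g \<in> carrier coha_J" "h \<in> carrier coha_pt"
  shows "tensor3 f g h \<in> carrier coha_tensor"
    and "T2.timg (tensor3 f g h) = conv (conv (tX f) (tJ g)) (tY h)"
  using assms by (simp_all add: tensor3_def T2.pure_tensor_closed T1.pure_tensor_closed T2.timg_pure T1.timg_pure)

text \<open>The left factor of an outer pure tensor need not be pure; an inner induction, with
  linearity of the outer tensor in that factor, reduces it to pure ones.\<close>

lemma coha_tensor_induct [consumes 1, case_names zero add smult tensor3]:
  assumes U: "U \<in> carrier coha_tensor" and zero: "P \<zero>\<^bsub>coha_tensor\<^esub>"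
    and add: "\<And>U V. U \<in> carrier coha_tensor \<Longrightarrow> V \<in> carrier coha_tensor \<Longrightarrow> P U \<Longrightarrow> P V \<Longrightarrow> P (U \<oplus>\<^bsub>coha_tensor\<^esub> V)"
    and smult: "\<And>c U. U \<in> carrier coha_tensor \<Longrightarrow> P U \<Longrightarrow> P (c \<odot>\<^bsub>coha_tensor\<^esub> U)"
    and tensor3: "\<And>f g h. f \<in> carrier coha_pt \<Longrightarrow> g \<in> carrier coha_J \<Longrightarrow> h \<in> carrier coha_pt \<Longrightarrow> P (tensor3 f g h)"
  shows "P U"
  using U
proof (induction rule: T2.tensor_induct)
  case (pure x h)
  note h = pure(2)
  show ?case
    using pure(1)
  proof (induction rule: T1.tensor_induct)
    case zero
    have "pure_tensor T1.T coha_pt \<zero>\<^bsub>T1.T\<^esub> h = \<zero>\<^bsub>coha_tensor\<^esub>"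
      using h by (intro M2.inj) (simp_all add: T2.pure_tensor_closed T2.timg_pure T2.A.zero M2.zero)
    with \<open>P \<zero>\<^bsub>coha_tensor\<^esub>\<close> show ?case by simp
  next
    case (add x y)
    have "pure_tensor T1.T coha_pt (x \<oplus>\<^bsub>T1.T\<^esub> y) h =
      pure_tensor T1.T coha_pt x h \<oplus>\<^bsub>coha_tensor\<^esub> pure_tensor T1.T coha_pt y h"
      using h add.hyps by (intro M2.inj) (simp_all add: T2.pure_tensor_closed T2.timg_pure T2.A.add M2.add conv_add)
    then show ?case
      using assms(3)[OF T2.pure_tensor_closed[OF add.hyps(1) h] T2.pure_tensor_closed[OF add.hyps(2) h]] add.IH by simp
  next
    case (smult c x)
    have "pure_tensor T1.T coha_pt (c \<odot>\<^bsub>T1.T\<^esub> x) h = c \<odot>\<^bsub>coha_tensor\<^esub> pure_tensor T1.T coha_pt x h"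
      using h smult.hyps by (intro M2.inj) (simp_all add: T2.pure_tensor_closed T2.timg_pure T2.A.smult M2.smult conv_scale)
    then show ?case
      using assms(4)[OF T2.pure_tensor_closed[OF smult.hyps(1) h]] smult.IH by simp
  next
    case (pure f g)
    from tensor3[OF this h] show ?case by (simp add: tensor3_def)
  qed
qed (auto intro: zero add smult)

lemma Psi_value_exists: "U \<in> carrier coha_tensor \<Longrightarrow> \<exists>F\<in>carrier coha_A1. tA F = T2.timg U"
proof (induction rule: coha_tensor_induct)
  case zero
  show ?case by (rule bexI[of _ "\<zero>\<^bsub>coha_A1\<^esub>"]) (simp_all add: M2.zero A1.zero)
next
  case (add U V)
  then obtain F G where "F \<in> carrier coha_A1" "tA F = T2.timg U" "G \<in> carrier coha_A1" "tA G = T2.timg V" by auto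
  with add.hyps show ?case by (intro bexI[of _ "F \<oplus>\<^bsub>coha_A1\<^esub> G"]) (simp_all add: M2.add A1.add)
next
  case (smult c U)
  then obtain F where "F \<in> carrier coha_A1" "tA F = T2.timg U" by auto
  with smult.hyps show ?case by (intro bexI[of _ "c \<odot>\<^bsub>coha_A1\<^esub> F"]) (simp_all add: M2.smult A1.smult)
next
  case (tensor3 f g h)
  then show ?case
    by (intro bexI[of _ "incl_X f \<otimes>\<^bsub>coha_A1\<^esub> psi0 g \<otimes>\<^bsub>coha_A1\<^esub> incl_Y h"])
      (simp_all add: timg_tensor3 A1.mult incl_closed tA_incl)
qed

text \<open>The choice is unique because \<open>tA\<close> is injective on the carrier.\<close>

definition psi :: "_ \<Rightarrow> (nat \<times> nat \<Rightarrow>\<^sub>0 xy mpoly)" where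
  "psi U = (SOME F. F \<in> carrier coha_A1 \<and> tA F = T2.timg U)"

lemma psi:
  assumes "U \<in> carrier coha_tensor"
  shows "psi U \<in> carrier coha_A1" "tA (psi U) = T2.timg U"
proof -
  have "\<exists>F. F \<in> carrier coha_A1 \<and> tA F = T2.timg U" using Psi_value_exists[OF assms] by auto
  from someI_ex[OF this] show "psi U \<in> carrier coha_A1" "tA (psi U) = T2.timg U"
    by (simp_all add: psi_def)
qed

lemma psi_tensor3:
  assumes "f \<in> carrier coha_pt" "g \<in> carrier coha_J" "h \<in> carrier coha_pt"
  shows "psi (tensor3 f g h) = incl_X f \<otimes>\<^bsub>coha_A1\<^esub> Psi0 g \<otimes>\<^bsub>coha_A1\<^esub> incl_Y h"
  using assms
  by (intro A1.inj) (simp_all add: psi timg_tensor3 A1.mult incl_closed tA_incl Psi0_eq)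

lemma psi_linear: "restrict psi (carrier coha_tensor) \<in> linear_maps coha_tensor coha_A1"
proof -
  have "psi (U \<oplus>\<^bsub>coha_tensor\<^esub> V) = psi U \<oplus>\<^bsub>coha_A1\<^esub> psi V" "psi (c \<odot>\<^bsub>coha_tensor\<^esub> U) = c \<odot>\<^bsub>coha_A1\<^esub> psi U"
    if "U \<in> carrier coha_tensor" "V \<in> carrier coha_tensor" for U V c
    using that by (auto intro!: A1.inj simp: psi A1.simps M2.simps)
  then show ?thesis by (auto simp: linear_maps_def psi)
qed

lemma Psi_eq: "Psi = restrict psi (carrier coha_tensor)"
  unfolding Psi_def
proof (rule the_equality)
  show "restrict psi (carrier coha_tensor) \<in> linear_maps coha_tensor coha_A1 \<and>
    restrict psi (carrier coha_tensor) \<in> extensional (carrier coha_tensor) \<and>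
    (\<forall>f\<in>carrier coha_pt. \<forall>g\<in>carrier coha_J. \<forall>h\<in>carrier coha_pt.
        restrict psi (carrier coha_tensor) (tensor3 f g h) = incl_X f \<otimes>\<^bsub>coha_A1\<^esub> Psi0 g \<otimes>\<^bsub>coha_A1\<^esub> incl_Y h)"
    using psi_linear by (simp add: timg_tensor3(1) psi_tensor3)
next
  fix F assume F: "F \<in> linear_maps coha_tensor coha_A1 \<and> F \<in> extensional (carrier coha_tensor) \<and>
    (\<forall>f\<in>carrier coha_pt. \<forall>g\<in>carrier coha_J. \<forall>h\<in>carrier coha_pt.
        F (tensor3 f g h) = incl_X f \<otimes>\<^bsub>coha_A1\<^esub> Psi0 g \<otimes>\<^bsub>coha_A1\<^esub> incl_Y h)"
  have lin: "F (U \<oplus>\<^bsub>coha_tensor\<^esub> V) = F U \<oplus>\<^bsub>coha_A1\<^esub> F V" "F (c \<odot>\<^bsub>coha_tensor\<^esub> U) = c \<odot>\<^bsub>coha_A1\<^esub> F U" "F U \<in> carrier coha_A1"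
    if "U \<in> carrier coha_tensor" "V \<in> carrier coha_tensor" for U V c
    using F that by (auto simp: linear_maps_def)
  \<comment> \<open>Uniqueness: a competitor is fixed on the elements \<open>tensor3 f g h\<close>,
    which span, and \<open>tA\<close> detects equality.\<close>
  have "tA (F U) = T2.timg U" if "U \<in> carrier coha_tensor" for U
    using that
  proof (induction rule: coha_tensor_induct)
    case zero
    have "0 \<odot>\<^bsub>coha_tensor\<^esub> \<zero>\<^bsub>coha_tensor\<^esub> = \<zero>\<^bsub>coha_tensor\<^esub>" by (rule M2.inj) (simp_all add: M2.simps)
    then have "F \<zero>\<^bsub>coha_tensor\<^esub> = 0 \<odot>\<^bsub>coha_A1\<^esub> F \<zero>\<^bsub>coha_tensor\<^esub>"
      using lin(2)[OF M2.zero_closed M2.zero_closed, of 0] by simp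
    then have "tA (F \<zero>\<^bsub>coha_tensor\<^esub>) = (\<lambda>A B. 0)"
      using A1.smult[OF lin(3)[OF M2.zero_closed M2.zero_closed], of 0] by simp
    then show ?case by (simp add: M2.zero)
  next
    case (add U V)
    then show ?case by (simp add: lin M2.add A1.add)
  next
    case (smult c U)
    then show ?case by (simp add: lin M2.smult A1.smult)
  next
    case (tensor3 f g h)
    then have "F (tensor3 f g h) = psi (tensor3 f g h)" using F by (simp add: psi_tensor3)
    with tensor3 show ?case by (simp add: psi timg_tensor3(1))
  qed
  then have eq: "F U = psi U" if "U \<in> carrier coha_tensor" for U
    using that by (intro A1.inj) (simp_all add: psi lin(3))
  show "F = restrict psi (carrier coha_tensor)"
  proof (rule extensionalityI[of _ "carrier coha_tensor"])
    show "F \<in> extensional (carrier coha_tensor)" using F by (elim conjE)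
    show "restrict psi (carrier coha_tensor) \<in> extensional (carrier coha_tensor)" by (rule restrict_extensional)
  qed (simp add: eq)
qed

section \<open>Surjectivity\<close>

lemma tA_single:
  "tA (single (m, n) f) A B = (if finite A \<and> finite B \<and> card A = m \<and> card B = n then bval f A B else 0)"
  by (auto simp: tA_def lookup_single when_def)

text \<open>\<open>coha_pt\<close> and \<open>coha_J\<close> have the same carrier, so products
  formed in \<open>coha_J\<close> also serve as elements for the outer factors.\<close>

lemma phi_prod_pt: "phi_prod js \<in> carrier coha_pt"
  using phi_prod_closed[of js] by (simp add: carrier_coha)

lemma t_phi_prod:
  "tX (phi_prod js) A {} = (if finite A \<and> card A = length js then monomial_sum js A else 0)"
  "tY (phi_prod js) {} A = (if finite A \<and> card A = length js then monomial_sum js A else 0)"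
  "tJ (phi_prod js) A A = (if finite A \<and> card A = length js then monomial_sum js A else 0)"
  using sval_phi_prod[of A js]
  by (cases "finite A"; cases "card A = length js"; simp add: tX_def tY_def tJ_def)+

definition range_T :: "setfun set" where
  "range_T = T2.timg ` carrier coha_tensor"

lemma range_T_closed:
  "(\<lambda>A B. 0) \<in> range_T"
  "\<Phi> \<in> range_T \<Longrightarrow> \<Gamma> \<in> range_T \<Longrightarrow> (\<lambda>A B. \<Phi> A B + \<Gamma> A B) \<in> range_T"
  "\<Phi> \<in> range_T \<Longrightarrow> (\<lambda>A B. c * \<Phi> A B) \<in> range_T"
proof -
  show "(\<lambda>A B. 0) \<in> range_T"
    unfolding range_T_def by (rule image_eqI[of _ _ "\<zero>\<^bsub>coha_tensor\<^esub>"]) (simp_all add: M2.zero)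
  show "(\<lambda>A B. \<Phi> A B + \<Gamma> A B) \<in> range_T" if \<Phi>: "\<Phi> \<in> range_T" and \<Gamma>: "\<Gamma> \<in> range_T"
  proof -
    obtain U V where "U \<in> carrier coha_tensor" "\<Phi> = T2.timg U" "V \<in> carrier coha_tensor" "\<Gamma> = T2.timg V"
      using \<Phi> \<Gamma> by (auto simp: range_T_def)
    then show ?thesis
      unfolding range_T_def by (intro image_eqI[of _ _ "U \<oplus>\<^bsub>coha_tensor\<^esub> V"]) (simp_all add: M2.add)
  qed
  show "(\<lambda>A B. c * \<Phi> A B) \<in> range_T" if \<Phi>: "\<Phi> \<in> range_T"
  proof -
    obtain U where "U \<in> carrier coha_tensor" "\<Phi> = T2.timg U" using \<Phi> by (auto simp: range_T_def)
    then show ?thesis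
      unfolding range_T_def by (intro image_eqI[of _ _ "c \<odot>\<^bsub>coha_tensor\<^esub> U"]) (simp_all add: M2.smult)
  qed
qed

lemma range_T_sum:
  "(\<And>k. k \<in> K \<Longrightarrow> h k \<in> range_T) \<Longrightarrow> (\<lambda>A B. \<Sum>k\<in>K. h k A B) \<in> range_T"
  by (induction K rule: infinite_finite_induct) (auto intro: range_T_closed)

lemma triple_in_range:
  assumes "f \<in> carrier coha_pt" "g \<in> carrier coha_J" "h \<in> carrier coha_pt"
  shows "conv (conv (tX f) (tJ g)) (tY h) \<in> range_T"
  using timg_tensor3[OF assms] by (auto simp: range_T_def intro!: image_eqI[where x = "tensor3 f g h"])

lemma triple_phi:
  assumes fin: "finite A" "finite B"
  shows "conv (conv (tX (phi_prod ks)) (tJ (phi_prod js))) (tY (phi_prod ls)) A B =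
    (\<Sum>B1\<in>Pow B. \<Sum>C\<in>Pow A. if card (A - C) = card B1 then
      tX (phi_prod ks) C {} * tJ (phi_prod js) (A - C) (A - C) * tY (phi_prod ls) {} (B - B1) *
      triple_kernel C (A - C) B1 (B - B1) else 0)"
proof -
  define x where "x = pure_tensor coha_pt coha_J (phi_prod ks) (phi_prod js)"
  have x: "x \<in> carrier T1.T" "T1.timg x = conv (tX (phi_prod ks)) (tJ (phi_prod js))"
    by (simp_all add: x_def T1.pure_tensor_closed T1.timg_pure phi_prod_pt phi_prod_closed)
  have "T1.timg x A (A - C) = tX (phi_prod ks) C {} * tJ (phi_prod js) (A - C) (A - C)" if "C \<in> Pow A" for C
  proof -
    have "A - (A - C) = C" using that by auto
    then show ?thesis using conv_XJ_subset[of A "A - C"] fin by (simp add: x(2))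
  qed
  then show ?thesis
    using triple_formula[OF x(1) fin, of "phi_prod ls"] by (simp add: x(2) cong: if_cong)
qed

text \<open>A nonzero value needs a decomposition with nonzero kernel, whose middle blocks have
  \<open>length js\<close> elements and contain \<open>A \<inter> B\<close>. This triangularity
  ensures that subtracting such products spoils no larger intersection.\<close>

lemma triple_phi_support:
  assumes "conv (conv (tX (phi_prod ks)) (tJ (phi_prod js))) (tY (phi_prod ls)) A B \<noteq> 0"
  shows "finite A" "finite B" "card A = length ks + length js" "card B = length js + length ls"
    "card (A \<inter> B) \<le> length js"
proof -
  show fin: "finite A" "finite B" using assms conv_infinite by blast+
  let ?t = "\<lambda>B1 C. if card (A - C) = card B1 then
      tX (phi_prod ks) C {} * tJ (phi_prod js) (A - C) (A - C) * tY (phi_prod ls) {} (B - B1) *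
      triple_kernel C (A - C) B1 (B - B1) else 0"
  have "\<exists>B1\<in>Pow B. \<exists>C\<in>Pow A. ?t B1 C \<noteq> 0"
  proof (rule ccontr)
    assume *: "\<not> (\<exists>B1\<in>Pow B. \<exists>C\<in>Pow A. ?t B1 C \<noteq> 0)"
    have "(\<Sum>B1\<in>Pow B. \<Sum>C\<in>Pow A. ?t B1 C) = 0"
      by (intro sum.neutral ballI) (use * in blast)
    with assms show False unfolding triple_phi[OF fin] by contradiction
  qed
  then obtain B1 C where BC: "B1 \<in> Pow B" "C \<in> Pow A" and nz: "?t B1 C \<noteq> 0" by blast
  from nz have c: "card (A - C) = card B1" "card C = length ks" "card (A - C) = length js" "card (B - B1) = length ls"
    and k: "triple_kernel C (A - C) B1 (B - B1) \<noteq> 0"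
    by (auto simp: t_phi_prod split: if_splits)
  have fC: "finite C" "finite B1" using BC fin finite_subset by auto
  show "card A = length ks + length js" "card B = length js + length ls"
    using c BC fin fC card_mono[OF fin(1), of C] card_mono[OF fin(2), of B1]
    by (auto simp: card_Diff_subset)
  have "A \<inter> B \<subseteq> A - C" using triple_kernel_nonzero[OF fin _ _ k] BC by auto
  then show "card (A \<inter> B) \<le> length js" using c(3) card_mono[of "A - C" "A \<inter> B"] fin by simp
qed

text \<open>Both middle blocks contain \<open>A \<inter> B\<close> and have its size, so one
  decomposition survives.\<close>

lemma triple_phi_diag:
  assumes fin: "finite A" "finite B" and c: "card (A \<inter> B) = length js"
    "card (A - B) = length ks" "card (B - A) = length ls"
  shows "conv (conv (tX (phi_prod ks)) (tJ (phi_prod js))) (tY (phi_prod ls)) A B =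
    dprod (A - B) (B - A) * (monomial_sum ks (A - B) * monomial_sum js (A \<inter> B) * monomial_sum ls (B - A))"
proof -
  let ?v = "monomial_sum ks (A - B) * monomial_sum js (A \<inter> B) * monomial_sum ls (B - A) * dprod (A - B) (B - A)"
  let ?t = "\<lambda>B1 C. if card (A - C) = card B1 then
      tX (phi_prod ks) C {} * tJ (phi_prod js) (A - C) (A - C) * tY (phi_prod ls) {} (B - B1) *
      triple_kernel C (A - C) B1 (B - B1) else 0"
  have "?t B1 C = (if B1 = A \<inter> B then if C = A - B then ?v else 0 else 0)"
    if BC: "B1 \<in> Pow B" "C \<in> Pow A" for B1 C
  proof (cases "B1 = A \<inter> B \<and> C = A - B")
    case True
    then have e: "A - C = A \<inter> B" "B - B1 = B - A" by auto
    have "triple_kernel C (A - C) B1 (B - B1) = dprod (A - B) (B - A)"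
      using triple_kernel_diag[OF fin] True unfolding e by simp
    then show ?thesis unfolding e using True fin c by (simp add: t_phi_prod)
  next
    case False
    have "\<not> (card (A - C) = card B1 \<and> card (A - C) = length js \<and> triple_kernel C (A - C) B1 (B - B1) \<noteq> 0)"
    proof
      assume *: "card (A - C) = card B1 \<and> card (A - C) = length js \<and> triple_kernel C (A - C) B1 (B - B1) \<noteq> 0"
      then have sub: "A \<inter> B \<subseteq> (A - C) \<inter> B1" using triple_kernel_nonzero[OF fin] BC by auto
      have "finite B1" using BC fin finite_subset by auto
      then have "A \<inter> B = A - C" "A \<inter> B = B1"
        using sub * c(1) fin card_subset_eq[of "A - C" "A \<inter> B"] card_subset_eq[of B1 "A \<inter> B"] by simp_all
      moreover have "C = A - (A - C)" using BC by auto
      ultimately have "B1 = A \<inter> B" "C = A - B" by auto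
      with False show False by simp
    qed
    then have "?t B1 C = 0"
      by (auto simp: t_phi_prod)
    with False show ?thesis by auto
  qed
  then have "conv (conv (tX (phi_prod ks)) (tJ (phi_prod js))) (tY (phi_prod ls)) A B =
    (\<Sum>B1\<in>Pow B. \<Sum>C\<in>Pow A. if B1 = A \<inter> B then if C = A - B then ?v else 0 else 0)"
    unfolding triple_phi[OF fin] by (intro sum.cong[OF refl])
  also have "\<dots> = (\<Sum>B1\<in>Pow B. if B1 = A \<inter> B then \<Sum>C\<in>Pow A. if C = A - B then ?v else 0 else 0)"
    by (intro sum.cong) auto
  also have "\<dots> = ?v" using fin by (simp add: sum.delta)
  finally show ?thesis by simp
qed

lemma sum_triple_product:
  fixes c :: "'a::comm_semiring_0"
  shows "(\<Sum>x\<in>P. \<Sum>z\<in>Q. \<Sum>y\<in>R. c * (f x * g z * h y)) = c * (sum f P * sum g Q * sum h R)"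
  by (simp add: mult.assoc flip: sum_distrib_left sum_distrib_right)

text \<open>
  A polynomial vanishing whenever \<open>x\<close> and \<open>y\<close> share more than \<open>K\<close> values is, after identifying \<open>K\<close>
  of the \<open>x\<close> with \<open>K\<close> of the \<open>y\<close>, divisible by the differences of the remaining ones. Symmetrizing
  the monomials of the quotient gives the required triple products.
\<close>

lemma bval_decompose:
  assumes f: "f \<in> bisym_polys (a + K, K + b)"
    and vanish: "\<And>A B. finite A \<Longrightarrow> finite B \<Longrightarrow> card A = a + K \<Longrightarrow> card B = K + b \<Longrightarrow>
      card (A \<inter> B) > K \<Longrightarrow> bval f A B = 0"
  shows "\<exists>M c js1 js2 js3. finite M \<and> (\<forall>m :: xy \<Rightarrow>\<^sub>0 nat.
      length (js1 m) = a \<and> length (js2 m) = K \<and> length (js3 m) = b) \<and>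
      (\<forall>A B. finite A \<longrightarrow> finite B \<longrightarrow> card A = a + K \<longrightarrow> card B = K + b \<longrightarrow> card (A \<inter> B) = K \<longrightarrow>
        bval f A B = dprod (A - B) (B - A) * (\<Sum>m\<in>M. c m * (monomial_sum (js1 m) (A - B) *
          monomial_sum (js2 m) (A \<inter> B) * monomial_sum (js3 m) (B - A))))"
proof -
  \<comment> \<open>The first \<open>K\<close> y variables are identified with the last
    \<open>K\<close> x variables and the others renumbered from 1; this builds \<open>K\<close>
    shared values into the point.\<close>
  define \<theta> :: "xy \<Rightarrow> xy" where
    "\<theta> v = (case v of Xv i \<Rightarrow> Xv i | Yv j \<Rightarrow> if j \<le> K then Xv (a + j) else Yv (j - K))" for v
  define r where "r = relabel \<theta> f"
  let ?V = "Xv ` {1..a + K} \<union> Yv ` {1..b}"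
  have pt: "xy_point s t \<circ> \<theta> = xy_point s (\<lambda>j. if j \<le> K then s (a + j) else t (j - K))" for s t :: "nat \<Rightarrow> rat"
  proof
    fix v show "(xy_point s t \<circ> \<theta>) v = xy_point s (\<lambda>j. if j \<le> K then s (a + j) else t (j - K)) v"
      by (cases v) (auto simp: \<theta>_def)
  qed
  have eval_r: "eval (xy_point s t) r = bval f (s ` {1..a + K}) (s ` {a + 1..a + K} \<union> t ` {1..b})"
    and card_B: "card (s ` {a + 1..a + K} \<union> t ` {1..b}) = K + b"
    if s: "inj_on s {1..a + K}" and t: "inj_on t {1..b}" and st: "s ` {a + 1..a + K} \<inter> t ` {1..b} = {}"
    for s t :: "nat \<Rightarrow> rat"
  proof -
    have "bij_betw (\<lambda>i. a + i) {1..K} {a + 1..a + K}"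
      by (rule bij_betwI[where g = "\<lambda>i. i - a"]) auto
    moreover have "bij_betw s {a + 1..a + K} (s ` {a + 1..a + K})"
      by (rule bij_betw_inj_image) (rule inj_on_subset[OF s], auto)
    ultimately have "bij_betw (s \<circ> (\<lambda>i. a + i)) {1..K} (s ` {a + 1..a + K})"
      by (rule bij_betw_trans)
    then have "bij_betw (\<lambda>i. s (a + i)) {1..K} (s ` {a + 1..a + K})" by (simp only: comp_def)
    from bij_betw_append[OF this bij_betw_inj_image[OF t] st]
    have b: "bij_betw (\<lambda>j. if j \<le> K then s (a + j) else t (j - K)) {1..K + b} (s ` {a + 1..a + K} \<union> t ` {1..b})" .
    show "eval (xy_point s t) r = bval f (s ` {1..a + K}) (s ` {a + 1..a + K} \<union> t ` {1..b})"
      using bval_eqI[OF f bij_betw_inj_image[OF s] b] by (simp add: r_def pt)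
    show "card (s ` {a + 1..a + K} \<union> t ` {1..b}) = K + b" using bij_betw_same_card[OF b] by simp
  qed
  \<comment> \<open>The pairs of unshared variables; the product of their differences evaluates to
    \<open>dprod (A - B) (B - A)\<close>.\<close>
  define E where "E = (\<lambda>(i, j). (Xv i, Yv j)) ` ({1..a} \<times> {1..b})"
  have "vdiff u v ^ 1 dvd r" if "(u, v) \<in> E" for u v
  proof -
    from that obtain i j where ij: "u = Xv i" "v = Yv j" "i \<in> {1..a}" "j \<in> {1..b}" by (auto simp: E_def)
    have "relabel (id(v := u)) r = 0"
    proof (rule eval_eq_zeroD_generic[of ?V "{}"])
      fix p :: "xy \<Rightarrow> rat" assume p: "inj_on p ?V"
      define s where "s = (\<lambda>i. p (Xv i))"
      \<comment> \<open>Letting an unshared y coordinate coincide with an unshared x coordinate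
        produces more than \<open>K\<close> shared values, so \<open>vanish\<close> applies.\<close>
      define t where "t = (\<lambda>j. p (Yv j))(j := s i)"
      have "p \<circ> id(v := u) = xy_point s t"
      proof
        fix w show "(p \<circ> id(v := u)) w = xy_point s t w"
          by (cases w) (auto simp: ij s_def t_def)
      qed
      then have ev: "eval p (relabel (id(v := u)) r) = eval (xy_point s t) r" by simp
      have X: "p (Xv i1) = p (Xv i2) \<longleftrightarrow> i1 = i2" if "i1 \<in> {1..a + K}" "i2 \<in> {1..a + K}" for i1 i2
        using inj_on_eq_iff[OF p, of "Xv i1" "Xv i2"] that by simp
      have Y: "p (Yv j1) = p (Yv j2) \<longleftrightarrow> j1 = j2" if "j1 \<in> {1..b}" "j2 \<in> {1..b}" for j1 j2
        using inj_on_eq_iff[OF p, of "Yv j1" "Yv j2"] that by simp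
      have XY: "p (Xv i1) \<noteq> p (Yv j1)" if "i1 \<in> {1..a + K}" "j1 \<in> {1..b}" for i1 j1
        using inj_on_eq_iff[OF p, of "Xv i1" "Yv j1"] that by simp
      have i: "i \<in> {1..a + K}" using ij by auto
      have s: "inj_on s {1..a + K}" by (rule inj_onI) (simp add: s_def X)
      have t: "inj_on t {1..b}"
      proof (rule inj_onI)
        fix j1 j2 assume "j1 \<in> {1..b}" "j2 \<in> {1..b}" "t j1 = t j2"
        then show "j1 = j2"
          using Y[of j1 j2] XY[OF i, of j1] XY[OF i, of j2] by (auto simp: t_def s_def split: if_splits)
      qed
      have st: "s ` {a + 1..a + K} \<inter> t ` {1..b} = {}"
      proof -
        have "s i1 \<noteq> t j1" if "i1 \<in> {a + 1..a + K}" "j1 \<in> {1..b}" for i1 j1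
          using X[of i1 i] XY[of i1 j1] i ij(3) that by (auto simp: t_def s_def)
        then show ?thesis by blast
      qed
      have "s i \<in> s ` {1..a + K}" "s i \<in> t ` {1..b}" "s i \<notin> s ` {a + 1..a + K}"
      proof -
        show "s i \<in> s ` {1..a + K}" using i by blast
        show "s i \<in> t ` {1..b}" using ij(4) by (intro image_eqI[of _ _ j]) (auto simp: t_def)
        then show "s i \<notin> s ` {a + 1..a + K}" using st by blast
      qed
      moreover have "s ` {a + 1..a + K} \<subseteq> s ` {1..a + K}" by (rule image_mono) auto
      ultimately have "insert (s i) (s ` {a + 1..a + K}) \<subseteq> s ` {1..a + K} \<inter> (s ` {a + 1..a + K} \<union> t ` {1..b})"
        by blast
      then have "card (insert (s i) (s ` {a + 1..a + K})) \<le> card (s ` {1..a + K} \<inter> (s ` {a + 1..a + K} \<union> t ` {1..b}))"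
        by (intro card_mono) auto
      moreover have "card (s ` {a + 1..a + K}) = K"
        by (subst card_image) (auto intro: inj_on_subset[OF s])
      ultimately have "card (s ` {1..a + K} \<inter> (s ` {a + 1..a + K} \<union> t ` {1..b})) > K"
        using \<open>s i \<notin> s ` {a + 1..a + K}\<close> by simp
      then have "bval f (s ` {1..a + K}) (s ` {a + 1..a + K} \<union> t ` {1..b}) = 0"
        using card_B[OF s t st] card_image[OF s] by (intro vanish) auto
      then show "eval p (relabel (id(v := u)) r) = 0" unfolding ev eval_r[OF s t st] .
    qed auto
    then show ?thesis by (simp add: vdiff_dvd_iff)
  qed
  then have "(\<Prod>(u, v)\<in>E. vdiff u v ^ 1) dvd r"
    by (intro prod_vdiff_power_dvd) (auto simp: E_def)
  then obtain q where q: "r = (\<Prod>(u, v)\<in>E. vdiff u v) * q" by (auto elim: dvdE)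
  have D0: "(\<Prod>(u, v)\<in>E. vdiff u v) \<noteq> 0" by (auto simp: E_def prod_zero_iff)
  have "vars q \<subseteq> ?V"
  proof (rule vars_factor[OF _ _ D0])
    show "vars (\<Prod>(u, v)\<in>E. vdiff u v) \<subseteq> ?V"
      unfolding case_prod_unfold by (intro vars_closure) (auto simp: E_def)
    show "vars ((\<Prod>(u, v)\<in>E. vdiff u v) * q) \<subseteq> ?V"
      unfolding q[symmetric] r_def
    proof (rule vars_relabel)
      fix v assume "v \<in> vars f"
      with f have "v \<in> Xv ` {1..a + K} \<union> Yv ` {1..K + b}" by (auto simp: bisym_polys.simps)
      then show "\<theta> v \<in> ?V"
      proof (elim UnE imageE)
        fix j assume j: "v = Yv j" "j \<in> {1..K + b}"
        show ?thesis
        proof (cases "j \<le> K")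
          case True
          with j show ?thesis by (simp add: \<theta>_def)
        next
          case False
          with j have "j - K \<in> {1..b}" by auto
          with False j show ?thesis by (simp add: \<theta>_def)
        qed
      qed (simp add: \<theta>_def)
    qed
  qed
  then have keys_q: "keys m \<subseteq> ?V" if "m \<in> keys q" for m
    using that by (auto simp: vars_def)
  define js1 where "js1 m = map (\<lambda>i. lookup m (Xv (Suc i))) [0..<a]" for m :: "xy \<Rightarrow>\<^sub>0 nat"
  define js2 where "js2 m = map (\<lambda>i. lookup m (Xv (a + Suc i))) [0..<K]" for m :: "xy \<Rightarrow>\<^sub>0 nat"
  define js3 where "js3 m = map (\<lambda>j. lookup m (Yv (Suc j))) [0..<b]" for m :: "xy \<Rightarrow>\<^sub>0 nat"
  \<comment> \<open>The number of orderings of the three blocks, over which the value is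
    averaged.\<close>
  define N :: rat where "N = fact a * fact K * fact b"
  define c where "c m = lookup q m / N" for m
  let ?mon = "\<lambda>js xs. \<Prod>t<length js. (xs ! t) ^ (js ! t) :: rat"
  have "bval f A B = dprod (A - B) (B - A) * (\<Sum>m\<in>keys q. c m * (monomial_sum (js1 m) (A - B) *
      monomial_sum (js2 m) (A \<inter> B) * monomial_sum (js3 m) (B - A)))"
    if AB: "finite A" "finite B" "card A = a + K" "card B = K + b" "card (A \<inter> B) = K" for A B
  proof -
    have cards: "card (A - B) = a" "card (B - A) = b"
      using AB card_Diff_subset_Int[of A B] card_Diff_subset_Int[of B A] by (auto simp: Int_commute)
    let ?P = "permutations_of_set (A - B)" and ?Q = "permutations_of_set (A \<inter> B)" and ?R = "permutations_of_set (B - A)"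
    have val: "bval f A B = dprod (A - B) (B - A) * (\<Sum>m\<in>keys q. lookup q m *
        (?mon (js1 m) xs * ?mon (js2 m) zs * ?mon (js3 m) ys))"
      if "xs \<in> ?P" "zs \<in> ?Q" "ys \<in> ?R" for xs zs ys
    proof -
      \<comment> \<open>\<open>A - B\<close> comes first and \<open>A \<inter> B\<close> last, where
        \<open>\<theta>\<close> expects the shared values.\<close>
      define s where "s i = (if i \<le> a then xs ! (i - 1) else zs ! (i - a - 1))" for i
      define t where "t j = ys ! (j - 1)" for j
      have bx: "bij_betw (\<lambda>i. xs ! (i - 1)) {1..a} (A - B)" and bz: "bij_betw (\<lambda>i. zs ! (i - 1)) {1..K} (A \<inter> B)"
        and bt: "bij_betw t {1..b} (B - A)"
        using permutations_of_set_bij[OF that(1)] permutations_of_set_bij[OF that(2)]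
          permutations_of_set_bij[OF that(3)] by (simp_all add: cards AB t_def[abs_def])
      have "(A - B) \<inter> (A \<inter> B) = {}" by auto
      from bij_betw_append[OF bx bz this] have bs: "bij_betw s {1..a + K} A"
        by (simp add: s_def[abs_def] Un_Diff_Int)
      have im1: "s ` {1..a} = A - B"
      proof -
        have "s ` {1..a} = (\<lambda>i. xs ! (i - 1)) ` {1..a}" by (intro image_cong) (auto simp: s_def)
        then show ?thesis using bx by (simp add: bij_betw_def)
      qed
      have im: "s ` {1..a + K} = A" "t ` {1..b} = B - A" and inj: "inj_on s {1..a + K}" "inj_on t {1..b}"
        using bs bt by (auto simp: bij_betw_def)
      have "{a + 1..a + K} = {1..a + K} - {1..a}" by auto
      then have "s ` {a + 1..a + K} = A - (A - B)"
        using inj_on_image_set_diff[OF inj(1), of "{1..a + K}" "{1..a}"] im im1 by simp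
      then have im2: "s ` {a + 1..a + K} = A \<inter> B" by auto
      have st: "s ` {a + 1..a + K} \<inter> t ` {1..b} = {}" unfolding im2 im by auto
      have "A \<inter> B \<union> (B - A) = B" by auto
      then have "bval f A B = eval (xy_point s t) r"
        unfolding eval_r[OF inj st] im2 im by simp
      also have "\<dots> = eval (xy_point s t) (\<Prod>(u, v)\<in>E. vdiff u v) * eval (xy_point s t) q"
        by (simp add: q)
      also have "eval (xy_point s t) (\<Prod>(u, v)\<in>E. vdiff u v) = dprod (A - B) (B - A)"
      proof -
        have "inj_on (\<lambda>(i, j). (Xv i, Yv j)) ({1..a} \<times> {1..b})" by (auto simp: inj_on_def)
        then have "eval (xy_point s t) (\<Prod>(u, v)\<in>E. vdiff u v) = (\<Prod>i\<in>{1..a}. \<Prod>j\<in>{1..b}. t j - s i)"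
          unfolding E_def by (subst prod.reindex) (auto simp: case_prod_unfold prod.cartesian_product)
        also have "\<dots> = dprod (s ` {1..a}) (t ` {1..b})"
          by (intro dprod_reindex inj inj_on_subset[OF inj(1)]) auto
        finally show ?thesis by (simp only: im1 im)
      qed
      also have "eval (xy_point s t) q = (\<Sum>m\<in>keys q. lookup q m *
          (?mon (js1 m) xs * ?mon (js2 m) zs * ?mon (js3 m) ys))"
        unfolding evl.subst_def
      proof (intro sum.cong[OF refl] arg_cong2[of _ _ _ _ "(*)", OF refl])
        fix m assume m: "m \<in> keys q"
        have "evl.power_prod (xy_point s t) m = (\<Prod>v\<in>?V. xy_point s t v ^ lookup m v)"
          by (rule evl.power_prod_superset[OF _ keys_q[OF m]]) simp
        also have "\<dots> = (\<Prod>v\<in>Xv ` {1..a + K}. xy_point s t v ^ lookup m v) *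
            (\<Prod>v\<in>Yv ` {1..b}. xy_point s t v ^ lookup m v)"
          by (rule prod.union_disjoint) auto
        also have "\<dots> = (\<Prod>i\<in>{1..a + K}. s i ^ lookup m (Xv i)) *
            (\<Prod>j\<in>{1..b}. t j ^ lookup m (Yv j))"
          by (simp add: prod.reindex inj_on_def)
        also have "(\<Prod>i\<in>{1..a + K}. s i ^ lookup m (Xv i)) =
            (\<Prod>i\<in>{1..a}. s i ^ lookup m (Xv i)) * (\<Prod>i\<in>{a + 1..a + K}. s i ^ lookup m (Xv i))"
        proof -
          have "{1..a + K} = {1..a} \<union> {a + 1..a + K}" by auto
          then show ?thesis by (simp only:) (rule prod.union_disjoint, auto)
        qed
        also have "(\<Prod>i\<in>{1..a}. s i ^ lookup m (Xv i)) = ?mon (js1 m) xs"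
          by (rule prod.reindex_bij_witness[where i = Suc and j = "\<lambda>i. i - 1"])
            (auto simp: js1_def s_def)
        also have "(\<Prod>i\<in>{a + 1..a + K}. s i ^ lookup m (Xv i)) = ?mon (js2 m) zs"
          by (rule prod.reindex_bij_witness[where i = "\<lambda>i. a + Suc i" and j = "\<lambda>i. i - a - 1"])
            (auto simp: js2_def s_def)
        also have "(\<Prod>j\<in>{1..b}. t j ^ lookup m (Yv j)) = ?mon (js3 m) ys"
          by (rule prod.reindex_bij_witness[where i = Suc and j = "\<lambda>i. i - 1"])
            (auto simp: js3_def t_def)
        finally show "evl.power_prod (xy_point s t) m = ?mon (js1 m) xs * ?mon (js2 m) zs * ?mon (js3 m) ys" .
      qed
      finally show ?thesis .
    qed
    have "N * bval f A B = (\<Sum>xs\<in>?P. \<Sum>zs\<in>?Q. \<Sum>ys\<in>?R. bval f A B)"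
      using AB cards by (simp add: N_def card_permutations_of_set mult.assoc)
    also have "\<dots> = (\<Sum>xs\<in>?P. \<Sum>zs\<in>?Q. \<Sum>ys\<in>?R. dprod (A - B) (B - A) *
        (\<Sum>m\<in>keys q. lookup q m * (?mon (js1 m) xs * ?mon (js2 m) zs * ?mon (js3 m) ys)))"
      by (intro sum.cong[OF refl] val)
    also have "\<dots> = dprod (A - B) (B - A) * (\<Sum>xs\<in>?P. \<Sum>zs\<in>?Q. \<Sum>ys\<in>?R.
        \<Sum>m\<in>keys q. lookup q m * (?mon (js1 m) xs * ?mon (js2 m) zs * ?mon (js3 m) ys))"
      by (simp only: sum_distrib_left)
    also have "(\<Sum>xs\<in>?P. \<Sum>zs\<in>?Q. \<Sum>ys\<in>?R.
        \<Sum>m\<in>keys q. lookup q m * (?mon (js1 m) xs * ?mon (js2 m) zs * ?mon (js3 m) ys)) =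
      (\<Sum>m\<in>keys q. \<Sum>xs\<in>?P. \<Sum>zs\<in>?Q. \<Sum>ys\<in>?R.
        lookup q m * (?mon (js1 m) xs * ?mon (js2 m) zs * ?mon (js3 m) ys))"
      by (subst (3) sum.swap, subst (2) sum.swap, subst sum.swap) (rule refl)
    also have "\<dots> = (\<Sum>m\<in>keys q. lookup q m * (monomial_sum (js1 m) (A - B) *
      monomial_sum (js2 m) (A \<inter> B) * monomial_sum (js3 m) (B - A)))"
      unfolding monomial_sum_def sum_triple_product ..
    also have "\<dots> = N * (\<Sum>m\<in>keys q. c m * (monomial_sum (js1 m) (A - B) *
      monomial_sum (js2 m) (A \<inter> B) * monomial_sum (js3 m) (B - A)))"
      unfolding sum_distrib_left by (intro sum.cong[OF refl]) (simp add: c_def N_def)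
    finally have "N * bval f A B = N * (dprod (A - B) (B - A) * (\<Sum>m\<in>keys q. c m *
      (monomial_sum (js1 m) (A - B) * monomial_sum (js2 m) (A \<inter> B) * monomial_sum (js3 m) (B - A))))"
      by (simp only: mult.left_commute)
    moreover have "N \<noteq> 0" by (simp add: N_def)
    ultimately show ?thesis by simp
  qed
  then show ?thesis
    by (intro exI[of _ "keys q"] exI[of _ c] exI[of _ js1] exI[of _ js2] exI[of _ js3])
      (simp add: js1_def js2_def js3_def)
qed

text \<open>\<open>K\<close> bounds the filtration step: values vanish from \<open>K\<close> shared
  elements on. A step removes the top layer by triple products with middle degree one less than the
  bound; at bound 0 the function is zero.\<close>

lemma single_in_range:
  assumes "f \<in> bisym_polys (m, n)"
    "\<And>A B. finite A \<Longrightarrow> finite B \<Longrightarrow> card A = m \<Longrightarrow> card B = n \<Longrightarrow> K \<le> card (A \<inter> B) \<Longrightarrow> bval f A B = 0"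
  shows "tA (single (m, n) f) \<in> range_T"
  using assms
proof (induction K arbitrary: f)
  case 0
  have "tA (single (m, n) f) = (\<lambda>A B. 0)"
    by (intro ext) (use 0 in \<open>simp add: tA_single\<close>)
  then show ?case by (simp add: range_T_closed)
next
  case (Suc K)
  show ?case
  proof (cases "K \<le> m \<and> K \<le> n")
    \<comment> \<open>Sets of these sizes cannot share \<open>K\<close> elements, so the stronger
      vanishing is vacuous.\<close>
    case False
    show ?thesis
    proof (rule Suc.IH[OF Suc.prems(1)])
      fix A B :: "rat set" assume "finite A" "finite B" "card A = m" "card B = n" "K \<le> card (A \<inter> B)"
      then show "bval f A B = 0"
        using False card_mono[of A "A \<inter> B"] card_mono[of B "A \<inter> B"] by auto
    qed
  next
    case True
    define a b where "a = m - K" and "b = n - K"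
    have mn: "m = a + K" "n = K + b" using True by (simp_all add: a_def b_def)
    have van: "bval f A B = 0"
      if "finite A" "finite B" "card A = a + K" "card B = K + b" "card (A \<inter> B) > K" for A B
      using Suc.prems(2)[OF that(1,2)] that(3-5) by (simp add: mn)
    have ex: "\<exists>M c js1 js2 js3. finite M \<and> (\<forall>m :: xy \<Rightarrow>\<^sub>0 nat.
      length (js1 m) = a \<and> length (js2 m) = K \<and> length (js3 m) = b) \<and>
      (\<forall>A B. finite A \<longrightarrow> finite B \<longrightarrow> card A = a + K \<longrightarrow> card B = K + b \<longrightarrow> card (A \<inter> B) = K \<longrightarrow>
        bval f A B = dprod (A - B) (B - A) * (\<Sum>m\<in>M. c m * (monomial_sum (js1 m) (A - B) *
          monomial_sum (js2 m) (A \<inter> B) * monomial_sum (js3 m) (B - A))))"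
      (is "\<exists>M c js1 js2 js3. ?P M c js1 js2 js3")
      by (rule bval_decompose[OF Suc.prems(1)[unfolded mn]]) (rule van)
    then obtain M c js1 js2 js3 where P: "?P M c js1 js2 js3" by (elim exE)
    have fin: "finite M" using P by (elim conjE)
    have len: "length (js1 k) = a" "length (js2 k) = K" "length (js3 k) = b" for k
      using P by (elim conjE, simp)+
    have val: "bval f A B = dprod (A - B) (B - A) * (\<Sum>k\<in>M. c k * (monomial_sum (js1 k) (A - B) *
          monomial_sum (js2 k) (A \<inter> B) * monomial_sum (js3 k) (B - A)))"
      if "finite A" "finite B" "card A = a + K" "card B = K + b" "card (A \<inter> B) = K" for A B
      using conjunct2[OF conjunct2[OF P], rule_format, OF that] .
    define \<Phi> where "\<Phi> A B = (\<Sum>k\<in>M. c k * conv (conv (tX (phi_prod (js1 k))) (tJ (phi_prod (js2 k)))) (tY (phi_prod (js3 k))) A B)" for A B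
    have \<Phi>: "\<Phi> \<in> range_T"
      unfolding \<Phi>_def[abs_def]
      by (intro range_T_sum range_T_closed(3) triple_in_range phi_prod_pt phi_prod_closed)
    then obtain U where U: "U \<in> carrier coha_tensor" "T2.timg U = \<Phi>" by (auto simp: range_T_def)
    from Psi_value_exists[OF U(1)] obtain G where G: "G \<in> carrier coha_A1" "tA G = \<Phi>" by (auto simp: U(2))
    \<comment> \<open>The supports of the triple products place all of \<open>\<Phi>\<close> in
      degree (m, n), so this component represents it.\<close>
    define g where "g = lookup G (m, n)"
    have g: "g \<in> bisym_polys (m, n)" using G(1) by (simp add: carrier_coha g_def)
    have \<Phi>0: "\<Phi> A B = 0" if "\<not> (finite A \<and> finite B \<and> card A = m \<and> card B = n \<and> card (A \<inter> B) \<le> K)" for A B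
      unfolding \<Phi>_def
    proof (intro sum.neutral ballI)
      fix k
      have "conv (conv (tX (phi_prod (js1 k))) (tJ (phi_prod (js2 k)))) (tY (phi_prod (js3 k))) A B = 0"
        using triple_phi_support[of "js1 k" "js2 k" "js3 k" A B] that by (auto simp: len mn)
      then show "c k * conv (conv (tX (phi_prod (js1 k))) (tJ (phi_prod (js2 k)))) (tY (phi_prod (js3 k))) A B = 0"
        by simp
    qed
    have bg: "bval g A B = \<Phi> A B" if "finite A" "finite B" "card A = m" "card B = n" for A B
      using that fun_cong[OF fun_cong[OF G(2), of A], of B] by (simp add: tA_def g_def)
    have tg: "tA (single (m, n) g) = \<Phi>"
    proof (intro ext)
      fix A B show "tA (single (m, n) g) A B = \<Phi> A B"
        using \<Phi>0[of A B] bg[of A B] by (auto simp: tA_single)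
    qed
    \<comment> \<open>The difference vanishes for exactly \<open>K\<close> shared elements because
      the leading terms agree, and for more because \<open>f\<close> and \<open>\<Phi>\<close> both
      vanish there.\<close>
    define f' where "f' = f + scale (- 1) g"
    have "tA (single (m, n) f') \<in> range_T"
    proof (rule Suc.IH)
      show "f' \<in> bisym_polys (m, n)" using Suc.prems(1) g by (simp add: f'_def)
      fix A B :: "rat set" assume *: "finite A" "finite B" "card A = m" "card B = n" "K \<le> card (A \<inter> B)"
      show "bval f' A B = 0"
      proof (cases "card (A \<inter> B) = K")
        case eq: True
        have cards: "card (A - B) = a" "card (B - A) = b"
          using * eq mn card_Diff_subset_Int[of A B] card_Diff_subset_Int[of B A] by (auto simp: Int_commute)
        have "\<Phi> A B = (\<Sum>k\<in>M. c k * (dprod (A - B) (B - A) * (monomial_sum (js1 k) (A - B) *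
          monomial_sum (js2 k) (A \<inter> B) * monomial_sum (js3 k) (B - A))))"
          unfolding \<Phi>_def using * eq cards by (simp add: triple_phi_diag len)
        also have "\<dots> = bval f A B"
          using * eq mn by (simp add: val sum_distrib_left mult_ac)
        finally show ?thesis using bg[OF *(1-4)] by (simp add: f'_def)
      next
        case False
        then show ?thesis using * Suc.prems(2)[of A B] bg[OF *(1-4)] \<Phi>0[of A B] by (simp add: f'_def)
      qed
    qed
    moreover have "tA (single (m, n) f) = (\<lambda>A B. tA (single (m, n) f') A B + \<Phi> A B)"
      unfolding tg[symmetric] by (intro ext) (simp add: tA_single f'_def)
    ultimately show ?thesis using \<Phi> by (simp add: range_T_closed(2))
  qed
qed

lemma tA_in_range:
  assumes F: "F \<in> carrier coha_A1"
  shows "tA F \<in> range_T"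
proof -
  have "tA (\<Sum>d\<in>K. h d) = (\<lambda>A B. \<Sum>d\<in>K. tA (h d) A B)" for h :: "nat \<times> nat \<Rightarrow> _" and K
    by (auto simp: tA_def lookup_sum bval_def fun_eq_iff intro!: sum.neutral)
  then have "tA F = (\<lambda>A B. \<Sum>d\<in>keys F. tA (single d (lookup F d)) A B)"
    using poly_mapping_sum_single[of F] by metis
  also have "\<dots> \<in> range_T"
  proof (rule range_T_sum)
    fix d assume "d \<in> keys F"
    obtain m n where d: "d = (m, n)" by (cases d)
    show "tA (single d (lookup F d)) \<in> range_T"
      unfolding d
    \<comment> \<open>The intersection has at most \<open>m\<close> elements, so this starting bound
      holds vacuously.\<close>
    proof (rule single_in_range[where K = "Suc m"])
      show "lookup F (m, n) \<in> bisym_polys (m, n)" using F by (simp add: carrier_coha)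
      fix A B :: "rat set" assume "finite A" "card A = m" "Suc m \<le> card (A \<inter> B)"
      then show "bval (lookup F (m, n)) A B = 0" using card_mono[of A "A \<inter> B"] by auto
    qed
  qed
  finally show ?thesis .
qed

text \<open>Source and target embed into the same convolution algebra and \<open>psi\<close> matches
  the images, so multiplicativity and injectivity are immediate; surjectivity is
  \<open>tA_in_range\<close>.\<close>

lemma Psi_iso: "Psi \<in> algebra_isos coha_tensor coha_A1"
proof -
  have mult: "psi (U \<otimes>\<^bsub>coha_tensor\<^esub> V) = psi U \<otimes>\<^bsub>coha_A1\<^esub> psi V"
    "psi (U \<oplus>\<^bsub>coha_tensor\<^esub> V) = psi U \<oplus>\<^bsub>coha_A1\<^esub> psi V"
    if "U \<in> carrier coha_tensor" "V \<in> carrier coha_tensor" for U V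
    using that by (auto intro!: A1.inj simp: psi A1.simps M2.simps)
  have one: "psi \<one>\<^bsub>coha_tensor\<^esub> = \<one>\<^bsub>coha_A1\<^esub>"
    by (auto intro!: A1.inj simp: psi A1.simps M2.simps)
  have "bij_betw psi (carrier coha_tensor) (carrier coha_A1)"
    unfolding bij_betw_def
  proof
    show "inj_on psi (carrier coha_tensor)"
      by (rule inj_onI) (metis M2.inj psi(2))
    show "psi ` carrier coha_tensor = carrier coha_A1"
    proof (intro equalityI subsetI)
      fix F assume F: "F \<in> carrier coha_A1"
      obtain U where U: "U \<in> carrier coha_tensor" "T2.timg U = tA F"
        using tA_in_range[OF F] by (auto simp: range_T_def)
      then have "psi U = F" using F by (intro A1.inj) (simp_all add: psi)
      with U(1) show "F \<in> psi ` carrier coha_tensor" by blast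
    qed (auto simp: psi)
  qed
  then have "bij_betw (restrict psi (carrier coha_tensor)) (carrier coha_tensor) (carrier coha_A1)"
    by (rule iffD1[OF bij_betw_cong, rotated]) simp
  then show ?thesis
    using psi_linear mult one
    unfolding Psi_eq algebra_isos_def ring_iso_def ring_hom_def
    by (simp add: psi)
qed

theorem proposition2p4:
  shows "Psi0 \<in> algebra_homs coha_J coha_A1_diag
    \<and> (\<forall>i. Psi0 (phi i) = Poly_Mapping.single (1, 1) (mvar (Xv 1) ^ i))
    \<and> (\<forall>f\<in>carrier coha_pt. \<forall>g\<in>carrier coha_J. \<forall>h\<in>carrier coha_pt.
         Psi (tensor3 f g h) = incl_X f \<otimes>\<^bsub>coha_A1\<^esub> Psi0 g \<otimes>\<^bsub>coha_A1\<^esub> incl_Y h)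
    \<and> is_algebra coha_tensor
    \<and> is_algebra coha_A1
    \<and> Psi \<in> algebra_isos coha_tensor coha_A1"
proof (intro conjI allI ballI)
  show "Psi0 \<in> algebra_homs coha_J coha_A1_diag" unfolding Psi0_eq by (rule psi0_hom)
  show "Psi0 (phi i) = Poly_Mapping.single (1, 1) (mvar (Xv 1) ^ i)" for i
    using phi_closed psi0_phi by (simp add: Psi0_eq)
  show "Psi (tensor3 f g h) = incl_X f \<otimes>\<^bsub>coha_A1\<^esub> Psi0 g \<otimes>\<^bsub>coha_A1\<^esub> incl_Y h"
    if "f \<in> carrier coha_pt" "g \<in> carrier coha_J" "h \<in> carrier coha_pt" for f g h
    using that by (simp add: Psi_eq timg_tensor3(1) psi_tensor3)
qed (rule M2.is_algebra A1.is_algebra Psi_iso)+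

end
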